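(* In the setting of the context, assume hypotheses (H1)--(H5) stated there, suppose that the sequence $P^n$ is exponentially tight of order $n$, and let $\mathbf\Pi$ be an LD limit point of the $P^n$. Then, for $a\in A$, $$\mathbf\Pi(a)=\frac{\sup_{g\in G_A(a)}w(g)}{\sup_{a'\in A}\ \sup_{g\in G_A(a')}w(g)}\,.$$
   Context: **Deviabilities.** Suprema over empty sets equal $0$. For a metric space $\mathbb E$, a deviability on $\mathbb E$ is a set function $\mathbf\Pi:\mathcal P(\mathbb E)\to[0,1]$ on the power set with $\mathbf\Pi(E)=\sup_{x\in E}\mathbf\Pi(x)$ for all $E\subset\mathbb E$, where $\mathbf\Pi(x)=\mathbf\Pi(\{x\})$ (the deviability density), such that $\sup_{x\in\mathbb E}\mathbf\Pi(x)=1$ and $\{x:\mathbf\Pi(x)\ge\gamma\}$ is compact for every $\gamma\in(0,1]$. A sequence $Q_n$ of Borel probability measures on $\mathbb E$ LD converges at rate $n$ to a deviability $\mathbf\Pi$ if $\lim_{n\to\infty}\bigl(\int_{\mathbb E}f(x)^nQ_n(dx)\bigr)^{1/n}=\sup_{x\in\mathbb E}f(x)\mathbf\Pi(x)$ for every bounded continuous $f:\mathbb E\to[0,\infty)$. The sequence $Q_n$ is exponentially tight of order $n$ if $\inf_{K}\limsup_{n\to\infty}Q_n(\mathbb E\setminus K)^{1/n}=0$, the infimum being over compact $K\subset\mathbb E$. An LD limit point of $Q_n$ is a deviability to which some subsequence $Q_{n'}$ LD converges at rate $n'$. **Setting.** $(\mathbb S,d)$ is a metric space; $\mathbb D(\mathbb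 R_+,\mathbb S)$ is the Skorohod space of right-continuous functions with left-hand limits. $X^n=(X^n_t,t\ge0)$, $n\in\mathbb N$, are stochastic processes with trajectories in $\mathbb D(\mathbb R_+,\mathbb S)$ defined on a complete probability space $(\Omega,\mathcal F,\mathbf P)$, and $P^n$ are Borel probability measures on $\mathbb S$ with $\mathbf P(X^n_t\in\Gamma)=P^n(\Gamma)$ for all Borel $\Gamma\subset\mathbb S$ and all $t\ge0$. **Hypotheses.** (H1) There exist versions of the regular conditional distributions $\mathbf P(X^n\in\cdot\,|X^n_0=x)$, $x\in\mathbb S$, such that whenever $x^n\to x$ with $x^n$ in the support of $P^n$, the distributions $\mathbf P(X^n\in\cdot\,|X^n_0=x^n)$ on $\mathbb D(\mathbb R_+,\mathbb S)$ LD converge at rate $n$ to a deviability $\mathbf\Pi_x$ on $\mathbb D(\mathbb R_+,\mathbb S)$ such that $\mathbf\Pi_x(X)=0$ unless $X$ is a continuous function. (Then $\mathbf\Pi_x(X)=0$ unless $X_0=x$.) (H2) $\mathbf\Pi_x(X)$ is upper semicontinuous in $(x,X)$, and $\bigcup_{x\in K}\{X:\mathbf\Pi_x(X)\ge\gamma\}$ is compact for all $\gamma\in(0,1]$ and all compact $K\subset\mathbb S$. (H3) For all $X\in\mathbb D(\mathbb R_+,\mathbb S)$ (and all $x\in\mathbb S$, $s\ge0$), $\mathbf\Pi_x(X)=\mathbf\Pi_x(\pi_s^{-1}(\pi_sX))\,\mathbf\Pi_{X_s}(\theta_sX)$, where $\pi_sX=(X_t,t\in[0,s])$ and $\theta_sX=(X_{s+t},t\ge0)$.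 Let $\Pi_{x,t}(y)=\sup\{\mathbf\Pi_x(X):X\in\mathbb D(\mathbb R_+,\mathbb S),X_t=y\}$ and $\Pi_{x,t}(\Gamma)=\sup_{y\in\Gamma}\Pi_{x,t}(y)$ for $\Gamma\subset\mathbb S$. (H4) There is a set $A\subset\mathbb S$ that is locally finite (every compact subset of $\mathbb S$ contains at most finitely many elements of $A$) such that: (1) if $\mathbf\Pi_x(X)=1$, then $\inf_{t\ge0}d(X_t,A)=0$; (2) if $X_t=a$ for all $t\ge0$, where $a\in A$, then $\mathbf\Pi_a(X)=1$; (3) if $a,a'\in A$, then $\Pi_{a,t}(a')>0$ for some $t>0$; (4) for any $\epsilon>0$ there exists $\delta>0$ such that if $d(x,A)<\delta$, then $\Pi_{x,s_0}(a)>1-\epsilon$ and $\Pi_{a,s_1}(x)>1-\epsilon$ for some $s_0>0$, $s_1>0$ and $a\in A$; (5) for any $x\in\mathbb S$ and $\epsilon>0$ there exist $\delta>0$, $t_0$ and $t_1$ such that $\Pi_{x,t_0}(x')>1-\epsilon$ and $\Pi_{x',t_1}(x)>1-\epsilon$ whenever $d(x,x')<\delta$. (H5) For any compact $K_1\subset\mathbb S$ and $\epsilon>0$ there exists a compact $K_2\subset\mathbb S$ such that $\limsup_{t\to\infty}\sup_{x\in K_1}\Pi_{x,t}(\mathbb S\setminus K_2)<\epsilon$. **Notation.** Under these hypotheses the limits $\Pi(x,y)=\lim_{t\to\infty}\Pi_{x,t}(y)$ exist for all $x,y\in\mathbb S$. **Graphs.** For $a\in A$, $G_A(a)$ denotes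 the set of directed graphs that are in-trees with root $a$ on the vertex set $A$; thus, for every $a'\in A$ there is a unique directed path from $a'$ to $a$ in the graph. For $g\in G_A(a)$, $E(g)$ is the set of edges of $g$. Each edge $e=(a',a'')\in E(g)$ is assigned the weight $v(e)=\Pi(a',a'')$, and $w(g)=\prod_{e\in E(g)}v(e)$ (if $E(g)$ is infinite, the product is defined as the infimum of finite products).
   Formalization: For infinite A the denominator is assumed nonzero (it can vanish, giving 0/0), and (H1) is assumed also along subsequences x^{n'} → x with x^{n'} in the support of P^{n'}, which follows from (H1) when every x in S is a limit of points x^n in the supports of P^n. *)

theory Defs
  imports "HOL-Probability.Probability" "Graph_Theory.Pair_Digraph"
begin

section \<open>The Skorohod space\<close>

text \<open>
  Trajectories on \<open>{0..}\<close> are represented by total functions on \<^typ>\<open>real\<close> that are constant on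
  \<open>{..0}\<close>; this makes the representation unique, and the requirements at \<open>t \<le> 0\<close> then
  add nothing beyond right-continuity at \<open>0\<close>.
\<close>

definition is_cadlag :: "(real \<Rightarrow> 's::topological_space) \<Rightarrow> bool" where
  "is_cadlag X \<longleftrightarrow>
     (\<forall>t. continuous (at_right t) X) \<and> (\<forall>t. \<exists>l. (X \<longlongrightarrow> l) (at_left t)) \<and> (\<forall>t<0. X t = X 0)"

typedef (overloaded) ('s::topological_space) cadlag = "{X :: real \<Rightarrow> 's. is_cadlag X}"
  morphisms traj Traj
  by (rule exI[of _ "\<lambda>_. undefined"]) (auto simp: is_cadlag_def)

setup_lifting type_definition_cadlag

definition time_change :: "(real \<Rightarrow> real) \<Rightarrow> bool" where
  "time_change l \<longleftrightarrow> strict_mono_on {0..} l \<and> l ` {0..} = {0..}"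

text \<open>
  The Skorohod (J1) topology. A sequence \<open>Y\<^sub>n\<close> converges to \<open>X\<close> in this topology iff there are
  time changes \<open>l\<^sub>n\<close> with \<open>sup\<^sub>t \<bar>l\<^sub>n t - t\<bar> \<longrightarrow> 0\<close> and, for every \<open>N\<close>,
  \<open>sup\<^bsub>t\<le>N\<^esub> d (Y\<^sub>n (l\<^sub>n t), X t) \<longrightarrow> 0\<close> (Jacod and Shiryaev, Theorem VI.1.14).
  The topology is metrizable, hence its open sets are the sequentially open ones for this
  convergence, and these are the sets containing, with each \<open>X\<close>, one of the sets
  \<open>{Y. skorohod_close e X Y}\<close> with \<open>e > 0\<close>.
\<close>

definition skorohod_close :: "real \<Rightarrow> 's::metric_space cadlag \<Rightarrow> 's cadlag \<Rightarrow> bool" where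
  "skorohod_close e X Y \<longleftrightarrow>
     (\<exists>l. time_change l \<and> (\<forall>t\<ge>0. \<bar>l t - t\<bar> < e) \<and>
          (\<forall>t\<in>{0..1 / e}. dist (traj Y (l t)) (traj X t) < e))"

lemma skorohod_close_mono:
  assumes "skorohod_close e X Y" "0 < e" "e \<le> e'"
  shows "skorohod_close e' X Y"
proof -
  obtain l where l: "time_change l" "\<And>t. t \<ge> 0 \<Longrightarrow> \<bar>l t - t\<bar> < e"
    "\<And>t. t \<in> {0..1 / e} \<Longrightarrow> dist (traj Y (l t)) (traj X t) < e"
    using assms(1) unfolding skorohod_close_def by blast
  have "1 / e' \<le> 1 / e"
    using assms(2,3) by (simp add: frac_le)
  then have "\<forall>t\<in>{0..1 / e'}. dist (traj Y (l t)) (traj X t) < e'"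
    using l(3) assms(3) by force
  moreover have "\<forall>t\<ge>0. \<bar>l t - t\<bar> < e'"
    using l(2) assms(3) by force
  ultimately show ?thesis
    using l(1) unfolding skorohod_close_def by blast
qed

instantiation cadlag :: (metric_space) topological_space
begin

definition open_cadlag :: "'a cadlag set \<Rightarrow> bool" where
  "open_cadlag U \<longleftrightarrow> (\<forall>X\<in>U. \<exists>e>0. \<forall>Y. skorohod_close e X Y \<longrightarrow> Y \<in> U)"

instance
proof
  show "open (UNIV :: 'a cadlag set)"
    unfolding open_cadlag_def by (auto intro: exI[of _ 1])
next
  fix S T :: "'a cadlag set"
  assume S: "open S" and T: "open T"
  show "open (S \<inter> T)"
    unfolding open_cadlag_def
  proof
    fix X assume "X \<in> S \<inter> T"
    then obtain d e where d: "d > 0" "\<And>Y. skorohod_close d X Y \<Longrightarrow> Y \<in> S"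
      and e: "e > 0" "\<And>Y. skorohod_close e X Y \<Longrightarrow> Y \<in> T"
      using S T unfolding open_cadlag_def by blast
    have "Y \<in> S \<inter> T" if "skorohod_close (min d e) X Y" for Y
      using d e skorohod_close_mono[OF that, of d] skorohod_close_mono[OF that, of e] by simp
    moreover have "min d e > 0"
      using d(1) e(1) by simp
    ultimately show "\<exists>e>0. \<forall>Y. skorohod_close e X Y \<longrightarrow> Y \<in> S \<inter> T"
      by blast
  qed
next
  fix K :: "'a cadlag set set"
  assume "\<forall>S\<in>K. open S"
  then show "open (\<Union>K)"
    unfolding open_cadlag_def by (meson UnionE UnionI)
qed

end

lift_definition shift_traj :: "real \<Rightarrow> 's::topological_space cadlag \<Rightarrow> 's cadlag"
  is "\<lambda>s X t. X (s + max 0 t)"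
proof -
  fix s :: real and X :: "real \<Rightarrow> 's"
  assume X: "is_cadlag X"
  let ?Z = "\<lambda>t. X (s + max 0 t)"
  have "(?Z \<longlongrightarrow> ?Z t) (at_right t)" for t
  proof (cases "t < 0")
    case True
    then have "eventually (\<lambda>u. ?Z u = ?Z t) (at_right t)"
      by (auto simp: eventually_at_right_field intro!: exI[of _ 0])
    then show ?thesis by (rule tendsto_eventually)
  next
    case False
    have "(X \<longlongrightarrow> X (s + t)) (at_right (s + t))"
      using X unfolding is_cadlag_def continuous_within by blast
    moreover have "filterlim (\<lambda>u. s + u) (at_right (s + t)) (at_right t)"
      by (auto simp: filterlim_at eventually_at_right_field intro!: tendsto_intros exI[of _ "t + 1"])
    ultimately have "((\<lambda>u. X (s + u)) \<longlongrightarrow> X (s + t)) (at_right t)"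
      by (rule filterlim_compose)
    moreover have "eventually (\<lambda>u. X (s + u) = ?Z u) (at_right t)"
      using False by (auto simp: eventually_at_right_field intro!: exI[of _ "t + 1"])
    ultimately have "(?Z \<longlongrightarrow> X (s + t)) (at_right t)"
      by (rule Lim_transform_eventually)
    then show ?thesis using False by (simp add: max_def)
  qed
  moreover have "\<exists>l. (?Z \<longlongrightarrow> l) (at_left t)" for t
  proof (cases "t \<le> 0")
    case True
    then have "eventually (\<lambda>u. ?Z u = X s) (at_left t)"
      by (auto simp: eventually_at_left_field intro!: exI[of _ "t - 1"])
    then show ?thesis by (intro exI[of _ "X s"]) (rule tendsto_eventually)
  next
    case False
    obtain l where "(X \<longlongrightarrow> l) (at_left (s + t))"
      using X unfolding is_cadlag_def by blast
    moreover have "filterlim (\<lambda>u. s + u) (at_left (s + t)) (at_left t)"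
      by (auto simp: filterlim_at eventually_at_left_field intro!: tendsto_intros exI[of _ "t - 1"])
    ultimately have "((\<lambda>u. X (s + u)) \<longlongrightarrow> l) (at_left t)"
      by (rule filterlim_compose)
    moreover have "eventually (\<lambda>u. X (s + u) = ?Z u) (at_left t)"
      using False by (auto simp: eventually_at_left_field intro!: exI[of _ 0])
    ultimately have "(?Z \<longlongrightarrow> l) (at_left t)"
      by (rule Lim_transform_eventually)
    then show ?thesis by blast
  qed
  moreover have "?Z t = ?Z 0" if "t < 0" for t
    using that by simp
  ultimately show "is_cadlag ?Z"
    unfolding is_cadlag_def continuous_within by blast
qed

definition same_upto :: "real \<Rightarrow> 's::topological_space cadlag \<Rightarrow> 's cadlag set" where
  \<comment> \<open>the set \<open>\<pi>\<^sub>s\<^sup>-\<^sup>1 (\<pi>\<^sub>s X)\<close>\<close>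
  "same_upto s X = {Y. \<forall>t\<in>{0..s}. traj Y t = traj X t}"

section \<open>Deviabilities and large deviation convergence\<close>

definition sup0 :: "real set \<Rightarrow> real" where
  \<comment> \<open>\<^term>\<open>Sup {} :: real\<close> is not \<open>0\<close> by definition\<close>
  "sup0 A = (if A = {} then 0 else Sup A)"

definition deviability :: "('e::topological_space set \<Rightarrow> real) \<Rightarrow> bool" where
  "deviability \<Phi> \<longleftrightarrow>
     (\<forall>E. \<Phi> E \<in> {0..1}) \<and>
     (\<forall>E. \<Phi> E = sup0 ((\<lambda>x. \<Phi> {x}) ` E)) \<and>
     sup0 (range (\<lambda>x. \<Phi> {x})) = 1 \<and>
     (\<forall>\<gamma>\<in>{0<..1}. compact {x. \<Phi> {x} \<ge> \<gamma>})"

definition borel_prob :: "'e::topological_space measure \<Rightarrow> bool" where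
  "borel_prob Q \<longleftrightarrow> prob_space Q \<and> sets Q = sets borel"

text \<open>
  The sequence of rates is a parameter because subsequences keep their original index as rate.
\<close>

definition ld_converges ::
    "(nat \<Rightarrow> 'e::topological_space measure) \<Rightarrow> (nat \<Rightarrow> nat) \<Rightarrow> ('e set \<Rightarrow> real) \<Rightarrow> bool" where
  "ld_converges Q r \<Phi> \<longleftrightarrow>
     deviability \<Phi> \<and>
     (\<forall>f. continuous_on UNIV f \<and> bounded (range f) \<and> (\<forall>x. 0 \<le> f x) \<longrightarrow>
        (\<lambda>k. root (r k) (\<integral>x. f x ^ r k \<partial>Q k)) \<longlonglongrightarrow> sup0 (range (\<lambda>x. f x * \<Phi> {x})))"

definition ld_limit_point ::
    "(nat \<Rightarrow> 'e::topological_space measure) \<Rightarrow> ('e set \<Rightarrow> real) \<Rightarrow> bool" where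
  "ld_limit_point Q \<Phi> \<longleftrightarrow> (\<exists>r. strict_mono r \<and> ld_converges (\<lambda>k. Q (r k)) r \<Phi>)"

definition exponentially_tight :: "(nat \<Rightarrow> 'e::topological_space measure) \<Rightarrow> bool" where
  "exponentially_tight Q \<longleftrightarrow>
     (INF K\<in>{K. compact K}. limsup (\<lambda>n. ereal (root n (measure (Q n) (UNIV - K))))) = 0"

definition msupport :: "'e::topological_space measure \<Rightarrow> 'e set" where
  "msupport Q = {x. \<forall>U. open U \<and> x \<in> U \<longrightarrow> emeasure Q U > 0}"

definition upper_semicontinuous :: "('e::topological_space \<Rightarrow> real) \<Rightarrow> bool" where
  "upper_semicontinuous f \<longleftrightarrow> (\<forall>c. open {x. f x < c})"

definition regular_conditional_distribution ::
    "'w measure \<Rightarrow> ('w \<Rightarrow> 'b::topological_space) \<Rightarrow> ('w \<Rightarrow> 'e::topological_space) \<Rightarrow>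
     ('e \<Rightarrow> 'b measure) \<Rightarrow> bool" where
  \<comment> \<open>\<open>\<kappa> x\<close> is a version of the law of \<open>Y\<close> given \<open>Z = x\<close>\<close>
  "regular_conditional_distribution M Y Z \<kappa> \<longleftrightarrow>
     \<kappa> \<in> borel \<rightarrow>\<^sub>M prob_algebra borel \<and>
     (\<forall>B\<in>sets borel. \<forall>\<Gamma>\<in>sets borel.
        emeasure M {\<omega> \<in> space M. Y \<omega> \<in> B \<and> Z \<omega> \<in> \<Gamma>} =
        (\<integral>\<^sup>+x\<in>\<Gamma>. emeasure (\<kappa> x) B \<partial>distr M borel Z))"

definition cadlag_process :: "'w measure \<Rightarrow> ('w \<Rightarrow> 's::metric_space cadlag) \<Rightarrow> bool" where
  "cadlag_process M X \<longleftrightarrow>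
     X \<in> M \<rightarrow>\<^sub>M borel \<and> (\<forall>t\<ge>0. (\<lambda>\<omega>. traj (X \<omega>) t) \<in> M \<rightarrow>\<^sub>M borel)"

section \<open>Time marginals and weighted in-trees\<close>

definition marginal ::
    "('s \<Rightarrow> 's::topological_space cadlag set \<Rightarrow> real) \<Rightarrow> 's \<Rightarrow> real \<Rightarrow> 's \<Rightarrow> real" where
  "marginal \<Phi> x t y = sup0 ((\<lambda>X. \<Phi> x {X}) ` {X. traj X t = y})"

definition marginal_set ::
    "('s \<Rightarrow> 's::topological_space cadlag set \<Rightarrow> real) \<Rightarrow> 's \<Rightarrow> real \<Rightarrow> 's set \<Rightarrow> real" where
  "marginal_set \<Phi> x t \<Gamma> = sup0 (marginal \<Phi> x t ` \<Gamma>)"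

definition limit_marginal ::
    "('s \<Rightarrow> 's::topological_space cadlag set \<Rightarrow> real) \<Rightarrow> 's \<Rightarrow> 's \<Rightarrow> real" where
  "limit_marginal \<Phi> x y = Lim at_top (\<lambda>t. marginal \<Phi> x t y)"

text \<open>
  Uniqueness is required of walks, not only of walks without repeated vertices, and the root is
  included: this excludes arcs leaving the root, loops and all other cycles.
\<close>

definition in_trees :: "'v set \<Rightarrow> 'v \<Rightarrow> 'v pair_pre_digraph set" where
  "in_trees A a =
     {g. pair_wf_digraph g \<and> pverts g = A \<and> a \<in> A \<and>
         (\<forall>a'\<in>A. \<exists>!p. pre_digraph.awalk (with_proj g) a' p a)}"

definition tree_weight ::
    "('s \<Rightarrow> 's::topological_space cadlag set \<Rightarrow> real) \<Rightarrow> 's pair_pre_digraph \<Rightarrow> real" where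
  "tree_weight \<Phi> g =
     (let v = (\<lambda>(a', a''). limit_marginal \<Phi> a' a'') in
      if finite (parcs g) then \<Prod>e\<in>parcs g. v e
      else INF F\<in>{F. finite F \<and> F \<subseteq> parcs g}. \<Prod>e\<in>F. v e)"

definition max_tree_weight ::
    "('s \<Rightarrow> 's::topological_space cadlag set \<Rightarrow> real) \<Rightarrow> 's set \<Rightarrow> 's \<Rightarrow> real" where
  "max_tree_weight \<Phi> A a = sup0 (tree_weight \<Phi> ` in_trees A a)"

end

theory Submission
  imports Defs
begin

text \<open>
  Let \<open>u\<close> be the restriction of \<open>\<Psi>\<close> to \<open>A\<close>, and let \<open>v b c\<close> be the largest deviability of a path from \<open>b\<close>
  to \<open>c\<close>, whatever its duration. For \<open>c\<close> in \<open>A\<close> this is the limit of the marginals at \<open>c\<close>, because a path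
  may wait at \<open>c\<close> for free. The claim is that \<open>u\<close> is proportional to \<open>T\<close>, the maximal weight of an
  in-tree as a function of its root; the constant is then found from \<open>sup u = 1\<close>.

  The inequalities \<open>u b * v b c \<le> u c\<close> do not determine \<open>u\<close>: since \<open>v b b = 1\<close>, the max-times kernel
  \<open>v\<close> has many invariant functions. What determines \<open>u\<close> is balance across cuts. For each \<open>B \<subseteq> A\<close> the
  supremum of \<open>u b * v b c\<close> over arcs leaving \<open>B\<close> equals the supremum over arcs entering \<open>B\<close>. The
  function \<open>T\<close> has this property for a combinatorial reason (\<open>max_arc_weight_cut\<close>): an in-tree with
  root \<open>b\<close> together with an arc \<open>(b, c)\<close> that leaves \<open>B\<close> contains a cycle, which returns to \<open>B\<close> by
  some arc \<open>(c', b')\<close>; without that arc it is an in-tree with root \<open>c'\<close>. Two functions that are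
  balanced on all cuts are proportional (\<open>max_balanced_ratio_le\<close>), since otherwise a cut between a high
  and a low level of their ratio would be unbalanced for one of them.

  Balance for \<open>u\<close> (\<open>cut_inequality\<close>) comes from stationarity. As \<open>X\<^sub>0\<close> and \<open>X\<^sub>t\<close> have the same law, the
  events \<open>X\<^sub>0 \<in> D, X\<^sub>t \<notin> D\<close> and \<open>X\<^sub>0 \<notin> D, X\<^sub>t \<in> D\<close> have the same probability for every \<open>n\<close>, hence the same
  exponential rate, and the large deviation hypotheses express the two rates by \<open>\<Psi>\<close> and the path
  deviabilities (\<open>flow_upper\<close>, \<open>flow_lower\<close>, \<open>flow_balance\<close>). For a given \<open>B\<close> the right \<open>D\<close> is the set of
  points from which \<open>B\<close> is reached only with deviability at most some \<open>\<rho> < 1\<close>, and \<open>t\<close> has to be large.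
  In a short time the boundary of \<open>D\<close> is crossed at no cost, and the balance says nothing. A long path,
  however, comes close to \<open>A\<close> (\<open>hitting_time\<close>), so that the flow out of \<open>D\<close> factors through a point
  \<open>a\<close> of \<open>A\<close>. If \<open>B\<close> violated the balance, this would make the flow out of \<open>D\<close> smaller than the flow into
  \<open>D\<close>, both for \<open>a \<in> B\<close> and for \<open>a \<notin> B\<close> (\<open>remote_outflow\<close>).

  All points that occur have \<open>\<Psi> {x} > 0\<close>. They are limits of points in the supports of the \<open>P n\<close>, so that
  the hypotheses on the conditional laws apply: paths from \<open>x\<close> are continuous and do start at \<open>x\<close>
  (\<open>continuous_path\<close>, \<open>path_starts_at\<close>).
\<close>

section \<open>In-trees and max-balanced weights\<close>

text \<open>
  Out-degrees and reachability, instead of unique walks, because these conditions are easy to follow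
  when single arcs are exchanged; \<open>in_trees_iff\<close> shows that they describe the same trees.
\<close>

definition in_tree_arcs :: "'v set \<Rightarrow> 'v \<Rightarrow> ('v \<times> 'v) set \<Rightarrow> bool" where
  "in_tree_arcs A a E \<longleftrightarrow> E \<subseteq> A \<times> A \<and> a \<in> A \<and> (\<forall>x. (a, x) \<notin> E) \<and> single_valued E \<and>
     (\<forall>x\<in>A. (x, a) \<in> E\<^sup>*)"

lemma pcas_imp_rtrancl: "pcas x p y \<Longrightarrow> set p \<subseteq> E \<Longrightarrow> (x, y) \<in> E\<^sup>*"
  by (induction p arbitrary: x) (auto intro: converse_rtrancl_into_rtrancl)

lemma rtrancl_imp_pcas: "(x, y) \<in> E\<^sup>* \<Longrightarrow> \<exists>p. pcas x p y \<and> set p \<subseteq> E"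
proof (induction rule: converse_rtrancl_induct)
  case base
  show ?case by (intro exI[of _ "[]"]) simp
next
  case (step x z)
  then obtain p where "pcas z p y" "set p \<subseteq> E" by blast
  with step(1) show ?case by (intro exI[of _ "(x, z) # p"]) simp
qed

lemma pcas_unique:
  assumes "single_valued E" "\<And>x. (a, x) \<notin> E"
  shows "pcas x p a \<Longrightarrow> set p \<subseteq> E \<Longrightarrow> pcas x q a \<Longrightarrow> set q \<subseteq> E \<Longrightarrow> p = q"
proof (induction p arbitrary: x q)
  case Nil
  then show ?case using assms(2) by (cases q) (auto simp: prod_eq_iff)
next
  case (Cons e p)
  from Cons.prems have x: "(x, snd e) \<in> E" by (metis list.set_intros(1) pcas.simps(2) prod.collapse subsetD)
  show ?case
  proof (cases q)
    case Nil
    with Cons.prems x show ?thesis using assms(2) by auto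
  next
    case (Cons f q')
    with Cons.prems have f: "(x, snd f) \<in> E"
      by (metis list.set_intros(1) pcas.simps(2) prod.collapse subsetD)
    with x have "snd e = snd f" using assms(1) by (auto simp: single_valued_def)
    moreover have "fst e = fst f" using Cons Cons.prems by simp
    ultimately have "e = f" by (simp add: prod_eq_iff)
    then show ?thesis using Cons.IH[of "snd e" q'] Cons Cons.prems by simp
  qed
qed

lemma in_trees_iff: "g \<in> in_trees A a \<longleftrightarrow> pverts g = A \<and> in_tree_arcs A a (parcs g)"
proof -
  have awalk: "pre_digraph.awalk (with_proj g) x p y \<longleftrightarrow> x \<in> pverts g \<and> set p \<subseteq> parcs g \<and> pcas x p y"
    for x p y
    by (simp add: pre_digraph.awalk_def cas_with_proj_eq)
  show ?thesis
  proof
    assume g: "g \<in> in_trees A a"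
    then have wf: "pair_wf_digraph g" and V: "pverts g = A" and a: "a \<in> A"
      unfolding in_trees_def by blast+
    have ex1: "\<exists>!p. set p \<subseteq> parcs g \<and> pcas x p a" if "x \<in> A" for x
    proof -
      have "\<exists>!p. pre_digraph.awalk (with_proj g) x p a"
        using g that unfolding in_trees_def by blast
      then show ?thesis unfolding awalk V using that by simp
    qed
    have sub: "parcs g \<subseteq> A \<times> A"
      using pair_wf_digraph.wellformed'[OF wf] V by auto
    have walk: "\<exists>p. set p \<subseteq> parcs g \<and> pcas x p a" if "x \<in> A" for x
      using ex1[OF that] by (rule ex1_implies_ex)
    have reach: "(x, a) \<in> (parcs g)\<^sup>*" if "x \<in> A" for x
      using walk[OF that] pcas_imp_rtrancl[of x _ a "parcs g"] by blast
    have "(a, x) \<notin> parcs g" for x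
    proof
      assume ax: "(a, x) \<in> parcs g"
      obtain p where "set p \<subseteq> parcs g" "pcas x p a" using walk[of x] sub ax by blast
      with ax have "set ((a, x) # p) \<subseteq> parcs g" "pcas a ((a, x) # p) a" by auto
      moreover have "set [] \<subseteq> parcs g" "pcas a [] a" by auto
      ultimately show False using ex1[OF a] by blast
    qed
    moreover have "single_valued (parcs g)"
    proof (rule single_valuedI)
      fix x y z assume xy: "(x, y) \<in> parcs g" and xz: "(x, z) \<in> parcs g"
      obtain p q where "set p \<subseteq> parcs g" "pcas y p a" "set q \<subseteq> parcs g" "pcas z q a"
        using walk[of y] walk[of z] sub xy xz by blast
      with xy xz have "set ((x, y) # p) \<subseteq> parcs g" "pcas x ((x, y) # p) a"
        "set ((x, z) # q) \<subseteq> parcs g" "pcas x ((x, z) # q) a" by auto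
      moreover have "x \<in> A" using xy sub by auto
      ultimately have "(x, y) # p = (x, z) # q" using ex1[of x] by blast
      then show "y = z" by simp
    qed
    ultimately show "pverts g = A \<and> in_tree_arcs A a (parcs g)"
      unfolding in_tree_arcs_def using sub V a reach by simp
  next
    assume "pverts g = A \<and> in_tree_arcs A a (parcs g)"
    then have V: "pverts g = A" and sub: "parcs g \<subseteq> A \<times> A" and a: "a \<in> A"
      and root: "\<And>x. (a, x) \<notin> parcs g" and sv: "single_valued (parcs g)"
      and reach: "\<And>x. x \<in> A \<Longrightarrow> (x, a) \<in> (parcs g)\<^sup>*"
      by (auto simp: in_tree_arcs_def)
    have "pair_wf_digraph g" using sub V by unfold_locales auto
    moreover have "\<exists>!p. set p \<subseteq> parcs g \<and> pcas x p a" if "x \<in> A" for x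
    proof (rule ex_ex1I)
      show "\<exists>p. set p \<subseteq> parcs g \<and> pcas x p a"
        using rtrancl_imp_pcas[OF reach[OF that]] by blast
      show "p = q" if "set p \<subseteq> parcs g \<and> pcas x p a" "set q \<subseteq> parcs g \<and> pcas x q a" for p q
        using pcas_unique[OF sv root, of x p q] that by blast
    qed
    ultimately show "g \<in> in_trees A a"
      using V a by (simp add: in_trees_def awalk)
  qed
qed

text \<open>
  The path from \<open>c\<close> to the root \<open>b\<close> enters \<open>B\<close> for the first time by some arc \<open>(c', b')\<close>. Replacing this
  arc by \<open>(b, c)\<close> moves the root to \<open>c'\<close>: a path that used to end in \<open>b\<close> goes on from \<open>b\<close> to \<open>c\<close> and
  then to \<open>c'\<close> along arcs whose heads lie outside \<open>B\<close>, which are not affected by the exchange.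
\<close>

lemma in_tree_arcs_exchange:
  assumes E: "in_tree_arcs A b E" and b: "b \<in> B" and c: "c \<in> A - B"
  obtains c' b' where "(c', b') \<in> E" "c' \<in> A - B" "b' \<in> B" "(b, c) \<notin> E"
    "in_tree_arcs A c' (insert (b, c) (E - {(c', b')}))"
proof -
  have sub: "E \<subseteq> A \<times> A" and bA: "b \<in> A" and root: "\<And>x. (b, x) \<notin> E" and sv: "single_valued E"
    and reach: "\<And>x. x \<in> A \<Longrightarrow> (x, b) \<in> E\<^sup>*"
    using E by (auto simp: in_tree_arcs_def)
  have "\<exists>c' b'. (c, c') \<in> (E \<inter> UNIV \<times> (- B))\<^sup>* \<and> (c', b') \<in> E \<and> c' \<notin> B \<and> b' \<in> B"
    if "(c, b) \<in> E\<^sup>*" "c \<notin> B" for c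
    using that
  proof (induction rule: converse_rtrancl_induct)
    case base
    then show ?case using b by blast
  next
    case (step x z)
    show ?case
    proof (cases "z \<in> B")
      case True
      with step show ?thesis by blast
    next
      case False
      with step obtain c' b' where *: "(z, c') \<in> (E \<inter> UNIV \<times> (- B))\<^sup>*" "(c', b') \<in> E" "c' \<notin> B" "b' \<in> B"
        by blast
      moreover have "(x, c') \<in> (E \<inter> UNIV \<times> (- B))\<^sup>*"
        using *(1) step(1) False by (intro converse_rtrancl_into_rtrancl[of x z]) auto
      ultimately show ?thesis by blast
    qed
  qed
  then obtain c' b' where path: "(c, c') \<in> (E \<inter> UNIV \<times> (- B))\<^sup>*"
    and arc: "(c', b') \<in> E" and c': "c' \<notin> B" and b': "b' \<in> B"
    using c reach[of c] by blast
  define E' where "E' = insert (b, c) (E - {(c', b')})"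
  have "E \<inter> UNIV \<times> (- B) \<subseteq> E'" using b' by (auto simp: E'_def)
  from rtrancl_mono[OF this] path have cc': "(c, c') \<in> E'\<^sup>*" by blast
  have "(x, c') \<in> E'\<^sup>*" if "(x, b) \<in> E\<^sup>*" for x
    using that
  proof (induction rule: converse_rtrancl_induct)
    case base
    have "(b, c) \<in> E'" by (simp add: E'_def)
    with cc' show ?case by (rule converse_rtrancl_into_rtrancl[rotated])
  next
    case (step x z)
    show ?case
    proof (cases "x = c'")
      case False
      then have "(x, z) \<in> E'" using step by (simp add: E'_def)
      with step show ?thesis by (blast intro: converse_rtrancl_into_rtrancl)
    qed simp
  qed
  moreover have "(c', x) \<notin> E'" for x
    using sv arc c' b by (auto simp: E'_def single_valued_def)
  moreover have "single_valued E'"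
    using sv root by (auto simp: E'_def single_valued_def)
  moreover have "E' \<subseteq> A \<times> A" using sub bA c by (auto simp: E'_def)
  moreover have "c' \<in> A" using arc sub by auto
  ultimately have "in_tree_arcs A c' E'"
    using reach by (simp add: in_tree_arcs_def)
  with that arc c' b' \<open>c' \<in> A\<close> root show thesis by (auto simp: E'_def)
qed

lemma in_tree_arcs_star:
  assumes "a \<in> A"
  shows "in_tree_arcs A a ((A - {a}) \<times> {a})"
proof -
  have "(x, a) \<in> ((A - {a}) \<times> {a})\<^sup>*" if "x \<in> A" for x
    using that by (cases "x = a") auto
  with assms show ?thesis by (auto simp: in_tree_arcs_def single_valued_def)
qed

text \<open>
  The product over \<open>E\<close> of weights in the unit interval, for infinite \<open>E\<close> as well; for finite \<open>E\<close> it is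
  the ordinary product (\<open>inf_prod_finite\<close>).
\<close>

definition inf_prod :: "('e \<Rightarrow> real) \<Rightarrow> 'e set \<Rightarrow> real" where
  "inf_prod v E = (INF F\<in>{F. finite F \<and> F \<subseteq> E}. \<Prod>e\<in>F. v e)"

lemma inf_prod_lower:
  assumes "\<And>e. e \<in> E \<Longrightarrow> 0 \<le> v e" "finite F" "F \<subseteq> E"
  shows "inf_prod v E \<le> (\<Prod>e\<in>F. v e)"
  unfolding inf_prod_def using assms
  by (intro cINF_lower bdd_belowI2[where m = 0] prod_nonneg) auto

lemma inf_prod_greatest:
  assumes "\<And>F. finite F \<Longrightarrow> F \<subseteq> E \<Longrightarrow> m \<le> (\<Prod>e\<in>F. v e)"
  shows "m \<le> inf_prod v E"
  unfolding inf_prod_def using assms by (intro cINF_greatest) auto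

lemma inf_prod_in_unit:
  assumes "\<And>e. e \<in> E \<Longrightarrow> 0 \<le> v e"
  shows "inf_prod v E \<in> {0..1}"
  using inf_prod_lower[of E v "{}"] inf_prod_greatest[of E 0 v] assms
  by (auto intro: prod_nonneg)

lemma inf_prod_finite:
  assumes "finite E" "\<And>e. e \<in> E \<Longrightarrow> v e \<in> {0..1}"
  shows "inf_prod v E = (\<Prod>e\<in>E. v e)"
proof (rule antisym)
  show "inf_prod v E \<le> (\<Prod>e\<in>E. v e)"
    using assms by (intro inf_prod_lower) auto
  show "(\<Prod>e\<in>E. v e) \<le> inf_prod v E"
  proof (rule inf_prod_greatest)
    fix F assume F: "finite F" "F \<subseteq> E"
    have "(\<Prod>e\<in>E. v e) = (\<Prod>e\<in>E - F. v e) * (\<Prod>e\<in>F. v e)"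
      using F assms(1) by (intro prod.subset_diff)
    also have "\<dots> \<le> 1 * (\<Prod>e\<in>F. v e)"
      using assms F by (intro mult_right_mono prod_le_1 prod_nonneg) auto
    finally show "(\<Prod>e\<in>E. v e) \<le> (\<Prod>e\<in>F. v e)" by simp
  qed
qed

lemma inf_prod_insert:
  assumes v: "\<And>e. e \<in> insert e0 E \<Longrightarrow> 0 < v e \<and> v e \<le> 1" and e0: "e0 \<notin> E"
  shows "inf_prod v (insert e0 E) = v e0 * inf_prod v E"
proof (rule antisym)
  have "inf_prod v (insert e0 E) / v e0 \<le> inf_prod v E"
  proof (rule inf_prod_greatest)
    fix F assume F: "finite F" "F \<subseteq> E"
    then have "inf_prod v (insert e0 E) \<le> (\<Prod>e\<in>insert e0 F. v e)"
      using v by (intro inf_prod_lower) (auto intro: less_imp_le)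
    also have "\<dots> = v e0 * (\<Prod>e\<in>F. v e)"
      using F e0 by (subst prod.insert) auto
    finally show "inf_prod v (insert e0 E) / v e0 \<le> (\<Prod>e\<in>F. v e)"
      using v[of e0] by (simp add: field_simps)
  qed
  then show "inf_prod v (insert e0 E) \<le> v e0 * inf_prod v E"
    using v[of e0] by (simp add: field_simps)
  show "v e0 * inf_prod v E \<le> inf_prod v (insert e0 E)"
  proof (rule inf_prod_greatest)
    fix F assume F: "finite F" "F \<subseteq> insert e0 E"
    have "inf_prod v E \<le> (\<Prod>e\<in>F - {e0}. v e)"
      using F v by (intro inf_prod_lower) (auto intro: less_imp_le)
    then have "v e0 * inf_prod v E \<le> v e0 * (\<Prod>e\<in>F - {e0}. v e)"
      using v[of e0] by simp
    also have "\<dots> \<le> (\<Prod>e\<in>F. v e)"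
    proof (cases "e0 \<in> F")
      case True
      then show ?thesis using F by (simp add: prod.remove[of F e0])
    next
      case False
      have "0 \<le> (\<Prod>e\<in>F. v e)" using F v by (intro prod_nonneg) (auto intro: less_imp_le)
      then show ?thesis using False v[of e0] by (simp add: mult_left_le_one_le)
    qed
    finally show "v e0 * inf_prod v E \<le> (\<Prod>e\<in>F. v e)" .
  qed
qed

lemma sup0_upper:
  assumes "x \<in> S" "\<And>y. y \<in> S \<Longrightarrow> y \<le> (c::real)"
  shows "x \<le> sup0 S"
  using assms by (auto simp: sup0_def intro!: cSup_upper bdd_aboveI)

lemma sup0_least:
  assumes "\<And>y. y \<in> S \<Longrightarrow> y \<le> c" "0 \<le> c"
  shows "sup0 S \<le> c"
  using assms by (auto simp: sup0_def intro!: cSup_least)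

lemma less_sup0E:
  assumes "c < sup0 S" "0 \<le> c"
  obtains y where "y \<in> S" "c < y"
  using assms sup0_least[of S c] by (meson linorder_not_le)

lemma sup0_nonneg:
  assumes "\<And>y. y \<in> S \<Longrightarrow> 0 \<le> y" "\<And>y. y \<in> S \<Longrightarrow> y \<le> (c::real)"
  shows "0 \<le> sup0 S"
proof (cases "S = {}")
  case False
  then obtain y where "y \<in> S" by blast
  with assms sup0_upper[OF this] show ?thesis by (meson order_trans)
qed (simp add: sup0_def)

definition max_arc_weight :: "('v \<times> 'v \<Rightarrow> real) \<Rightarrow> 'v set \<Rightarrow> 'v \<Rightarrow> real" where
  "max_arc_weight v A a = sup0 (inf_prod v ` {E. in_tree_arcs A a E})"

text \<open>
  Multiplying the weight of an in-tree with root \<open>b\<close> by \<open>v (b, c)\<close> gives the weight of a graph with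
  one cycle. The same graph is an in-tree with root \<open>c'\<close> together with an arc from \<open>c'\<close> into \<open>B\<close>, so
  every flow out of \<open>B\<close> is matched by a flow into \<open>B\<close>.
\<close>

lemma max_arc_weight_cut:
  assumes v: "\<And>x y. x \<in> A \<Longrightarrow> y \<in> A \<Longrightarrow> 0 < v (x, y) \<and> v (x, y) \<le> 1"
    and b: "b \<in> A" "b \<in> B" and c: "c \<in> A - B"
    and M: "\<And>c' b'. c' \<in> A - B \<Longrightarrow> b' \<in> A \<inter> B \<Longrightarrow> max_arc_weight v A c' * v (c', b') \<le> M"
  shows "max_arc_weight v A b * v (b, c) \<le> M"
proof -
  have bnd: "0 \<le> inf_prod v E \<and> inf_prod v E \<le> 1" if "in_tree_arcs A a E" for a E
    
  proof -
    have "0 \<le> v e" if "e \<in> E" for e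
      using v[of "fst e" "snd e"] that \<open>in_tree_arcs A a E\<close> by (auto simp: in_tree_arcs_def)
    from inf_prod_in_unit[of E v, OF this] show ?thesis by simp
  qed
  have "inf_prod v E \<le> M / v (b, c)" if E: "in_tree_arcs A b E" for E
  proof -
    from in_tree_arcs_exchange[OF E b(2) c] obtain c' b' where e: "(c', b') \<in> E" "c' \<in> A - B" "b' \<in> B"
      "(b, c) \<notin> E" "in_tree_arcs A c' (insert (b, c) (E - {(c', b')}))"
      by metis
    let ?D = "E - {(c', b')}"
    have sub: "E \<subseteq> A \<times> A" using E by (auto simp: in_tree_arcs_def)
    then have pos: "0 < v e \<and> v e \<le> 1" if "e \<in> E" for e
      using v[of "fst e" "snd e"] that by auto
    have "inf_prod v E * v (b, c) = inf_prod v (insert (c', b') ?D) * v (b, c)"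
      using e by (simp add: insert_absorb)
    also have "\<dots> = v (c', b') * inf_prod v ?D * v (b, c)"
      using e pos by (subst inf_prod_insert) auto
    also have "\<dots> = inf_prod v (insert (b, c) ?D) * v (c', b')"
      using e pos v[of b c] b c by (subst inf_prod_insert) auto
    also have "\<dots> \<le> max_arc_weight v A c' * v (c', b')"
    proof (rule mult_right_mono)
      show "inf_prod v (insert (b, c) ?D) \<le> max_arc_weight v A c'"
        unfolding max_arc_weight_def using e bnd by (intro sup0_upper[where c = 1]) auto
      show "0 \<le> v (c', b')" using pos[OF e(1)] by simp
    qed
    also have "\<dots> \<le> M" using e sub by (intro M) auto
    finally show ?thesis using v[of b c] b c by (simp add: field_simps)
  qed
  moreover have "0 \<le> M / v (b, c)"
  proof -
    have "0 \<le> max_arc_weight v A c"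
      unfolding max_arc_weight_def using bnd by (intro sup0_nonneg[where c = 1]) auto
    then have "0 \<le> max_arc_weight v A c * v (c, b)" using v[of c b] b c by simp
    also have "\<dots> \<le> M" using M[of c b] b c by simp
    finally show ?thesis using v[of b c] b c by simp
  qed
  ultimately have "max_arc_weight v A b \<le> M / v (b, c)"
    unfolding max_arc_weight_def by (intro sup0_least) auto
  then show ?thesis using v[of b c] b c by (simp add: field_simps)
qed

text \<open>
  If \<open>T / u\<close> is at least \<open>l\<close> on \<open>B\<close> and below \<open>l\<close> outside, then the flow of \<open>T\<close> out of \<open>B\<close> is at least \<open>l\<close>
  times that of \<open>u\<close>, and its flow into \<open>B\<close> is less than \<open>l\<close> times that of \<open>u\<close>. The last inequality has to
  be strict for suprema over infinitely many arcs. This is where finiteness of \<open>{x \<in> A. \<gamma> \<le> u x}\<close> enters: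
  only finitely many tails can carry half of the flow or more.
\<close>

lemma max_balanced_ratio_le:
  fixes u T :: "'v \<Rightarrow> real"
  assumes v: "\<And>x y. x \<in> A \<Longrightarrow> y \<in> A \<Longrightarrow> 0 < v (x, y) \<and> v (x, y) \<le> (1::real)"
    and u: "\<And>x. x \<in> A \<Longrightarrow> 0 < u x \<and> u x \<le> 1"
    and T: "\<And>x. x \<in> A \<Longrightarrow> 0 \<le> T x"
    and fin: "\<And>\<gamma>. 0 < \<gamma> \<Longrightarrow> finite {x \<in> A. \<gamma> \<le> u x}"
    and u_cut: "\<And>B b c M. B \<subseteq> A \<Longrightarrow> b \<in> B \<Longrightarrow> c \<in> A - B \<Longrightarrow>
      (\<And>c' b'. c' \<in> A - B \<Longrightarrow> b' \<in> B \<Longrightarrow> u c' * v (c', b') \<le> M) \<Longrightarrow> u b * v (b, c) \<le> M"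
    and T_cut: "\<And>B b c M. B \<subseteq> A \<Longrightarrow> b \<in> B \<Longrightarrow> c \<in> A - B \<Longrightarrow>
      (\<And>c' b'. c' \<in> A - B \<Longrightarrow> b' \<in> B \<Longrightarrow> T c' * v (c', b') \<le> M) \<Longrightarrow> T b * v (b, c) \<le> M"
    and a: "a1 \<in> A" "a2 \<in> A"
  shows "T a1 / u a1 \<le> T a2 / u a2"
proof (rule ccontr)
  assume gt: "\<not> ?thesis"
  define l where "l = T a1 / u a1"
  have l: "T a2 / u a2 < l" using gt by (simp add: l_def)
  then have l0: "0 < l" using T[OF a(2)] u[OF a(2)] by (smt (verit) divide_nonneg_pos)
  define B where "B = {x \<in> A. l \<le> T x / u x}"
  have B: "B \<subseteq> A" "a1 \<in> B" "a2 \<in> A - B" using a l by (auto simp: B_def l_def)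
  define S where "S = (SUP (c, b)\<in>(A - B) \<times> B. u c * v (c, b))"
  have bdd: "bdd_above ((\<lambda>(c, b). u c * v (c, b)) ` ((A - B) \<times> B))"
  proof (rule bdd_aboveI2[where M = 1])
    fix x assume "x \<in> (A - B) \<times> B"
    then have "u (fst x) \<le> 1" "0 \<le> v x" "v x \<le> 1"
      using u v[of "fst x" "snd x"] B(1) by (auto intro: less_imp_le)
    then have "u (fst x) * v x \<le> 1" by (rule mult_le_one)
    then show "(case x of (c, b) \<Rightarrow> u c * v (c, b)) \<le> 1" by (simp add: case_prod_beta)
  qed
  have S: "u c * v (c, b) \<le> S" if "c \<in> A - B" "b \<in> B" for c b
    unfolding S_def using that bdd cSUP_upper[of "(c, b)" "(A - B) \<times> B" "\<lambda>(c, b). u c * v (c, b)"] by auto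
  have "0 < u a2 * v (a2, a1)" using u v a by simp
  with S[OF B(3,2)] have S0: "0 < S" by simp
  \<comment> \<open>tails outside \<open>F\<close> carry at most half of the flow of \<open>u\<close>, whence the value \<open>l / 2\<close> below\<close>
  define F where "F = {c \<in> A - B. S / 2 \<le> u c}"
  have "finite F" using fin[of "S / 2"] S0 by (auto simp: F_def elim: rev_finite_subset)
  define l' where "l' = Max (insert (l / 2) ((\<lambda>c. T c / u c) ` F))"
  have l': "l' < l"
    unfolding l'_def using \<open>finite F\<close> l0 by (subst Max_less_iff) (auto simp: F_def B_def)
  have l'0: "l / 2 \<le> l'" "\<And>c. c \<in> F \<Longrightarrow> T c / u c \<le> l'"
    unfolding l'_def using \<open>finite F\<close> by (intro Max_ge; blast)+
  have T_le: "T c * v (c, b) \<le> l' * S" if c: "c \<in> A - B" and b: "b \<in> B" for c b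
  proof (cases "c \<in> F")
    case True
    from c have uc: "u c > 0" using u by auto
    have "T c \<le> l' * u c" using l'0(2)[OF True] uc by (simp add: field_simps)
    then have "T c * v (c, b) \<le> l' * u c * v (c, b)" using v c b B by (intro mult_right_mono) (auto intro: less_imp_le)
    also have "\<dots> \<le> l' * S" using S[OF c b] l'0(1) l0 by simp
    finally show ?thesis .
  next
    case False
    then have "u c \<le> S / 2" using c by (auto simp: F_def)
    moreover have "T c \<le> l * u c" using c u[of c] by (auto simp: B_def field_simps)
    ultimately have "T c \<le> l * (S / 2)" using l0 by (smt (verit) mult_left_mono)
    moreover have "T c * v (c, b) \<le> T c" using T[of c] v[of c b] c b B by (auto intro!: mult_left_le)
    moreover have "l * (S / 2) \<le> l' * S" using l'0(1) S0 by simp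
    ultimately show ?thesis by linarith
  qed
  have "u b * v (b, c) \<le> l' / l * S" if b: "b \<in> B" and c: "c \<in> A - B" for b c
  proof -
    have "l * u b \<le> T b" using b u[of b] by (auto simp: B_def field_simps)
    then have "l * u b * v (b, c) \<le> T b * v (b, c)"
      using v b c B by (intro mult_right_mono) (auto intro: less_imp_le)
    also have "\<dots> \<le> l' * S" using T_cut[OF B(1) b c T_le] by simp
    finally show ?thesis using l0 by (simp add: field_simps)
  qed
  then have K: "u c * v (c, b) \<le> l' / l * S" if "c \<in> A - B" "b \<in> B" for b c
    using u_cut[of "A - B" c b "l' / l * S"] that B(1) by (auto simp: double_diff)
  define K where "K = l' / l * S"
  have "S \<le> K"
    using K unfolding K_def[symmetric]
    unfolding S_def using B(2,3) by (intro cSUP_least) auto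
  then have "S \<le> l' / l * S" by (simp add: K_def)
  moreover have "l' / l * S < 1 * S" using l' l0 S0 by (intro mult_strict_right_mono) auto
  ultimately show False by simp
qed

section \<open>Paths and continuous path functionals\<close>

definition bump :: "'a::metric_space set \<Rightarrow> real \<Rightarrow> 'a \<Rightarrow> real" where
  "bump S r x = max 0 (1 - infdist x S / r)"

lemma bump_nonneg: "0 \<le> bump S r x"
  by (simp add: bump_def)

lemma bump_le_1: "0 < r \<Longrightarrow> bump S r x \<le> 1"
  by (simp add: bump_def infdist_nonneg)

lemma bump_eq_1: "x \<in> S \<Longrightarrow> bump S r x = 1"
  by (simp add: bump_def)

lemma bump_pos_iff: "0 < r \<Longrightarrow> 0 < bump S r x \<longleftrightarrow> infdist x S < r"
  by (simp add: bump_def field_simps less_max_iff_disj)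

lemma bump_mono: "0 < r \<Longrightarrow> r \<le> r' \<Longrightarrow> bump S r x \<le> bump S r' x"
  unfolding bump_def by (intro max.mono order_refl diff_left_mono divide_left_mono infdist_nonneg) auto

lemma bump_lipschitz:
  assumes "0 < r"
  shows "\<bar>bump S r x - bump S r y\<bar> \<le> dist x y / r"
proof -
  have "\<bar>infdist x S / r - infdist y S / r\<bar> \<le> dist x y / r"
    using infdist_triangle_abs[of x S y] assms by (simp add: field_simps flip: diff_divide_distrib)
  then show ?thesis by (auto simp: bump_def max_def)
qed

lemma continuous_bump: "continuous_on S (bump E \<rho>)" if "0 < \<rho>"
  unfolding bump_def[abs_def] using that by (intro continuous_intros) auto

text \<open>
  Evaluation at time \<open>t\<close> is not continuous in the Skorohod topology. The supremum of \<open>f\<close> along the path,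
  damped by a Lipschitz window around \<open>t\<close>, is continuous, because a time change that is close to the
  identity moves the window only a little. It bounds \<open>f\<close> at time \<open>t\<close> from above, and with \<open>1 - f\<close> in
  place of \<open>f\<close> it yields lower bounds. For paths that are continuous at \<open>t\<close> nothing is lost in the limit
  of small windows.
\<close>

definition window_sup :: "('s::metric_space \<Rightarrow> real) \<Rightarrow> real \<Rightarrow> real \<Rightarrow> 's cadlag \<Rightarrow> real" where
  "window_sup f t r X = (SUP s\<in>{0..}. f (traj X s) * bump {t} r s)"

locale unit_function =
  fixes f :: "'s::metric_space \<Rightarrow> real"
  assumes nonneg: "0 \<le> f x" and le_1: "f x \<le> 1"
begin

lemma term_le_1: "0 < r \<Longrightarrow> f x * bump {t} r s \<le> 1"
  by (intro mult_le_one nonneg le_1 bump_nonneg bump_le_1)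

lemma window_sup_upper:
  assumes "0 < r" "0 \<le> s"
  shows "f (traj X s) * bump {t} r s \<le> window_sup f t r X"
  unfolding window_sup_def using assms
  by (intro cSUP_upper bdd_aboveI2[where M = 1] term_le_1) auto

lemma window_sup_least:
  assumes "0 < r" "0 \<le> c" "\<And>s. 0 \<le> s \<Longrightarrow> \<bar>s - t\<bar> < r \<Longrightarrow> f (traj X s) \<le> c"
  shows "window_sup f t r X \<le> c"
  unfolding window_sup_def
proof (rule cSUP_least)
  fix s :: real assume s: "s \<in> {0..}"
  show "f (traj X s) * bump {t} r s \<le> c"
  proof (cases "\<bar>s - t\<bar> < r")
    case True
    then have "f (traj X s) * bump {t} r s \<le> f (traj X s) * 1"
      using assms(1) by (intro mult_left_mono bump_le_1 nonneg)
    also have "\<dots> \<le> c" using assms(3)[of s] True s by simp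
    finally show ?thesis .
  next
    case False
    then have "bump {t} r s = 0" using assms(1) bump_pos_iff[of r "{t}" s] bump_nonneg[of "{t}" r s]
      by (auto simp: dist_real_def)
    then show ?thesis using assms(2) by simp
  qed
qed simp

lemma window_sup_nonneg: "0 < r \<Longrightarrow> 0 \<le> window_sup f t r X"
  using window_sup_upper[of r 0 X t] nonneg[of "traj X 0"] bump_nonneg[of "{t}" r 0]
  by (meson mult_nonneg_nonneg order_refl order_trans)

lemma window_sup_le_1: "0 < r \<Longrightarrow> window_sup f t r X \<le> 1"
  by (intro window_sup_least le_1) auto

lemma window_sup_ge: "0 < r \<Longrightarrow> 0 \<le> t \<Longrightarrow> f (traj X t) \<le> window_sup f t r X"
  using window_sup_upper[of r t X t] by (simp add: bump_eq_1)

lemma window_sup_posE: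
  assumes "0 < window_sup f t r X" "0 < r"
  obtains s where "0 \<le> s" "\<bar>s - t\<bar> < r" "0 < f (traj X s)"
  using window_sup_least[of r 0 t X] assms by (meson linorder_not_le order_refl)

lemma window_sup_close:
  assumes lip: "\<And>x y. \<bar>f x - f y\<bar> \<le> L * dist x y" and L: "0 \<le> L" and r: "0 < r" and t: "0 \<le> t"
    and close: "skorohod_close e X Y" and e: "0 < e" "t + r + e \<le> 1 / e"
  shows "\<bar>window_sup f t r Y - window_sup f t r X\<bar> \<le> (L + 1 / r) * e"
proof -
  from close obtain l where l: "time_change l" "\<And>s. s \<ge> 0 \<Longrightarrow> \<bar>l s - s\<bar> < e"
    "\<And>s. s \<in> {0..1 / e} \<Longrightarrow> dist (traj Y (l s)) (traj X s) < e"
    unfolding skorohod_close_def by blast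
  have l_onto: "l ` {0..} = {0..}" using l(1) by (simp add: time_change_def)
  have step: "\<bar>f (traj Y (l s)) * bump {t} r (l s) - f (traj X s) * bump {t} r s\<bar> \<le> (L + 1 / r) * e"
    if s: "0 \<le> s" "s \<le> 1 / e" for s
  proof -
    have "\<bar>f (traj Y (l s)) - f (traj X s)\<bar> \<le> L * e"
      using lip[of "traj Y (l s)" "traj X s"] l(3)[of s] s L
      by (smt (verit) atLeastAtMost_iff mult_left_mono)
    then have 1: "\<bar>(f (traj Y (l s)) - f (traj X s)) * bump {t} r (l s)\<bar> \<le> L * e"
      using mult_mono[of "\<bar>f (traj Y (l s)) - f (traj X s)\<bar>" "L * e" "bump {t} r (l s)" 1]
        bump_nonneg[of "{t}" r "l s"] bump_le_1[OF r, of "{t}" "l s"] L e(1) by (simp add: abs_mult)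
    have "\<bar>bump {t} r (l s) - bump {t} r s\<bar> \<le> \<bar>l s - s\<bar> / r"
      using bump_lipschitz[OF r, of "{t}" "l s" s] by (simp add: dist_real_def)
    also have "\<dots> \<le> e / r" using l(2)[OF s(1)] r by (simp add: divide_right_mono less_imp_le)
    finally have 2: "\<bar>f (traj X s) * (bump {t} r (l s) - bump {t} r s)\<bar> \<le> e / r"
      using mult_mono[of "f (traj X s)" 1 "\<bar>bump {t} r (l s) - bump {t} r s\<bar>" "e / r"]
        nonneg[of "traj X s"] le_1[of "traj X s"] by (simp add: abs_mult)
    have "f (traj Y (l s)) * bump {t} r (l s) - f (traj X s) * bump {t} r s =
      (f (traj Y (l s)) - f (traj X s)) * bump {t} r (l s) + f (traj X s) * (bump {t} r (l s) - bump {t} r s)"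
      by (simp add: algebra_simps)
    with 1 2 show ?thesis by (simp add: algebra_simps)
  qed
  have zero: "bump {t} r s = 0" if "t + r \<le> s" for s
    using that bump_pos_iff[OF r, of "{t}" s] bump_nonneg[of "{t}" r s] by (auto simp: dist_real_def)
  have K: "0 \<le> (L + 1 / r) * e" using L r e(1) by simp
  have "window_sup f t r Y \<le> window_sup f t r X + (L + 1 / r) * e"
    unfolding window_sup_def[of f t r Y]
  proof (rule cSUP_least)
    fix s' :: real assume "s' \<in> {0..}"
    then obtain s where s: "0 \<le> s" "s' = l s" using l_onto by (metis atLeast_iff imageE)
    show "f (traj Y s') * bump {t} r s' \<le> window_sup f t r X + (L + 1 / r) * e"
    proof (cases "s \<le> 1 / e")
      case True
      show ?thesis
        using step[OF s(1) True] window_sup_upper[OF r s(1), of X t] unfolding s(2) by linarith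
    next
      case False
      then have "t + r \<le> s'" using l(2)[OF s(1)] e s by linarith
      then show ?thesis using zero window_sup_nonneg[OF r, of t X] K by simp
    qed
  qed simp
  moreover have "window_sup f t r X \<le> window_sup f t r Y + (L + 1 / r) * e"
    unfolding window_sup_def[of f t r X]
  proof (rule cSUP_least)
    fix s :: real assume s: "s \<in> {0..}"
    show "f (traj X s) * bump {t} r s \<le> window_sup f t r Y + (L + 1 / r) * e"
    proof (cases "s \<le> 1 / e")
      case True
      have "0 \<le> l s" using s l_onto by auto
      with step[of s] window_sup_upper[OF r, of "l s" Y t] s True show ?thesis by simp
    next
      case False
      then have "t + r \<le> s" using e by linarith
      then show ?thesis using zero window_sup_nonneg[OF r, of t Y] K by simp
    qed
  qed simp
  ultimately show ?thesis by linarith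
qed

lemma continuous_window_sup:
  assumes lip: "\<And>x y. \<bar>f x - f y\<bar> \<le> L * dist x y" and L: "0 \<le> L" and r: "0 < r" and t: "0 \<le> t"
  shows "continuous_on UNIV (window_sup f t r)"
proof (subst continuous_on_open_vimage[OF open_UNIV], intro allI impI)
  fix B :: "real set" assume B: "open B"
  show "open (window_sup f t r -` B \<inter> UNIV)"
    unfolding open_cadlag_def
  proof
    fix X assume "X \<in> window_sup f t r -` B \<inter> UNIV"
    then obtain \<eta> where \<eta>: "0 < \<eta>" "\<And>z. \<bar>z - window_sup f t r X\<bar> < \<eta> \<Longrightarrow> z \<in> B"
      using B by (auto simp: open_dist dist_real_def)
    define e where "e = min (min 1 (1 / (t + r + 1))) (\<eta> / (2 * (L + 1 / r)))"
    have Lr: "0 < L + 1 / r" using L r by (simp add: add_nonneg_pos)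
    have e: "0 < e" "e \<le> 1" "e \<le> 1 / (t + r + 1)" "e \<le> \<eta> / (2 * (L + 1 / r))"
      unfolding e_def using t r \<eta>(1) Lr by (simp_all add: min.coboundedI1 del: distrib_left_numeral)
    have "t + r + 1 \<le> 1 / e" using e t r by (simp add: field_simps)
    then have "t + r + e \<le> 1 / e" using e(2) by linarith
    moreover have "(L + 1 / r) * e < \<eta>"
    proof -
      have "(L + 1 / r) * e \<le> (L + 1 / r) * (\<eta> / (2 * (L + 1 / r)))"
        using e(4) Lr by (intro mult_left_mono) auto
      also have "\<dots> = \<eta> / 2" using Lr by (simp add: divide_simps del: distrib_left_numeral)
      finally show ?thesis using \<eta>(1) by linarith
    qed
    ultimately have "Y \<in> window_sup f t r -` B" if "skorohod_close e X Y" for Y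
      using window_sup_close[OF lip L r t that e(1)] \<eta>(2) by (meson le_less_trans vimageI2)
    then show "\<exists>e>0. \<forall>Y. skorohod_close e X Y \<longrightarrow> Y \<in> window_sup f t r -` B \<inter> UNIV"
      using e(1) by blast
  qed
qed

end

lemma unit_function_bump: "0 < r \<Longrightarrow> unit_function (bump S r)"
  by unfold_locales (simp_all add: bump_nonneg bump_le_1)

lemma unit_function_1_minus_bump: "0 < r \<Longrightarrow> unit_function (\<lambda>x. 1 - bump S r x)"
  by unfold_locales (simp_all add: bump_nonneg bump_le_1)

lemma continuous_window_sup_bump:
  assumes "0 < r" "0 < r'" "0 \<le> t"
  shows "continuous_on UNIV (window_sup (bump S r) t r')"
  by (rule unit_function.continuous_window_sup[OF unit_function_bump[OF assms(1)], where L = "1 / r"])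
    (use bump_lipschitz[OF assms(1)] assms in auto)

lemma continuous_window_sup_1_minus_bump:
  assumes "0 < r" "0 < r'" "0 \<le> t"
  shows "continuous_on UNIV (window_sup (\<lambda>x. 1 - bump S r x) t r')"
  by (rule unit_function.continuous_window_sup[OF unit_function_1_minus_bump[OF assms(1)], where L = "1 / r"])
    (use bump_lipschitz[OF assms(1), of S] assms in \<open>auto simp: abs_minus_commute\<close>)

lemma window_sup_small:
  assumes E: "closed E" "E \<noteq> {}" and Y: "continuous_on {0..} (traj Y)" "traj Y t \<notin> E" and t: "0 \<le> t"
  obtains \<rho> where "0 < \<rho>" "window_sup (bump E \<rho>) t \<rho> Y < 1 / 2"
proof -
  define d where "d = infdist (traj Y t) E"
  have d: "0 < d" using infdist_pos_not_in_closed[OF E Y(2)] by (simp add: d_def)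
  obtain \<eta> where \<eta>: "0 < \<eta>" "\<And>s. 0 \<le> s \<Longrightarrow> \<bar>s - t\<bar> < \<eta> \<Longrightarrow> dist (traj Y s) (traj Y t) < d / 2"
    using Y(1)[unfolded continuous_on_iff, rule_format, of t "d / 2"] t d by (auto simp: dist_real_def)
  define \<rho> where "\<rho> = min \<eta> (d / 2)"
  have \<rho>: "0 < \<rho>" "\<rho> \<le> \<eta>" "\<rho> \<le> d / 2" using \<eta> d by (auto simp: \<rho>_def)
  interpret unit_function "bump E \<rho>" using \<rho>(1) by (rule unit_function_bump)
  have "window_sup (bump E \<rho>) t \<rho> Y \<le> 0"
  proof (rule window_sup_least[OF \<rho>(1) order_refl])
    fix s assume s: "0 \<le> s" "\<bar>s - t\<bar> < \<rho>"
    then have "dist (traj Y s) (traj Y t) < d / 2" using \<eta>(2) \<rho> by simp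
    then have "d / 2 \<le> infdist (traj Y s) E"
      using infdist_triangle[of "traj Y t" E "traj Y s"] by (simp add: d_def dist_commute)
    then show "bump E \<rho> (traj Y s) \<le> 0"
      using \<rho> bump_pos_iff[OF \<rho>(1), of E "traj Y s"] by (simp add: not_less[symmetric])
  qed
  then show thesis using \<rho>(1) by (intro that[of \<rho>]) auto
qed

lemma window_sup_bump_mono:
  assumes "0 < \<rho>" "\<rho> \<le> \<rho>'"
  shows "window_sup (bump E \<rho>) t \<rho> Y \<le> window_sup (bump E \<rho>') t \<rho>' Y"
proof -
  interpret u: unit_function "bump E \<rho>" using assms by (intro unit_function_bump) auto
  interpret u': unit_function "bump E \<rho>'" using assms by (intro unit_function_bump) auto
  show ?thesis
    unfolding window_sup_def[of _ _ \<rho>]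
  proof (rule cSUP_least)
    fix s :: real assume s: "s \<in> {0..}"
    have "bump E \<rho> (traj Y s) * bump {t} \<rho> s \<le> bump E \<rho>' (traj Y s) * bump {t} \<rho>' s"
      using assms by (intro mult_mono bump_mono bump_nonneg)
    also have "\<dots> \<le> window_sup (bump E \<rho>') t \<rho>' Y"
      using assms s by (intro u'.window_sup_upper) auto
    finally show "bump E \<rho> (traj Y s) * bump {t} \<rho> s \<le> window_sup (bump E \<rho>') t \<rho>' Y" .
  qed simp
qed

lemma is_cadlag_neg: "is_cadlag x \<Longrightarrow> t < 0 \<Longrightarrow> x t = x 0"
  unfolding is_cadlag_def by blast

lemma is_cadlag_traj: "is_cadlag (traj X)"
  using traj by blast

lemma cadlag_eqI: "(\<And>t. 0 \<le> t \<Longrightarrow> traj X t = traj Y t) \<Longrightarrow> X = Y"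
proof -
  assume eq: "\<And>t. 0 \<le> t \<Longrightarrow> traj X t = traj Y t"
  have "traj X t = traj Y t" for t
    using eq[of t] eq[of 0] is_cadlag_neg[OF is_cadlag_traj, of t X] is_cadlag_neg[OF is_cadlag_traj, of t Y]
    by (cases "t < 0") auto
  then show "X = Y" using traj_inject by blast
qed

lemma traj_shift: "0 \<le> t \<Longrightarrow> traj (shift_traj s X) t = traj X (s + t)"
  by (simp add: shift_traj.rep_eq)

lemma shift_0: "shift_traj 0 X = X"
  by (rule cadlag_eqI) (simp add: traj_shift)

lemma shift_shift: "0 \<le> r \<Longrightarrow> 0 \<le> s \<Longrightarrow> shift_traj r (shift_traj s X) = shift_traj (s + r) X"
  by (rule cadlag_eqI) (simp add: traj_shift add.assoc)

lemma is_cadlag_concat: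
  fixes x y :: "real \<Rightarrow> 's::topological_space"
  assumes x: "is_cadlag x" and y: "is_cadlag y" and s: "0 \<le> s" and join: "x s = y 0"
  shows "is_cadlag (\<lambda>t. if t < s then x t else y (t - s))" (is "is_cadlag ?z")
proof -
  have xr: "(x \<longlongrightarrow> x t) (at_right t)" and yr: "(y \<longlongrightarrow> y t) (at_right t)" for t
    using x y unfolding is_cadlag_def continuous_within by blast+
  have xl: "\<exists>l. (x \<longlongrightarrow> l) (at_left t)" and yl: "\<exists>l. (y \<longlongrightarrow> l) (at_left t)" for t
    using x y unfolding is_cadlag_def by blast+
  have "(?z \<longlongrightarrow> ?z t) (at_right t)" for t
  proof (cases "t < s")
    case True
    then have "eventually (\<lambda>u. x u = ?z u) (at_right t)"
      by (auto simp: eventually_at_right_field intro!: exI[of _ s])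
    from Lim_transform_eventually[OF xr this] True show ?thesis by simp
  next
    case False
    have "filterlim (\<lambda>u. u - s) (at_right (t - s)) (at_right t)"
      by (auto simp: filterlim_at eventually_at_right_field intro!: tendsto_intros exI[of _ "t + 1"])
    then have lim: "((\<lambda>u. y (u - s)) \<longlongrightarrow> y (t - s)) (at_right t)"
      by (rule filterlim_compose[OF yr])
    have "eventually (\<lambda>u. y (u - s) = ?z u) (at_right t)"
      using False by (auto simp: eventually_at_right_field intro!: exI[of _ "t + 1"])
    from Lim_transform_eventually[OF lim this] False show ?thesis by simp
  qed
  moreover have "\<exists>l. (?z \<longlongrightarrow> l) (at_left t)" for t
  proof (cases "t \<le> s")
    case True
    obtain l where l: "(x \<longlongrightarrow> l) (at_left t)" using xl by blast
    have "eventually (\<lambda>u. x u = ?z u) (at_left t)"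
      using True by (auto simp: eventually_at_left_field intro!: exI[of _ "t - 1"])
    from Lim_transform_eventually[OF l this] show ?thesis by (rule exI)
  next
    case False
    obtain l where l: "(y \<longlongrightarrow> l) (at_left (t - s))" using yl by blast
    have "filterlim (\<lambda>u. u - s) (at_left (t - s)) (at_left t)"
      by (auto simp: filterlim_at eventually_at_left_field intro!: tendsto_intros exI[of _ "t - 1"])
    then have lim: "((\<lambda>u. y (u - s)) \<longlongrightarrow> l) (at_left t)"
      by (rule filterlim_compose[OF l])
    have "eventually (\<lambda>u. y (u - s) = ?z u) (at_left t)"
      using False by (auto simp: eventually_at_left_field intro!: exI[of _ s])
    from Lim_transform_eventually[OF lim this] show ?thesis by (rule exI)
  qed
  moreover have "?z t = ?z 0" if "t < 0" for t
  proof -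
    have xt: "x t = x 0" using x that by (rule is_cadlag_neg)
    show ?thesis
    proof (cases "s = 0")
      case True
      then show ?thesis using that xt join by simp
    next
      case False
      then show ?thesis using that xt s by simp
    qed
  qed
  ultimately show ?thesis
    unfolding is_cadlag_def continuous_within by blast
qed

lemma concat_cadlag:
  fixes X Y :: "'s::topological_space cadlag"
  assumes "0 \<le> s" "traj X s = traj Y 0"
  obtains Z where "Z \<in> same_upto s X" "shift_traj s Z = Y"
proof
  let ?z = "\<lambda>t. if t < s then traj X t else traj Y (t - s)"
  have Z: "traj (Traj ?z) = ?z"
    using is_cadlag_concat[OF is_cadlag_traj is_cadlag_traj assms] by (intro Traj_inverse) simp
  show "Traj ?z \<in> same_upto s X"
    using assms(2) by (auto simp: same_upto_def Z)
  show "shift_traj s (Traj ?z) = Y"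
    by (rule cadlag_eqI) (simp add: traj_shift Z)
qed

lemma compact_cluster_point:
  assumes "compact K" "\<And>n::nat. s n \<in> K"
  shows "\<exists>x\<in>K. \<forall>U. open U \<longrightarrow> x \<in> U \<longrightarrow> (\<exists>\<^sub>\<infinity>n. s n \<in> U)"
proof (rule ccontr)
  assume "\<not> ?thesis"
  then have "\<forall>x\<in>K. \<exists>U. open U \<and> x \<in> U \<and> \<not> (\<exists>\<^sub>\<infinity>n. s n \<in> U)" by blast
  then obtain U where U: "\<forall>x\<in>K. open (U x) \<and> x \<in> U x \<and> \<not> (\<exists>\<^sub>\<infinity>n. s n \<in> U x)"
    by (rule bchoice[THEN exE])
  obtain D where D: "D \<subseteq> K" "finite D" "K \<subseteq> (\<Union>x\<in>D. U x)"
    by (rule compactE_image[OF assms(1), of K U]) (use U in auto)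
  have "\<forall>x\<in>D. finite {n. s n \<in> U x}" using D(1) U by (auto simp: INFM_iff_infinite)
  then have "finite (\<Union>x\<in>D. {n. s n \<in> U x})" using D(2) by blast
  moreover have "(\<Union>x\<in>D. {n. s n \<in> U x}) = UNIV" using D(3) assms(2) by blast
  ultimately show False by simp
qed

section \<open>Large deviation convergence and supports\<close>

lemma deviability_unit: "deviability \<Psi> \<Longrightarrow> 0 \<le> \<Psi> E \<and> \<Psi> E \<le> 1"
  unfolding deviability_def atLeastAtMost_iff by blast

lemma deviability_compact: "deviability \<Psi> \<Longrightarrow> 0 < \<gamma> \<Longrightarrow> compact {x. \<gamma> \<le> \<Psi> {x}}"
proof (cases "\<gamma> \<le> 1")
  case False
  assume dev: "deviability \<Psi>"
  have "{x. \<gamma> \<le> \<Psi> {x}} = {}"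
  proof -
    have "\<Psi> {x} < \<gamma>" for x
      using False deviability_unit[OF dev, of "{x}"] by linarith
    then show ?thesis by (auto simp: not_le)
  qed
  then show ?thesis by simp
next
  case True
  assume "deviability \<Psi>" "0 < \<gamma>"
  then have "\<forall>\<gamma>\<in>{0<..1}. compact {x. \<gamma> \<le> \<Psi> {x}}" unfolding deviability_def by blast
  with True \<open>0 < \<gamma>\<close> show ?thesis by simp
qed

lemma subsequence_of_frequently:
  assumes "\<And>j. \<exists>\<^sub>\<infinity>k::nat. Q (j::nat) k"
  shows "\<exists>\<sigma> :: nat \<Rightarrow> nat. strict_mono \<sigma> \<and> (\<forall>j. Q j (\<sigma> j))"
proof -
  have "\<exists>\<sigma>. \<forall>j. Q j (\<sigma> j) \<and> \<sigma> j < \<sigma> (Suc j)"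
  proof (rule dependent_nat_choice)
    show "\<exists>k. Q 0 k" using assms[of 0] by (rule INFM_E) blast
    show "\<exists>k'. Q (Suc j) k' \<and> k < k'" for k j
      using assms[of "Suc j"] unfolding INFM_nat by blast
  qed
  then obtain \<sigma> where "\<forall>j. Q j (\<sigma> j) \<and> \<sigma> j < \<sigma> (Suc j)" by blast
  then show ?thesis by (intro exI[of _ \<sigma>]) (simp add: strict_mono_Suc_iff)
qed

lemma eventually_rate_pos: "strict_mono (r :: nat \<Rightarrow> nat) \<Longrightarrow> \<forall>\<^sub>F k in sequentially. 0 < r k"
  using filterlim_subseq[of r] eventually_gt_at_top[of "0::nat"] by (auto simp: filterlim_iff)

lemma ld_upper:
  assumes ld: "ld_converges Q r \<Phi>" and r: "strict_mono r"
    and f: "continuous_on UNIV f" "\<And>x. 0 \<le> f x" "\<And>x. f x \<le> 1"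
    and q: "\<And>x. f x * \<Phi> {x} \<le> q0" "0 \<le> q0" "q0 < q"
  shows "\<forall>\<^sub>F k in sequentially. (\<integral>x. f x ^ r k \<partial>Q k) \<le> q ^ r k"
proof -
  have bdd: "bounded (range f)" using f(2,3) by (auto intro!: boundedI[where B = 1] simp: abs_le_iff order_trans[OF _ f(2)])
  have "(\<lambda>k. root (r k) (\<integral>x. f x ^ r k \<partial>Q k)) \<longlonglongrightarrow> sup0 (range (\<lambda>x. f x * \<Phi> {x}))"
    using ld f bdd unfolding ld_converges_def by blast
  moreover have "sup0 (range (\<lambda>x. f x * \<Phi> {x})) < q"
  proof -
    have "sup0 (range (\<lambda>x. f x * \<Phi> {x})) \<le> q0" using q by (intro sup0_least) auto
    with q(3) show ?thesis by simp
  qed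
  ultimately have "\<forall>\<^sub>F k in sequentially. root (r k) (\<integral>x. f x ^ r k \<partial>Q k) < q"
    by (rule order_tendstoD(2))
  with eventually_rate_pos[OF r] show ?thesis
  proof eventually_elim
    case (elim k)
    have nonneg: "0 \<le> (\<integral>x. f x ^ r k \<partial>Q k)" using f(2) by (intro integral_nonneg_AE) auto
    have "(\<integral>x. f x ^ r k \<partial>Q k) = root (r k) (\<integral>x. f x ^ r k \<partial>Q k) ^ r k"
      using elim(1) nonneg by (simp add: real_root_pow_pos2)
    also have "\<dots> \<le> q ^ r k"
      using elim nonneg by (intro power_mono) (auto intro: less_imp_le)
    finally show ?case .
  qed
qed

lemma ld_lower:
  assumes ld: "ld_converges Q r \<Phi>" and r: "strict_mono r"
    and f: "continuous_on UNIV f" "\<And>x. 0 \<le> f x" "\<And>x. f x \<le> 1"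
    and q: "q < f x * \<Phi> {x}" "0 \<le> q"
  shows "\<forall>\<^sub>F k in sequentially. q ^ r k \<le> (\<integral>x. f x ^ r k \<partial>Q k)"
proof -
  have dev: "deviability \<Phi>" using ld unfolding ld_converges_def by blast
  have bdd: "bounded (range f)" using f(2,3) by (auto intro!: boundedI[where B = 1] simp: abs_le_iff order_trans[OF _ f(2)])
  have "(\<lambda>k. root (r k) (\<integral>x. f x ^ r k \<partial>Q k)) \<longlonglongrightarrow> sup0 (range (\<lambda>x. f x * \<Phi> {x}))"
    using ld f bdd unfolding ld_converges_def by blast
  moreover have "q < sup0 (range (\<lambda>x. f x * \<Phi> {x}))"
  proof -
    have "f x * \<Phi> {x} \<le> sup0 (range (\<lambda>x. f x * \<Phi> {x}))"
      using f deviability_unit[OF dev] by (intro sup0_upper[where c = 1]) (auto intro!: mult_le_one)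
    with q show ?thesis by simp
  qed
  ultimately have "\<forall>\<^sub>F k in sequentially. q < root (r k) (\<integral>x. f x ^ r k \<partial>Q k)"
    by (rule order_tendstoD(1))
  with eventually_rate_pos[OF r] show ?thesis
  proof eventually_elim
    case (elim k)
    have nonneg: "0 \<le> (\<integral>x. f x ^ r k \<partial>Q k)" using f(2) by (intro integral_nonneg_AE) auto
    have "q ^ r k \<le> root (r k) (\<integral>x. f x ^ r k \<partial>Q k) ^ r k"
      using elim q by (intro power_mono) (auto intro: less_imp_le)
    also have "\<dots> = (\<integral>x. f x ^ r k \<partial>Q k)"
      using elim(1) nonneg by (simp add: real_root_pow_pos2)
    finally show ?case .
  qed
qed

lemma borel_probD: "borel_prob Q \<Longrightarrow> prob_space Q" "borel_prob Q \<Longrightarrow> sets Q = sets borel"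
  unfolding borel_prob_def by auto

lemma integral_power_bounds:
  assumes Q: "borel_prob Q" and f: "continuous_on UNIV f" "\<And>x. 0 \<le> f x" "\<And>x. f x \<le> 1" and n: "0 < n"
    and B: "B \<in> sets borel"
  shows "(\<And>x. x \<in> B \<Longrightarrow> f x = 1) \<Longrightarrow> measure Q B \<le> (\<integral>x. f x ^ n \<partial>Q)"
    and "(\<And>x. x \<notin> B \<Longrightarrow> f x = 0) \<Longrightarrow> (\<integral>x. f x ^ n \<partial>Q) \<le> measure Q B"
proof -
  interpret prob_space Q using Q by (rule borel_probD)
  have B': "B \<in> sets Q" using B borel_probD(2)[OF Q] by simp
  have meas: "(\<lambda>x. f x ^ n) \<in> borel_measurable Q"
    using borel_measurable_continuous_onI[OF f(1)] borel_probD(2)[OF Q]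
    by (subst measurable_cong_sets[OF borel_probD(2)[OF Q] refl]) simp
  have int: "integrable Q (\<lambda>x. f x ^ n)"
    using f by (intro integrable_const_bound[where B = 1] meas) (auto simp: power_le_one)
  have ind: "integrable Q (indicat_real B)" using B' by (intro integrable_real_indicator) (auto simp: emeasure_eq_measure)
  have eq: "measure Q B = (\<integral>x. indicat_real B x \<partial>Q)" using B' by simp
  show "(\<And>x. x \<in> B \<Longrightarrow> f x = 1) \<Longrightarrow> measure Q B \<le> (\<integral>x. f x ^ n \<partial>Q)"
    unfolding eq using f by (intro integral_mono ind int) (auto simp: indicator_def)
  show "(\<And>x. x \<notin> B \<Longrightarrow> f x = 0) \<Longrightarrow> (\<integral>x. f x ^ n \<partial>Q) \<le> measure Q B"
    unfolding eq using f n by (intro integral_mono ind int) (auto simp: indicator_def power_le_one zero_power)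
qed

lemma closed_msupport: "closed (msupport Q)"
proof -
  have "- msupport Q = \<Union>{U. open U \<and> emeasure Q U = 0}"
    by (auto simp: msupport_def zero_less_iff_neq_zero)
  then show ?thesis unfolding closed_def by (auto intro: open_Union)
qed

lemma emeasure_compact_off_msupport:
  fixes Q :: "'s::metric_space measure"
  assumes Q: "sets Q = sets borel" and K: "compact K" and disj: "K \<inter> msupport Q = {}"
  shows "emeasure Q K = 0"
proof -
  have "\<forall>x\<in>K. \<exists>U. open U \<and> x \<in> U \<and> emeasure Q U = 0"
    using disj by (auto simp: msupport_def zero_less_iff_neq_zero)
  from bchoice[OF this] obtain U where U: "\<forall>x\<in>K. open (U x) \<and> x \<in> U x \<and> emeasure Q (U x) = 0"
    by blast
  obtain D where D: "D \<subseteq> K" "finite D" "K \<subseteq> (\<Union>x\<in>D. U x)"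
    by (rule compactE_image[OF K, of K U]) (use U in auto)
  have opn: "open (U x)" "emeasure Q (U x) = 0" if "x \<in> D" for x using U D(1) that by auto
  then have "emeasure Q (\<Union>x\<in>D. U x) \<le> (\<Sum>x\<in>D. emeasure Q (U x))"
    using D(2) Q by (intro emeasure_subadditive_finite) auto
  also have "\<dots> = 0" using opn by simp
  finally have "emeasure Q (\<Union>x\<in>D. U x) = 0" by simp
  moreover have "emeasure Q K \<le> emeasure Q (\<Union>x\<in>D. U x)"
    using D(3) opn(1) Q by (intro emeasure_mono) (auto intro!: borel_open open_UN)
  ultimately show ?thesis by simp
qed

lemma emeasure_compact_minus_msupport:
  fixes Q :: "'s::metric_space measure"
  assumes Q: "sets Q = sets borel" and K: "compact K"
  shows "emeasure Q (K - msupport Q) = 0"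
proof (cases "msupport Q = {}")
  case True
  with emeasure_compact_off_msupport[OF Q K] show ?thesis by simp
next
  case False
  define C where "C m = K \<inter> {x. 1 / real (Suc m) \<le> infdist x (msupport Q)}" for m
  have compact: "compact (C m)" for m
    unfolding C_def by (intro compact_Int_closed K closed_Collect_le continuous_intros)
  have null: "emeasure Q (C m) = 0" for m
  proof (rule emeasure_compact_off_msupport[OF Q compact])
    show "C m \<inter> msupport Q = {}" by (auto simp: C_def field_simps)
  qed
  have "K - msupport Q \<subseteq> (\<Union>m. C m)"
  proof
    fix x assume x: "x \<in> K - msupport Q"
    then have "0 < infdist x (msupport Q)"
      using False infdist_pos_not_in_closed[OF closed_msupport False] by auto
    then obtain m where "1 / real (Suc m) < infdist x (msupport Q)"
      using nat_approx_posE by (metis inverse_eq_divide)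
    then show "x \<in> (\<Union>m. C m)" using x by (auto simp: C_def intro!: exI[of _ m])
  qed
  then have "emeasure Q (K - msupport Q) \<le> emeasure Q (\<Union>m. C m)"
    using compact Q by (intro emeasure_mono) (auto intro!: sets.countable_UN simp: compact_imp_closed)
  also have "\<dots> = 0"
    using null compact Q by (intro emeasure_UN_eq_0) (auto simp: compact_imp_closed)
  finally show ?thesis by simp
qed

text \<open>
  In a nonseparable space the complement of the support may have positive mass. Its part inside a
  compact set is null, since there finite covers suffice, and exponential tightness makes the rest
  smaller than every exponential.
\<close>

lemma measure_off_msupport:
  fixes P :: "nat \<Rightarrow> 's::metric_space measure"
  assumes P: "\<And>n. borel_prob (P n)" and tight: "exponentially_tight P" and \<epsilon>: "0 < \<epsilon>"
  shows "\<forall>\<^sub>F n in sequentially. measure (P n) (- msupport (P n)) \<le> \<epsilon> ^ n"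
proof -
  have "(INF K\<in>{K. compact K}. limsup (\<lambda>n. ereal (root n (measure (P n) (UNIV - K))))) < ereal \<epsilon>"
    using tight \<epsilon> by (simp add: exponentially_tight_def)
  then obtain K where K: "compact K" "limsup (\<lambda>n. ereal (root n (measure (P n) (UNIV - K)))) < ereal \<epsilon>"
    by (auto simp: INF_less_iff)
  from Limsup_lessD[OF K(2)] eventually_gt_at_top[of 0] show ?thesis
  proof eventually_elim
    case (elim n)
    interpret prob_space "P n" using P by (rule borel_probD)
    note sets = borel_probD(2)[OF P[of n]]
    have meas: "K \<in> sets (P n)" "msupport (P n) \<in> sets (P n)"
      using borel_closed[OF compact_imp_closed[OF K(1)]] borel_closed[OF closed_msupport] by (auto simp: sets)
    have "measure (P n) (- msupport (P n)) \<le> measure (P n) ((K - msupport (P n)) \<union> (UNIV - K))"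
      using meas sets by (intro finite_measure_mono) auto
    also have "\<dots> \<le> measure (P n) (K - msupport (P n)) + measure (P n) (UNIV - K)"
      using meas sets by (intro measure_Un_le) auto
    also have "measure (P n) (K - msupport (P n)) = 0"
      using emeasure_compact_minus_msupport[OF sets K(1)] by (simp add: measure_def)
    also have "0 + measure (P n) (UNIV - K) = root n (measure (P n) (UNIV - K)) ^ n"
      using elim by (simp add: real_root_pow_pos2)
    also have "\<dots> \<le> \<epsilon> ^ n"
      using elim by (intro power_mono) (auto intro: less_imp_le)
    finally show ?case .
  qed
qed

lemma power_combination_le:
  fixes c c' C :: real
  assumes "0 \<le> c" "c < c'" and r: "strict_mono (r :: nat \<Rightarrow> nat)"
  shows "\<forall>\<^sub>F k in sequentially. C * c ^ r k \<le> c' ^ r k"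
proof -
  have c': "0 < c'" using assms by linarith
  have "(\<lambda>n. C * (c / c') ^ n) \<longlonglongrightarrow> C * 0"
    using assms c' by (intro tendsto_mult tendsto_const LIMSEQ_realpow_zero) auto
  from filterlim_compose[OF this filterlim_subseq[OF r]]
  have "(\<lambda>k. C * (c / c') ^ r k) \<longlonglongrightarrow> 0" by simp
  then have "\<forall>\<^sub>F k in sequentially. C * (c / c') ^ r k < 1"
    by (rule order_tendstoD) simp
  then show ?thesis
    by eventually_elim (use c' in \<open>simp add: power_divide field_simps less_imp_le\<close>)
qed

lemma LIMSEQ_shrinking_balls:
  assumes "\<And>j. xs j \<in> ball x (1 / real (Suc j))"
  shows "xs \<longlonglongrightarrow> x"
proof (rule metric_LIMSEQ_I)
  fix e :: real assume "0 < e"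
  then obtain N where N: "1 / real (Suc N) < e" using nat_approx_posE by (metis inverse_eq_divide)
  have "dist (xs n) x < e" if "N \<le> n" for n
  proof -
    have "1 / real (Suc n) \<le> 1 / real (Suc N)" using that by (intro divide_left_mono) auto
    then show ?thesis using assms[of n] N by (simp add: dist_commute)
  qed
  then show "\<exists>N. \<forall>n\<ge>N. dist (xs n) x < e" by blast
qed

section \<open>Exponential rates of the flow between two sets\<close>

locale stationary_ld =
  fixes M :: "'w measure"
    and X :: "nat \<Rightarrow> 'w \<Rightarrow> 's::metric_space cadlag"
    and P :: "nat \<Rightarrow> 's measure"
    and \<kappa> :: "nat \<Rightarrow> 's \<Rightarrow> 's cadlag measure"
    and \<Phi> :: "'s \<Rightarrow> 's cadlag set \<Rightarrow> real"
    and \<Psi> :: "'s set \<Rightarrow> real"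
    and r :: "nat \<Rightarrow> nat"
  assumes prob: "prob_space M"
    and process: "\<And>n. cadlag_process M (X n)"
    and borel_P: "\<And>n. borel_prob (P n)"
    and stationary: "\<And>n t. t \<ge> 0 \<Longrightarrow> distr M borel (\<lambda>\<omega>. traj (X n \<omega>) t) = P n"
    and deviability_\<Phi>: "\<And>x. deviability (\<Phi> x)"
    and rcd: "\<And>n. regular_conditional_distribution M (X n) (\<lambda>\<omega>. traj (X n \<omega>) 0) (\<kappa> n)"
    and ld_paths: "\<And>r xs x. strict_mono r \<Longrightarrow> (\<And>k. xs k \<in> msupport (P (r k))) \<Longrightarrow> xs \<longlonglongrightarrow> x \<Longrightarrow>
          ld_converges (\<lambda>k. \<kappa> (r k) (xs k)) r (\<Phi> x) \<and>
          (\<forall>Y. \<not> continuous_on {0..} (traj Y) \<longrightarrow> \<Phi> x {Y} = 0)"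
    and tight: "exponentially_tight P"
    and r: "strict_mono r"
    and ld_initial: "ld_converges (\<lambda>k. P (r k)) r \<Psi>"
begin

lemma deviability_\<Psi>: "deviability \<Psi>"
  using ld_initial unfolding ld_converges_def by blast

lemmas \<Phi>_unit = deviability_unit[OF deviability_\<Phi>]
lemmas \<Psi>_unit = deviability_unit[OF deviability_\<Psi>]

lemma closed_level: "0 < \<gamma> \<Longrightarrow> closed {x. \<gamma> \<le> \<Psi> {x}}"
  by (intro compact_imp_closed deviability_compact[OF deviability_\<Psi>])

lemma sets_P: "sets (P n) = sets borel" and prob_P: "prob_space (P n)"
  using borel_probD[OF borel_P[of n]] by blast+

lemma usc_cball:
  assumes "\<Psi> {x} < c"
  obtains \<rho> where "0 < \<rho>" "\<And>y. y \<in> cball x \<rho> \<Longrightarrow> \<Psi> {y} < c"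
proof -
  have "0 < c" using assms \<Psi>_unit[of "{x}"] by linarith
  then have "open (- {y. c \<le> \<Psi> {y}})" using closed_level by (simp add: open_Compl)
  moreover have "x \<in> - {y. c \<le> \<Psi> {y}}" using assms by simp
  ultimately obtain \<rho> where "0 < \<rho>" "cball x \<rho> \<subseteq> - {y. c \<le> \<Psi> {y}}"
    by (meson open_contains_cball)
  then show thesis by (intro that[of \<rho>]) auto
qed

lemma initial_upper:
  assumes E: "closed E" and c: "\<And>x. x \<in> E \<Longrightarrow> \<Psi> {x} < c" "0 < c" "c < c'"
  shows "\<forall>\<^sub>F k in sequentially. measure (P (r k)) E \<le> c' ^ r k"
proof (cases "E = {}")
  case True
  then show ?thesis using c by simp
next
  case False
  let ?K = "{x. c \<le> \<Psi> {x}}"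
  have K: "compact ?K" using deviability_compact[OF deviability_\<Psi>] c by simp
  have "\<exists>\<rho>>0. \<forall>x\<in>?K. \<rho> \<le> infdist x E"
  proof (cases "?K = {}")
    case False
    from continuous_attains_inf[OF K False continuous_on_infdist[OF continuous_on_id]]
    obtain x where x: "x \<in> ?K" "\<And>y. y \<in> ?K \<Longrightarrow> infdist x E \<le> infdist y E" by auto
    moreover have "0 < infdist x E"
      using infdist_pos_not_in_closed[OF E \<open>E \<noteq> {}\<close>] c(1) x(1) by force
    ultimately show ?thesis by blast
  qed (auto intro: exI[of _ 1])
  then obtain \<rho> where \<rho>: "0 < \<rho>" "\<And>x. x \<in> ?K \<Longrightarrow> \<rho> \<le> infdist x E" by blast
  have f: "continuous_on UNIV (bump E \<rho>)" "\<And>x. 0 \<le> bump E \<rho> x" "\<And>x. bump E \<rho> x \<le> 1"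
    using \<rho>(1) by (simp_all add: bump_nonneg bump_le_1 continuous_bump)
  have "bump E \<rho> x * \<Psi> {x} \<le> c" for x
  proof (cases "x \<in> ?K")
    case True
    then have "bump E \<rho> x = 0" using \<rho> bump_pos_iff[OF \<rho>(1), of E x] bump_nonneg[of E \<rho> x] by force
    then show ?thesis using c by simp
  next
    case False
    then show ?thesis
      using mult_mono[OF f(3)[of x], of "\<Psi> {x}" c] \<Psi>_unit[of "{x}"] by simp
  qed
  from ld_upper[OF ld_initial r f this _ c(3)] c(2)
  have "\<forall>\<^sub>F k in sequentially. (\<integral>x. bump E \<rho> x ^ r k \<partial>P (r k)) \<le> c' ^ r k" by simp
  with eventually_rate_pos[OF r] show ?thesis
  proof eventually_elim
    case (elim k)
    have "measure (P (r k)) E \<le> (\<integral>x. bump E \<rho> x ^ r k \<partial>P (r k))"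
      using E by (intro integral_power_bounds(1) borel_P f elim borel_closed) (simp_all add: bump_eq_1)
    with elim show ?case by simp
  qed
qed

lemma initial_lower:
  assumes U: "open U" "x \<in> U" and c: "0 \<le> c" "c < \<Psi> {x}"
  shows "\<forall>\<^sub>F k in sequentially. c ^ r k \<le> measure (P (r k)) U"
proof -
  from U obtain \<rho> where \<rho>: "0 < \<rho>" "ball x \<rho> \<subseteq> U" by (meson open_contains_ball)
  have f: "continuous_on UNIV (bump {x} \<rho>)" "\<And>y. 0 \<le> bump {x} \<rho> y" "\<And>y. bump {x} \<rho> y \<le> 1"
    using \<rho>(1) by (simp_all add: bump_nonneg bump_le_1 continuous_bump)
  have "c < bump {x} \<rho> x * \<Psi> {x}" using c by (simp add: bump_eq_1)
  from eventually_rate_pos[OF r] ld_lower[OF ld_initial r f this c(1)] show ?thesis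
  proof eventually_elim
    case (elim k)
    have "(\<integral>x'. bump {x} \<rho> x' ^ r k \<partial>P (r k)) \<le> measure (P (r k)) U"
    proof (intro integral_power_bounds(2) borel_P f elim borel_open U)
      show "bump {x} \<rho> y = 0" if "y \<notin> U" for y
        using that \<rho> bump_pos_iff[OF \<rho>(1), of "{x}" y] bump_nonneg[of "{x}" \<rho> y]
        by (auto simp: subset_iff dist_commute not_less)
    qed
    with elim show ?case by simp
  qed
qed

lemma off_support:
  "0 < \<epsilon> \<Longrightarrow> \<forall>\<^sub>F k in sequentially. measure (P (r k)) (- msupport (P (r k))) \<le> \<epsilon> ^ r k"
  using measure_off_msupport[OF borel_P tight] filterlim_subseq[OF r] by (auto simp: filterlim_iff)

text \<open>
  The hypothesis on the conditional laws speaks of convergent sequences of points in the supports. It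
  yields bounds that are uniform near \<open>x\<close>: exceptional points in shrinking balls would form a
  sequence that contradicts it. The subsequence \<open>\<sigma>\<close> is needed because exceptional points are
  available only for infinitely many \<open>k\<close>.
\<close>

lemma eventually_near_on_support:
  assumes "\<And>\<sigma> xs. strict_mono \<sigma> \<Longrightarrow> (\<And>j. xs j \<in> msupport (P (r (\<sigma> j)))) \<Longrightarrow> xs \<longlonglongrightarrow> x \<Longrightarrow>
    \<forall>\<^sub>F j in sequentially. R (\<sigma> j) (xs j)"
  obtains \<rho> where "0 < \<rho>" "\<forall>\<^sub>F k in sequentially. \<forall>y \<in> ball x \<rho> \<inter> msupport (P (r k)). R k y"
proof -
  have "\<exists>\<rho>>0. \<forall>\<^sub>F k in sequentially. \<forall>y \<in> ball x \<rho> \<inter> msupport (P (r k)). R k y"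
  proof (rule ccontr)
    assume neg: "\<not> ?thesis"
    define Q where "Q j k \<longleftrightarrow> (\<exists>y \<in> ball x (1 / real (Suc j)) \<inter> msupport (P (r k)). \<not> R k y)" for j k
    have "\<exists>\<^sub>\<infinity>k. Q j k" for j
    proof -
      have "\<not> (\<forall>\<^sub>F k in sequentially. \<forall>y \<in> ball x (1 / real (Suc j)) \<inter> msupport (P (r k)). R k y)"
        using neg[unfolded not_ex, rule_format, of "1 / real (Suc j)"] by simp
      then show ?thesis
        unfolding Q_def cofinite_eq_sequentially frequently_def by simp
    qed
    from subsequence_of_frequently[of Q, OF this]
    obtain \<sigma> where \<sigma>: "strict_mono \<sigma>" "\<forall>j. Q j (\<sigma> j)" by (elim exE conjE)
    from \<sigma>(2) have "\<forall>j. \<exists>y. y \<in> ball x (1 / real (Suc j)) \<and> y \<in> msupport (P (r (\<sigma> j))) \<and> \<not> R (\<sigma> j) y"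
      unfolding Q_def by blast
    from choice[OF this] obtain xs where xs: "\<And>j. xs j \<in> ball x (1 / real (Suc j))"
      "\<And>j. xs j \<in> msupport (P (r (\<sigma> j)))" "\<And>j. \<not> R (\<sigma> j) (xs j)" by blast
    have lim: "xs \<longlonglongrightarrow> x" using xs(1) by (rule LIMSEQ_shrinking_balls)
    from assms[OF \<sigma>(1) xs(2) lim] xs(3) show False by simp
  qed
  then show thesis by (elim exE conjE) (rule that)
qed

lemma kernel_upper:
  assumes F: "continuous_on UNIV F" "\<And>Y. 0 \<le> F Y" "\<And>Y. F Y \<le> 1"
    and q: "\<And>Y. F Y * \<Phi> x {Y} \<le> q0" "0 \<le> q0" "q0 < q"
  obtains \<rho> where "0 < \<rho>"
    "\<forall>\<^sub>F k in sequentially. \<forall>y \<in> ball x \<rho> \<inter> msupport (P (r k)). (\<integral>Y. F Y ^ r k \<partial>\<kappa> (r k) y) \<le> q ^ r k"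
proof (rule eventually_near_on_support[of x "\<lambda>k y. (\<integral>Y. F Y ^ r k \<partial>\<kappa> (r k) y) \<le> q ^ r k"])
  fix \<sigma> xs assume \<sigma>: "strict_mono \<sigma>" and xs: "\<And>j::nat. xs j \<in> msupport (P (r (\<sigma> j)))" "xs \<longlonglongrightarrow> x"
  have "strict_mono (r \<circ> \<sigma>)" using r \<sigma> by (rule strict_mono_o)
  with ld_paths[OF this _ xs(2)] xs(1)
  have "ld_converges (\<lambda>k. \<kappa> ((r \<circ> \<sigma>) k) (xs k)) (r \<circ> \<sigma>) (\<Phi> x)" by simp
  from ld_upper[OF this \<open>strict_mono (r \<circ> \<sigma>)\<close> F q]
  show "\<forall>\<^sub>F j in sequentially. (\<integral>Y. F Y ^ r (\<sigma> j) \<partial>\<kappa> (r (\<sigma> j)) (xs j)) \<le> q ^ r (\<sigma> j)" by simp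
qed (rule that)

lemma kernel_lower:
  assumes F: "continuous_on UNIV F" "\<And>Y. 0 \<le> F Y" "\<And>Y. F Y \<le> 1"
    and q: "q < F Y * \<Phi> x {Y}" "0 \<le> q"
  obtains \<rho> where "0 < \<rho>"
    "\<forall>\<^sub>F k in sequentially. \<forall>y \<in> ball x \<rho> \<inter> msupport (P (r k)). q ^ r k \<le> (\<integral>Y. F Y ^ r k \<partial>\<kappa> (r k) y)"
proof (rule eventually_near_on_support[of x "\<lambda>k y. q ^ r k \<le> (\<integral>Y. F Y ^ r k \<partial>\<kappa> (r k) y)"])
  fix \<sigma> xs assume \<sigma>: "strict_mono \<sigma>" and xs: "\<And>j::nat. xs j \<in> msupport (P (r (\<sigma> j)))" "xs \<longlonglongrightarrow> x"
  have "strict_mono (r \<circ> \<sigma>)" using r \<sigma> by (rule strict_mono_o)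
  with ld_paths[OF this _ xs(2)] xs(1)
  have "ld_converges (\<lambda>k. \<kappa> ((r \<circ> \<sigma>) k) (xs k)) (r \<circ> \<sigma>) (\<Phi> x)" by simp
  from ld_lower[OF this \<open>strict_mono (r \<circ> \<sigma>)\<close> F q]
  show "\<forall>\<^sub>F j in sequentially. q ^ r (\<sigma> j) \<le> (\<integral>Y. F Y ^ r (\<sigma> j) \<partial>\<kappa> (r (\<sigma> j)) (xs j))" by simp
qed (rule that)

text \<open>
  If \<open>\<Psi> {x} > 0\<close>, the mass of a ball around \<open>x\<close> decays at most exponentially, whereas the mass off the
  support decays faster than every exponential.
\<close>

lemma support_meets_ball:
  assumes x: "0 < \<Psi> {x}" and \<rho>: "0 < \<rho>"
  shows "\<forall>\<^sub>F k in sequentially. ball x \<rho> \<inter> msupport (P (r k)) \<noteq> {}"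
proof -
  have 1: "\<forall>\<^sub>F k in sequentially. (\<Psi> {x} / 2) ^ r k \<le> measure (P (r k)) (ball x \<rho>)"
    using x \<rho> by (intro initial_lower[of _ x]) auto
  have 2: "\<forall>\<^sub>F k in sequentially. measure (P (r k)) (- msupport (P (r k))) \<le> (\<Psi> {x} / 4) ^ r k"
    using x by (intro off_support) simp
  from 1 2 eventually_rate_pos[OF r] show ?thesis
  proof eventually_elim
    case (elim k)
    interpret prob_space "P (r k)" by (rule prob_P)
    have "(\<Psi> {x} / 4) ^ r k < (\<Psi> {x} / 2) ^ r k"
      using x elim(3) by (intro power_strict_mono) auto
    then have less: "measure (P (r k)) (- msupport (P (r k))) < measure (P (r k)) (ball x \<rho>)"
      using elim(1,2) by linarith
    show ?case
    proof
      assume "ball x \<rho> \<inter> msupport (P (r k)) = {}"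
      then have sub: "ball x \<rho> \<subseteq> - msupport (P (r k))" by (rule disjoint_eq_subset_Compl[THEN iffD1])
      have "measure (P (r k)) (ball x \<rho>) \<le> measure (P (r k)) (- msupport (P (r k)))"
        using sub borel_closed[OF closed_msupport, of "P (r k)"]
        by (intro finite_measure_mono) (simp_all add: sets_P)
      with less show False by linarith
    qed
  qed
qed

text \<open>
  The hypotheses describe \<open>\<Phi> x\<close> only for limits \<open>x\<close> of points in the supports; \<open>\<Psi> {x} > 0\<close> makes \<open>x\<close>
  such a limit.
\<close>

lemma continuous_path:
  assumes x: "0 < \<Psi> {x}" and Y: "0 < \<Phi> x {Y}"
  shows "continuous_on {0..} (traj Y)"
proof -
  define Q where "Q j k \<longleftrightarrow> ball x (1 / real (Suc j)) \<inter> msupport (P (r k)) \<noteq> {}" for j k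
  have "\<exists>\<^sub>\<infinity>k. Q j k" for j
    unfolding cofinite_eq_sequentially Q_def
    using support_meets_ball[OF x, of "1 / real (Suc j)"] by (intro eventually_frequently) simp_all
  from subsequence_of_frequently[of Q, OF this]
  obtain \<sigma> where \<sigma>: "strict_mono \<sigma>" "\<forall>j. Q j (\<sigma> j)" by (elim exE conjE)
  from \<sigma>(2) have "\<forall>j. \<exists>y. y \<in> ball x (1 / real (Suc j)) \<and> y \<in> msupport (P (r (\<sigma> j)))"
    unfolding Q_def by blast
  from choice[OF this] obtain xs where xs: "\<And>j. xs j \<in> ball x (1 / real (Suc j))"
    "\<And>j. xs j \<in> msupport (P (r (\<sigma> j)))" by blast
  have lim: "xs \<longlonglongrightarrow> x" using xs(1) by (rule LIMSEQ_shrinking_balls)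
  from ld_paths[OF strict_mono_o[OF r \<sigma>(1)] _ lim] xs(2)
  have "\<forall>Y. \<not> continuous_on {0..} (traj Y) \<longrightarrow> \<Phi> x {Y} = 0" by simp
  with Y show ?thesis by (metis less_irrefl)
qed

lemma kernel_prob: "borel_prob (\<kappa> n x)"
proof -
  have "\<kappa> n \<in> borel \<rightarrow>\<^sub>M prob_algebra borel"
    using rcd[of n] unfolding regular_conditional_distribution_def by blast
  then have "\<kappa> n x \<in> space (prob_algebra borel)" by (rule measurable_space) simp
  then show ?thesis by (simp add: space_prob_algebra borel_prob_def)
qed

lemma measurable_at: "0 \<le> t \<Longrightarrow> \<Gamma> \<in> sets borel \<Longrightarrow> {\<omega> \<in> space M. traj (X n \<omega>) t \<in> \<Gamma>} \<in> sets M"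
proof -
  assume "0 \<le> t" "\<Gamma> \<in> sets borel"
  moreover have "(\<lambda>\<omega>. traj (X n \<omega>) t) \<in> M \<rightarrow>\<^sub>M borel"
    using process[of n] \<open>0 \<le> t\<close> unfolding cadlag_process_def by blast
  ultimately have "(\<lambda>\<omega>. traj (X n \<omega>) t) -` \<Gamma> \<inter> space M \<in> sets M" by (intro measurable_sets)
  then show ?thesis by (simp add: vimage_def Int_def conj_commute)
qed

lemma measurable_path: "B \<in> sets borel \<Longrightarrow> {\<omega> \<in> space M. X n \<omega> \<in> B} \<in> sets M"
proof -
  assume "B \<in> sets borel"
  moreover have "X n \<in> M \<rightarrow>\<^sub>M borel"
    using process[of n] unfolding cadlag_process_def by blast
  ultimately have "X n -` B \<inter> space M \<in> sets M" by (intro measurable_sets)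
  then show ?thesis by (simp add: vimage_def Int_def conj_commute)
qed

lemma measurable_flow:
  assumes "0 \<le> s" "0 \<le> t" "D \<in> sets borel" "E \<in> sets borel"
  shows "{\<omega> \<in> space M. traj (X n \<omega>) s \<in> D \<and> traj (X n \<omega>) t \<in> E} \<in> sets M"
  using sets.Int[OF measurable_at[OF assms(1,3)] measurable_at[OF assms(2,4)], of n]
  by (rule back_subst[of "\<lambda>S. S \<in> sets M"]) auto

lemma marginal_law: "0 \<le> t \<Longrightarrow> \<Gamma> \<in> sets borel \<Longrightarrow>
  measure M {\<omega> \<in> space M. traj (X n \<omega>) t \<in> \<Gamma>} = measure (P n) \<Gamma>"
proof -
  assume t: "0 \<le> t" and \<Gamma>: "\<Gamma> \<in> sets borel"
  have "(\<lambda>\<omega>. traj (X n \<omega>) t) \<in> M \<rightarrow>\<^sub>M borel"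
    using process[of n] t unfolding cadlag_process_def by blast
  from measure_distr[OF this \<Gamma>] show ?thesis
    by (simp add: stationary[OF t] vimage_def Int_def conj_commute)
qed

lemma emeasure_disintegrate:
  assumes "B \<in> sets borel" "\<Gamma> \<in> sets borel"
  shows "emeasure M {\<omega> \<in> space M. X n \<omega> \<in> B \<and> traj (X n \<omega>) 0 \<in> \<Gamma>} =
    (\<integral>\<^sup>+x. emeasure (\<kappa> n x) B * indicator \<Gamma> x \<partial>P n)"
  using rcd[of n] assms stationary[of 0 n] unfolding regular_conditional_distribution_def by simp

lemma measure_disintegrate_upper:
  assumes B: "B \<in> sets borel" and \<Gamma>: "\<Gamma> \<in> sets borel" and q: "0 \<le> q"
    "\<And>x. x \<in> \<Gamma> \<inter> msupport (P n) \<Longrightarrow> measure (\<kappa> n x) B \<le> q"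
  shows "measure M {\<omega> \<in> space M. X n \<omega> \<in> B \<and> traj (X n \<omega>) 0 \<in> \<Gamma>} \<le>
    q * measure (P n) \<Gamma> + measure (P n) (- msupport (P n))"
proof -
  interpret M: prob_space M by (rule prob)
  interpret Pn: prob_space "P n" by (rule prob_P)
  let ?S = "msupport (P n)"
  have S: "?S \<in> sets borel" by (rule borel_closed[OF closed_msupport])
  have "emeasure (\<kappa> n x) B * indicator \<Gamma> x \<le> ennreal q * indicator \<Gamma> x + indicator (- ?S) x" for x
  proof -
    interpret prob_space "\<kappa> n x" by (rule borel_probD[OF kernel_prob])
    show ?thesis
      using q(2)[of x] q(1) by (cases "x \<in> \<Gamma>"; cases "x \<in> ?S") (auto simp: emeasure_eq_measure add_increasing)
  qed
  then have "emeasure M {\<omega> \<in> space M. X n \<omega> \<in> B \<and> traj (X n \<omega>) 0 \<in> \<Gamma>} \<le>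
    (\<integral>\<^sup>+x. ennreal q * indicator \<Gamma> x + indicator (- ?S) x \<partial>P n)"
    unfolding emeasure_disintegrate[OF B \<Gamma>] by (intro nn_integral_mono)
  also have "\<dots> = ennreal q * emeasure (P n) \<Gamma> + emeasure (P n) (- ?S)"
  proof -
    have [measurable]: "\<Gamma> \<in> sets (P n)" "- ?S \<in> sets (P n)" using \<Gamma> S by (auto simp: sets_P)
    show ?thesis by (subst nn_integral_add) (simp_all add: nn_integral_cmult_indicator)
  qed
  also have "\<dots> = ennreal (q * measure (P n) \<Gamma> + measure (P n) (- ?S))"
    using q(1) by (simp add: Pn.emeasure_eq_measure ennreal_mult ennreal_plus)
  finally have "ennreal (measure M {\<omega> \<in> space M. X n \<omega> \<in> B \<and> traj (X n \<omega>) 0 \<in> \<Gamma>}) \<le>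
      ennreal (q * measure (P n) \<Gamma> + measure (P n) (- ?S))"
    by (simp only: M.emeasure_eq_measure)
  then show ?thesis using q(1) by (subst (asm) ennreal_le_iff) auto
qed

lemma measure_disintegrate_lower:
  assumes B: "B \<in> sets borel" and \<Gamma>: "\<Gamma> \<in> sets borel" and q: "0 \<le> q"
    "\<And>x. x \<in> \<Gamma> \<inter> msupport (P n) \<Longrightarrow> q \<le> measure (\<kappa> n x) B"
  shows "q * (measure (P n) \<Gamma> - measure (P n) (- msupport (P n))) \<le>
    measure M {\<omega> \<in> space M. X n \<omega> \<in> B \<and> traj (X n \<omega>) 0 \<in> \<Gamma>}"
proof -
  interpret M: prob_space M by (rule prob)
  interpret Pn: prob_space "P n" by (rule prob_P)
  let ?S = "msupport (P n)"
  have S: "?S \<in> sets borel" by (rule borel_closed[OF closed_msupport])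
  have "ennreal q * indicator (\<Gamma> \<inter> ?S) x \<le> emeasure (\<kappa> n x) B * indicator \<Gamma> x" for x
  proof -
    interpret prob_space "\<kappa> n x" by (rule borel_probD[OF kernel_prob])
    show ?thesis
      using q(2)[of x] q(1) by (cases "x \<in> \<Gamma>"; cases "x \<in> ?S") (auto simp: emeasure_eq_measure)
  qed
  then have "(\<integral>\<^sup>+x. ennreal q * indicator (\<Gamma> \<inter> ?S) x \<partial>P n) \<le>
      emeasure M {\<omega> \<in> space M. X n \<omega> \<in> B \<and> traj (X n \<omega>) 0 \<in> \<Gamma>}"
    unfolding emeasure_disintegrate[OF B \<Gamma>] by (intro nn_integral_mono)
  also have "(\<integral>\<^sup>+x. ennreal q * indicator (\<Gamma> \<inter> ?S) x \<partial>P n) = ennreal (q * measure (P n) (\<Gamma> \<inter> ?S))"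
    using \<Gamma> S q(1) by (subst nn_integral_cmult_indicator) (auto simp: sets_P Pn.emeasure_eq_measure ennreal_mult)
  finally have 1: "q * measure (P n) (\<Gamma> \<inter> ?S) \<le>
      measure M {\<omega> \<in> space M. X n \<omega> \<in> B \<and> traj (X n \<omega>) 0 \<in> \<Gamma>}"
    by (simp add: M.emeasure_eq_measure)
  have "measure (P n) \<Gamma> \<le> measure (P n) ((\<Gamma> \<inter> ?S) \<union> - ?S)"
    using \<Gamma> S by (intro Pn.finite_measure_mono) (auto simp: sets_P)
  also have "\<dots> \<le> measure (P n) (\<Gamma> \<inter> ?S) + measure (P n) (- ?S)"
    using \<Gamma> S by (intro measure_Un_le) (auto simp: sets_P)
  finally have "q * (measure (P n) \<Gamma> - measure (P n) (- ?S)) \<le> q * measure (P n) (\<Gamma> \<inter> ?S)"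
    using q(1) by (intro mult_left_mono) auto
  with 1 show ?thesis by linarith
qed

text \<open>
  Each single path in the compact level set is separated from \<open>E\<close> at time \<open>t\<close> by a small window, since it
  is continuous. The separation persists for smaller windows, so that finitely many neighbourhoods lead
  to one window for the whole level set.
\<close>

lemma window_separates_level:
  assumes E: "closed E" "E \<noteq> {}" and t: "0 \<le> t" and x: "0 < \<Psi> {x}" and q: "0 < q"
    and avoid: "\<And>Y. traj Y t \<in> E \<Longrightarrow> \<Phi> x {Y} < q"
  obtains \<rho> where "0 < \<rho>" "\<And>Y. q \<le> \<Phi> x {Y} \<Longrightarrow> window_sup (bump E \<rho>) t \<rho> Y < 1 / 2"
proof -
  let ?L = "{Y. q \<le> \<Phi> x {Y}}"
  let ?W = "\<lambda>\<rho>. {Y. window_sup (bump E \<rho>) t \<rho> Y < 1 / 2}"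
  have L: "compact ?L" using deviability_compact[OF deviability_\<Phi> q] .
  have "\<forall>Y\<in>?L. \<exists>\<rho>>0. Y \<in> ?W \<rho>"
  proof
    fix Y assume Y: "Y \<in> ?L"
    then have "continuous_on {0..} (traj Y)" using q by (intro continuous_path[OF x]) auto
    moreover have "traj Y t \<notin> E" using avoid[of Y] Y by force
    ultimately show "\<exists>\<rho>>0. Y \<in> ?W \<rho>" using window_sup_small[OF E _ _ t, of Y] by blast
  qed
  from bchoice[OF this] obtain \<rho> where \<rho>: "\<forall>Y\<in>?L. 0 < \<rho> Y \<and> Y \<in> ?W (\<rho> Y)" by blast
  have opn: "open (?W r)" if "0 < r" for r
    using t that by (intro open_Collect_less continuous_window_sup_bump continuous_intros)
  obtain D where D: "D \<subseteq> ?L" "finite D" "?L \<subseteq> (\<Union>Y\<in>D. ?W (\<rho> Y))"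
    by (rule compactE_image[OF L, of ?L "\<lambda>Y. ?W (\<rho> Y)"]) (use \<rho> opn in auto)
  define m where "m = Min (insert 1 (\<rho> ` D))"
  have m: "0 < m" "\<And>Y. Y \<in> D \<Longrightarrow> m \<le> \<rho> Y"
    using D(1,2) \<rho> by (auto simp: m_def)
  show thesis
  proof (rule that[OF m(1)])
    fix Y assume "q \<le> \<Phi> x {Y}"
    then obtain Z where Z: "Z \<in> D" "Y \<in> ?W (\<rho> Z)" using D(3) by blast
    then show "window_sup (bump E m) t m Y < 1 / 2"
      using window_sup_bump_mono[OF m(1) m(2)[OF Z(1)], of E t Y] by simp
  qed
qed

text \<open>
  Starting points near \<open>x\<close> have mass of rate about \<open>\<Psi> {x}\<close>, and from each of them the probability to be in
  \<open>E\<close> at time \<open>t\<close> has rate at most about \<open>q = c / \<Psi> {x}\<close>, uniformly on a small ball. The product of the two rates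
  is about \<open>c\<close>. The factor \<open>2\<close> accounts for starting points off the support.
\<close>

lemma flow_upper_local:
  assumes E: "closed E" "E \<noteq> {}" and t: "0 \<le> t" and x: "0 < c" "c \<le> \<Psi> {x}"
    and flow: "\<And>Y. traj Y t \<in> E \<Longrightarrow> \<Psi> {x} * \<Phi> x {Y} < c" and c': "c < c'"
  obtains \<rho> where "0 < \<rho>" "\<forall>\<^sub>F k in sequentially.
    measure M {\<omega> \<in> space M. traj (X (r k) \<omega>) 0 \<in> ball x \<rho> \<and> traj (X (r k) \<omega>) t \<in> E} \<le> 2 * c' ^ r k"
proof -
  interpret M: prob_space M by (rule prob)
  \<comment> \<open>\<open>\<epsilon>\<close> is so small that increasing both rates by \<open>\<epsilon>\<close> keeps their product below \<open>c'\<close>\<close>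
  define q where "q = c / \<Psi> {x}"
  define \<epsilon> where "\<epsilon> = min 1 ((c' - c) / (\<Psi> {x} + q + 1))"
  have q: "0 < q" "\<Psi> {x} * q = c" using x by (auto simp: q_def)
  have \<epsilon>: "0 < \<epsilon>" "\<epsilon> \<le> 1" "\<epsilon> * (\<Psi> {x} + q + 1) \<le> c' - c"
  proof -
    have "0 < \<Psi> {x} + q + 1" using x q by linarith
    then show "0 < \<epsilon>" "\<epsilon> \<le> 1" "\<epsilon> * (\<Psi> {x} + q + 1) \<le> c' - c"
      using c' by (simp_all add: \<epsilon>_def pos_le_divide_eq[symmetric])
  qed
  have prod: "(q + \<epsilon>) * (\<Psi> {x} + \<epsilon>) \<le> c'"
  proof -
    have "(q + \<epsilon>) * (\<Psi> {x} + \<epsilon>) = c + \<epsilon> * (\<Psi> {x} + q + \<epsilon>)" using q by (simp add: algebra_simps)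
    also have "\<dots> \<le> c + \<epsilon> * (\<Psi> {x} + q + 1)" using \<epsilon> by simp
    finally show ?thesis using \<epsilon>(3) by linarith
  qed
  have "\<Phi> x {Y} < q" if "traj Y t \<in> E" for Y
    using flow[OF that] x by (simp add: q_def field_simps)
  then obtain w where w: "0 < w" "\<And>Y. q \<le> \<Phi> x {Y} \<Longrightarrow> window_sup (bump E w) t w Y < 1 / 2"
    by (rule window_separates_level[OF E t _ q(1), of x, rotated]) (use x in auto)
  let ?w = "window_sup (bump E w) t w"
  interpret unit_function "bump E w" using w(1) by (rule unit_function_bump)
  \<comment> \<open>\<open>F\<close> is \<open>1\<close> if \<open>?w\<close> is \<open>1\<close>, hence on paths in \<open>E\<close> at time \<open>t\<close>; it vanishes where \<open>?w\<close> is below one half,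
    hence on paths of deviability at least \<open>q\<close>\<close>
  define F where "F Y = max 0 (2 * ?w Y - 1)" for Y
  have contw: "continuous_on UNIV ?w" using w(1) t by (intro continuous_window_sup_bump)
  have F: "continuous_on UNIV F" "\<And>Y. 0 \<le> F Y" "\<And>Y. F Y \<le> 1"
    unfolding F_def[abs_def] using window_sup_le_1[OF w(1)] by (auto intro!: continuous_intros contw)
  have FY: "F Y * \<Phi> x {Y} \<le> q" for Y
  proof (cases "q \<le> \<Phi> x {Y}")
    case True
    then show ?thesis using w(2)[of Y] q by (simp add: F_def)
  next
    case False
    then show ?thesis using mult_mono[OF F(3)[of Y], of "\<Phi> x {Y}" q] \<Phi>_unit[of x "{Y}"] by simp
  qed
  obtain \<rho>1 where \<rho>1: "0 < \<rho>1" "\<forall>\<^sub>F k in sequentially. \<forall>y \<in> ball x \<rho>1 \<inter> msupport (P (r k)).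
      (\<integral>Y. F Y ^ r k \<partial>\<kappa> (r k) y) \<le> (q + \<epsilon>) ^ r k"
    by (rule kernel_upper[of F x q "q + \<epsilon>"]) (use F FY q \<epsilon> in auto)
  obtain \<rho>2 where \<rho>2: "0 < \<rho>2" "\<And>y. y \<in> cball x \<rho>2 \<Longrightarrow> \<Psi> {y} < \<Psi> {x} + \<epsilon> / 2"
    using usc_cball[of x "\<Psi> {x} + \<epsilon> / 2"] \<epsilon> by auto
  have mass: "\<forall>\<^sub>F k in sequentially. measure (P (r k)) (cball x \<rho>2) \<le> (\<Psi> {x} + \<epsilon>) ^ r k"
    using \<rho>2 x \<epsilon> by (intro initial_upper[where c = "\<Psi> {x} + \<epsilon> / 2"]) auto
  define \<rho> where "\<rho> = min \<rho>1 \<rho>2"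
  have \<rho>: "0 < \<rho>" "ball x \<rho> \<subseteq> ball x \<rho>1" "ball x \<rho> \<subseteq> cball x \<rho>2" using \<rho>1 \<rho>2 by (auto simp: \<rho>_def)
  define B where "B = {Y. 1 \<le> ?w Y}"
  have "closed B" unfolding B_def by (intro closed_Collect_le contw continuous_intros)
  then have B: "B \<in> sets borel" by simp
  have c'0: "0 < c'" using x c' by linarith
  have "\<forall>\<^sub>F k in sequentially. measure M {\<omega> \<in> space M. traj (X (r k) \<omega>) 0 \<in> ball x \<rho> \<and> traj (X (r k) \<omega>) t \<in> E} \<le> 2 * c' ^ r k"
    using \<rho>1(2) mass off_support[OF c'0] eventually_rate_pos[OF r]
  proof eventually_elim
    case (elim k)
    let ?n = "r k"
    interpret Pn: prob_space "P ?n" by (rule prob_P)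
    have kB: "measure (\<kappa> ?n y) B \<le> (q + \<epsilon>) ^ ?n" if "y \<in> ball x \<rho> \<inter> msupport (P ?n)" for y
    proof -
      have "measure (\<kappa> ?n y) B \<le> (\<integral>Y. F Y ^ ?n \<partial>\<kappa> ?n y)"
      proof (rule integral_power_bounds(1)[OF kernel_prob F elim(4) B])
        show "F Y = 1" if "Y \<in> B" for Y
          using that window_sup_le_1[OF w(1), of t Y] by (simp add: F_def B_def)
      qed
      also have "\<dots> \<le> (q + \<epsilon>) ^ ?n" using elim(1) that \<rho> by auto
      finally show ?thesis .
    qed
    have mb: "measure (P ?n) (ball x \<rho>) \<le> (\<Psi> {x} + \<epsilon>) ^ ?n"
    proof -
      have "measure (P ?n) (ball x \<rho>) \<le> measure (P ?n) (cball x \<rho>2)"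
        using \<rho>(3) by (intro Pn.finite_measure_mono) (auto simp: sets_P)
      with elim(2) show ?thesis by linarith
    qed
    have "measure M {\<omega> \<in> space M. traj (X ?n \<omega>) 0 \<in> ball x \<rho> \<and> traj (X ?n \<omega>) t \<in> E} \<le>
        measure M {\<omega> \<in> space M. X ?n \<omega> \<in> B \<and> traj (X ?n \<omega>) 0 \<in> ball x \<rho>}"
    proof (rule M.finite_measure_mono)
      have "Y \<in> B" if "traj Y t \<in> E" for Y
        using window_sup_ge[OF w(1) t, of Y] bump_eq_1[OF that] by (simp add: B_def)
      then show "{\<omega> \<in> space M. traj (X ?n \<omega>) 0 \<in> ball x \<rho> \<and> traj (X ?n \<omega>) t \<in> E}
        \<subseteq> {\<omega> \<in> space M. X ?n \<omega> \<in> B \<and> traj (X ?n \<omega>) 0 \<in> ball x \<rho>}" by auto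
      have "{\<omega> \<in> space M. X ?n \<omega> \<in> B} \<inter> {\<omega> \<in> space M. traj (X ?n \<omega>) 0 \<in> ball x \<rho>} \<in> sets M"
        using B by (intro sets.Int measurable_path measurable_at) auto
      then show "{\<omega> \<in> space M. X ?n \<omega> \<in> B \<and> traj (X ?n \<omega>) 0 \<in> ball x \<rho>} \<in> sets M"
        by (rule back_subst[of "\<lambda>S. S \<in> sets M"]) auto
    qed
    also have "\<dots> \<le> (q + \<epsilon>) ^ ?n * measure (P ?n) (ball x \<rho>) + measure (P ?n) (- msupport (P ?n))"
      using kB q \<epsilon> B by (intro measure_disintegrate_upper) auto
    also have "\<dots> \<le> (q + \<epsilon>) ^ ?n * (\<Psi> {x} + \<epsilon>) ^ ?n + c' ^ ?n"
      using mb elim(3) q \<epsilon> by (intro add_mono mult_left_mono) auto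
    also have "(q + \<epsilon>) ^ ?n * (\<Psi> {x} + \<epsilon>) ^ ?n \<le> c' ^ ?n"
      unfolding power_mult_distrib[symmetric] using prod q \<epsilon> x by (intro power_mono) auto
    finally show ?case by simp
  qed
  with \<rho>(1) show thesis by (rule that)
qed

text \<open>
  The starting points with \<open>\<Psi> {x} \<ge> c\<close> form a compact set, which is covered by finitely many balls from
  the local bound; the mass of the remaining starting points alone has rate at most \<open>c\<close>.
\<close>

lemma flow_upper:
  assumes D: "closed D" and E: "closed E" "E \<noteq> {}" and t: "0 \<le> t" and c: "0 < c" "c < c'"
    and flow: "\<And>x Y. x \<in> D \<Longrightarrow> traj Y t \<in> E \<Longrightarrow> \<Psi> {x} * \<Phi> x {Y} < c"
  shows "\<forall>\<^sub>F k in sequentially.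
    measure M {\<omega> \<in> space M. traj (X (r k) \<omega>) 0 \<in> D \<and> traj (X (r k) \<omega>) t \<in> E} \<le> c' ^ r k"
proof -
  interpret M: prob_space M by (rule prob)
  let ?K = "D \<inter> {x. c \<le> \<Psi> {x}}"
  let ?flow = "\<lambda>D k. measure M {\<omega> \<in> space M. traj (X (r k) \<omega>) 0 \<in> D \<and> traj (X (r k) \<omega>) t \<in> E}"
  define c1 where "c1 = (c + c') / 2"
  have c1: "c < c1" "c1 < c'" using c by (auto simp: c1_def)
  have K: "compact ?K" using D deviability_compact[OF deviability_\<Psi> c(1)] by (simp add: closed_Int_compact)
  have "\<forall>x\<in>?K. \<exists>\<rho>>0. \<forall>\<^sub>F k in sequentially. ?flow (ball x \<rho>) k \<le> 2 * c1 ^ r k"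
  proof
    fix x assume x: "x \<in> ?K"
    show "\<exists>\<rho>>0. \<forall>\<^sub>F k in sequentially. ?flow (ball x \<rho>) k \<le> 2 * c1 ^ r k"
      by (rule flow_upper_local[OF E t c(1) _ _ c1(1), of x]) (use x flow in auto)
  qed
  from bchoice[OF this] obtain \<rho> where
    \<rho>: "\<forall>x\<in>?K. 0 < \<rho> x \<and> (\<forall>\<^sub>F k in sequentially. ?flow (ball x (\<rho> x)) k \<le> 2 * c1 ^ r k)"
    by blast
  obtain T where T: "T \<subseteq> ?K" "finite T" "?K \<subseteq> (\<Union>x\<in>T. ball x (\<rho> x))"
    by (rule compactE_image[OF K, of ?K "\<lambda>x. ball x (\<rho> x)"]) (use \<rho> in auto)
  define R where "R = D - (\<Union>x\<in>T. ball x (\<rho> x))"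
  have R: "closed R" unfolding R_def using D by (intro closed_Diff open_UN) auto
  have "\<Psi> {x} < c" if "x \<in> R" for x using that T(3) by (auto simp: R_def not_le[symmetric])
  then have evR: "\<forall>\<^sub>F k in sequentially. measure (P (r k)) R \<le> c1 ^ r k"
    using R c c1 by (intro initial_upper) auto
  have evT: "\<forall>\<^sub>F k in sequentially. \<forall>x\<in>T. ?flow (ball x (\<rho> x)) k \<le> 2 * c1 ^ r k"
    using T \<rho> by (intro eventually_ball_finite) auto
  have "\<forall>\<^sub>F k in sequentially. (2 * real (card T) + 1) * c1 ^ r k \<le> c' ^ r k"
    using c c1 r by (intro power_combination_le) auto
  with evR evT show ?thesis
  proof eventually_elim
    case (elim k)
    define A where "A D = {\<omega> \<in> space M. traj (X (r k) \<omega>) 0 \<in> D \<and> traj (X (r k) \<omega>) t \<in> E}" for D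
    have meas: "A B \<in> sets M" if "B \<in> sets borel" for B
      unfolding A_def using t E that by (intro measurable_flow) auto
    have AR: "A R \<in> sets M" and AB: "\<And>x. A (ball x (\<rho> x)) \<in> sets M"
      using R by (auto intro: meas)
    have AU: "(\<Union>x\<in>T. A (ball x (\<rho> x))) \<in> sets M"
      using T(2) AB by (intro sets.finite_UN)
    have "A D \<subseteq> A R \<union> (\<Union>x\<in>T. A (ball x (\<rho> x)))" unfolding A_def R_def by auto
    then have "measure M (A D) \<le> measure M (A R \<union> (\<Union>x\<in>T. A (ball x (\<rho> x))))"
      using AR AU by (intro M.finite_measure_mono sets.Un)
    also have "\<dots> \<le> measure M (A R) + measure M (\<Union>x\<in>T. A (ball x (\<rho> x)))"
      using AR AU by (intro measure_Un_le)
    also have "measure M (\<Union>x\<in>T. A (ball x (\<rho> x))) \<le> (\<Sum>x\<in>T. measure M (A (ball x (\<rho> x))))"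
      using T(2) AB by (intro measure_UNION_le)
    also have "\<dots> \<le> (\<Sum>x\<in>T. 2 * c1 ^ r k)"
      using elim(2) unfolding A_def by (intro sum_mono) simp
    also have "measure M (A R) \<le> measure M {\<omega> \<in> space M. traj (X (r k) \<omega>) 0 \<in> R}"
      unfolding A_def using R by (intro M.finite_measure_mono measurable_at) auto
    also have "\<dots> = measure (P (r k)) R"
      using R by (intro marginal_law) auto
    also note elim(1)
    finally show ?case using elim(3) unfolding A_def by (simp add: algebra_simps)
  qed
qed

text \<open>
  A single path \<open>Y\<close> suffices: starting points near \<open>x\<close> have mass of rate about \<open>\<Psi> {x}\<close>, and from each of those
  in the support the neighbourhood of \<open>Y\<close> given by a window around \<open>t\<close> has rate about \<open>\<Phi> x {Y}\<close>.
\<close>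

lemma flow_lower:
  assumes U: "open U" "x \<in> U" and V: "open V" "traj Y t \<in> V" and t: "0 \<le> t"
    and c: "0 < c" "c < \<Psi> {x} * \<Phi> x {Y}"
  shows "\<forall>\<^sub>F k in sequentially.
    c ^ r k \<le> measure M {\<omega> \<in> space M. traj (X (r k) \<omega>) 0 \<in> U \<and> traj (X (r k) \<omega>) t \<in> V}"
proof -
  interpret M: prob_space M by (rule prob)
  let ?p = "\<Psi> {x}" and ?f = "\<Phi> x {Y}"
  have pos: "0 < ?p" "0 < ?f"
    using c \<Psi>_unit[of "{x}"] \<Phi>_unit[of x "{Y}"] by (auto simp: order_less_le)
  \<comment> \<open>\<open>z\<close> is the factor that both rates may lose: \<open>z\<^sup>2 * ?p * ?f\<close> is halfway between \<open>c\<close> and \<open>?p * ?f\<close>\<close>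
  define z where "z = sqrt ((1 + c / (?p * ?f)) / 2)"
  have z2: "z * z = (1 + c / (?p * ?f)) / 2"
    unfolding z_def using c pos by (simp add: real_sqrt_mult_self)
  have z: "0 < z" "z < 1" "c < (z * ?p) * (z * ?f)"
  proof -
    have "0 < c / (?p * ?f)" "c / (?p * ?f) < 1" using c pos by auto
    then show "0 < z" "z < 1" unfolding z_def by auto
    have "(z * ?p) * (z * ?f) = (z * z) * (?p * ?f)" by (simp add: algebra_simps)
    also have "\<dots> = (?p * ?f + c) / 2" unfolding z2 using pos by (simp add: field_simps)
    finally show "c < (z * ?p) * (z * ?f)" using c by simp
  qed
  obtain \<delta> where \<delta>: "0 < \<delta>" "ball (traj Y t) \<delta> \<subseteq> V" using V by (meson open_contains_ball)
  let ?g = "\<lambda>y. 1 - bump {traj Y t} \<delta> y"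
  interpret unit_function ?g using \<delta>(1) by (rule unit_function_1_minus_bump)
  have "continuous_on {0..} (traj Y)" by (rule continuous_path[OF pos])
  then obtain w where w: "0 < w"
    "\<And>s. 0 \<le> s \<Longrightarrow> \<bar>s - t\<bar> < w \<Longrightarrow> dist (traj Y s) (traj Y t) < \<delta> * ((1 - z) / 2)"
    unfolding continuous_on_iff
    by (drule_tac x = t in bspec, use t in simp, drule_tac x = "\<delta> * ((1 - z) / 2)" in spec)
      (use z \<delta> in \<open>auto simp: dist_real_def\<close>)
  define G where "G Y' = 1 - window_sup ?g t w Y'" for Y'
  have G: "continuous_on UNIV G" "\<And>Y'. 0 \<le> G Y'" "\<And>Y'. G Y' \<le> 1"
    unfolding G_def[abs_def] using window_sup_le_1[OF w(1)] window_sup_nonneg[OF w(1)] w(1) t \<delta>(1)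
    by (auto intro!: continuous_intros continuous_window_sup_1_minus_bump)
  have "window_sup ?g t w Y \<le> (1 - z) / 2"
  proof (rule window_sup_least[OF w(1)])
    fix s assume s: "0 \<le> s" "\<bar>s - t\<bar> < w"
    from w(2)[OF this] \<delta>(1) have "dist (traj Y s) (traj Y t) / \<delta> \<le> (1 - z) / 2"
      by (simp add: field_simps)
    moreover have "1 - dist (traj Y s) (traj Y t) / \<delta> \<le> bump {traj Y t} \<delta> (traj Y s)"
      by (simp add: bump_def)
    ultimately show "?g (traj Y s) \<le> (1 - z) / 2" by linarith
  qed (use z in simp)
  then have "z < G Y" using z by (simp add: G_def field_simps)
  then have "z * ?f < G Y * ?f" using pos by simp
  then obtain \<rho>1 where \<rho>1: "0 < \<rho>1" "\<forall>\<^sub>F k in sequentially. \<forall>y \<in> ball x \<rho>1 \<inter> msupport (P (r k)).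
      (z * ?f) ^ r k \<le> (\<integral>Y'. G Y' ^ r k \<partial>\<kappa> (r k) y)"
    by (rule kernel_lower[OF G, of "z * ?f" Y x]) (use z pos in auto)
  obtain \<rho>2 where \<rho>2: "0 < \<rho>2" "ball x \<rho>2 \<subseteq> U" using U by (meson open_contains_ball)
  define \<rho> where "\<rho> = min \<rho>1 \<rho>2"
  have \<rho>: "0 < \<rho>" "ball x \<rho> \<subseteq> ball x \<rho>1" "ball x \<rho> \<subseteq> U" using \<rho>1 \<rho>2 by (auto simp: \<rho>_def)
  have mass: "\<forall>\<^sub>F k in sequentially. (z * ?p) ^ r k \<le> measure (P (r k)) (ball x \<rho>)"
    using \<rho> z pos by (intro initial_lower[of _ x]) auto
  have off: "\<forall>\<^sub>F k in sequentially. measure (P (r k)) (- msupport (P (r k))) \<le> (z * ?p / 2) ^ r k"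
    using z pos by (intro off_support) auto
  have half: "\<forall>\<^sub>F k in sequentially. 2 * (z * ?p / 2) ^ r k \<le> (z * ?p) ^ r k"
    using z pos r by (intro power_combination_le) auto
  have fin: "\<forall>\<^sub>F k in sequentially. 2 * c ^ r k \<le> ((z * ?p) * (z * ?f)) ^ r k"
    using z c r by (intro power_combination_le) auto
  define B where "B = {Y'. 0 < G Y'}"
  have "open B" unfolding B_def by (intro open_Collect_less G(1) continuous_intros)
  then have B: "B \<in> sets borel" by simp
  have BV: "traj Y' t \<in> V" if "Y' \<in> B" for Y'
  proof -
    have "?g (traj Y' t) < 1"
      using that window_sup_ge[OF w(1) t, of Y'] by (simp add: B_def G_def)
    then have "0 < bump {traj Y t} \<delta> (traj Y' t)" by simp
    then show ?thesis using \<delta> by (auto simp: bump_pos_iff subset_iff dist_commute)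
  qed
  from \<rho>1(2) mass off half fin eventually_rate_pos[OF r] show ?thesis
  proof eventually_elim
    case (elim k)
    let ?n = "r k"
    have kB: "(z * ?f) ^ ?n \<le> measure (\<kappa> ?n y) B" if "y \<in> ball x \<rho> \<inter> msupport (P ?n)" for y
    proof -
      have "(z * ?f) ^ ?n \<le> (\<integral>Y'. G Y' ^ ?n \<partial>\<kappa> ?n y)" using elim(1) that \<rho> by auto
      also have "\<dots> \<le> measure (\<kappa> ?n y) B"
        using G(2) by (intro integral_power_bounds(2)[OF kernel_prob G elim(6) B]) (auto simp: B_def order_less_le)
      finally show ?thesis .
    qed
    have "2 * c ^ ?n \<le> (z * ?f) ^ ?n * (z * ?p) ^ ?n"
      using elim(5) by (simp add: power_mult_distrib mult_ac)
    then have "c ^ ?n \<le> (z * ?f) ^ ?n * ((z * ?p) ^ ?n / 2)" by simp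
    also have "\<dots> \<le> (z * ?f) ^ ?n * (measure (P ?n) (ball x \<rho>) - measure (P ?n) (- msupport (P ?n)))"
      using elim(2,3,4) z pos by (intro mult_left_mono) auto
    also have "\<dots> \<le> measure M {\<omega> \<in> space M. X ?n \<omega> \<in> B \<and> traj (X ?n \<omega>) 0 \<in> ball x \<rho>}"
      using kB B z pos by (intro measure_disintegrate_lower) auto
    also have "\<dots> \<le> measure M {\<omega> \<in> space M. traj (X ?n \<omega>) 0 \<in> U \<and> traj (X ?n \<omega>) t \<in> V}"
      using U V t \<rho>(3) BV by (intro M.finite_measure_mono measurable_flow) auto
    finally show ?case .
  qed
qed

section \<open>Consequences of stationarity\<close>

lemma exponential_rates_le:
  fixes c d :: real
  assumes "\<forall>\<^sub>F k in sequentially. c ^ r k \<le> m k" "\<forall>\<^sub>F k in sequentially. m k \<le> d ^ r k" "0 \<le> d"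
  shows "c \<le> d"
proof (rule ccontr)
  assume "\<not> c \<le> d"
  then have "d < c" by simp
  from assms(1,2) eventually_rate_pos[OF r] have "\<forall>\<^sub>F k in sequentially. False"
  proof eventually_elim
    case (elim k)
    have "d ^ r k < c ^ r k" using \<open>d < c\<close> assms(3) elim(3) by (intro power_strict_mono) auto
    with elim(1,2) show ?case by linarith
  qed
  then show False by simp
qed

text \<open>
  The paths near \<open>Y\<close> contribute with rate \<open>\<Psi> {x} * \<Phi> x {Y}\<close> to the law of \<open>X\<^sub>t\<close> near \<open>traj Y t\<close>, which by
  stationarity has rate \<open>\<Psi> {traj Y t}\<close>.
\<close>

lemma transport:
  assumes t: "0 \<le> t"
  shows "\<Psi> {x} * \<Phi> x {Y} \<le> \<Psi> {traj Y t}"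
proof (rule ccontr)
  let ?y = "traj Y t"
  assume "\<not> ?thesis"
  then have "\<Psi> {?y} < \<Psi> {x} * \<Phi> x {Y}" by simp
  then obtain c1 where c1: "\<Psi> {?y} < c1" "c1 < \<Psi> {x} * \<Phi> x {Y}" using dense by blast
  then obtain c0 where c0: "\<Psi> {?y} < c0" "c0 < c1" using dense by blast
  obtain c2 where c2: "c1 < c2" "c2 < \<Psi> {x} * \<Phi> x {Y}" using c1 dense by blast
  have c0_pos: "0 < c0" using c0 \<Psi>_unit[of "{?y}"] by linarith
  obtain \<rho> where \<rho>: "0 < \<rho>" "\<And>y. y \<in> cball ?y \<rho> \<Longrightarrow> \<Psi> {y} < c0"
    using usc_cball[OF c0(1)] by blast
  have up: "\<forall>\<^sub>F k in sequentially. measure (P (r k)) (cball ?y \<rho>) \<le> c1 ^ r k"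
    using \<rho> c0 c0_pos by (intro initial_upper[where c = c0]) auto
  have low: "\<forall>\<^sub>F k in sequentially. c2 ^ r k \<le>
      measure M {\<omega> \<in> space M. traj (X (r k) \<omega>) 0 \<in> UNIV \<and> traj (X (r k) \<omega>) t \<in> ball ?y \<rho>}"
    using \<rho> t c0 c0_pos c1 c2 by (intro flow_lower[of UNIV x "ball ?y \<rho>" Y]) auto
  have "\<forall>\<^sub>F k in sequentially. c2 ^ r k \<le> measure (P (r k)) (cball ?y \<rho>)"
    using low
  proof eventually_elim
    case (elim k)
    interpret Pn: prob_space "P (r k)" by (rule prob_P)
    have "c2 ^ r k \<le> measure (P (r k)) (ball ?y \<rho>)"
      using elim marginal_law[OF t, of "ball ?y \<rho>" "r k"] by simp
    also have "\<dots> \<le> measure (P (r k)) (cball ?y \<rho>)"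
      by (intro Pn.finite_measure_mono) (auto simp: sets_P)
    finally show ?case .
  qed
  from exponential_rates_le[OF this up] c0 c0_pos c2 show False by linarith
qed

text \<open>
  Neighbourhoods of \<open>x\<close> and of \<open>traj Y 0\<close> cannot both contain \<open>X\<^sub>0\<close> if they are disjoint, but the lower bound
  at \<open>t = 0\<close> would give this event positive probability.
\<close>

lemma path_starts_at:
  assumes x: "0 < \<Psi> {x}" and Y: "0 < \<Phi> x {Y}"
  shows "traj Y 0 = x"
proof (rule ccontr)
  assume ne: "traj Y 0 \<noteq> x"
  then obtain U V where UV: "open U" "open V" "x \<in> U" "traj Y 0 \<in> V" "U \<inter> V = {}"
    using hausdorff[of x "traj Y 0"] by auto
  define c where "c = \<Psi> {x} * \<Phi> x {Y} / 2"
  have c: "0 < c" "c < \<Psi> {x} * \<Phi> x {Y}" using x Y by (auto simp: c_def)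
  have "\<forall>\<^sub>F k in sequentially. c ^ r k \<le>
      measure M {\<omega> \<in> space M. traj (X (r k) \<omega>) 0 \<in> U \<and> traj (X (r k) \<omega>) 0 \<in> V}"
    using UV c by (intro flow_lower[of U x V Y]) auto
  moreover have "{\<omega> \<in> space M. traj (X n \<omega>) 0 \<in> U \<and> traj (X n \<omega>) 0 \<in> V} = {}" for n
    using UV(5) by auto
  ultimately have "\<forall>\<^sub>F k in sequentially. c ^ r k \<le> 0" by simp
  then have "\<forall>\<^sub>F k in sequentially. False"
  proof eventually_elim
    case (elim k)
    then show ?case using zero_less_power[OF c(1), of "r k"] by linarith
  qed
  then show False by simp
qed

text \<open>
  The mass near \<open>y\<close> at time \<open>t\<close> has rate \<open>\<Psi> {y}\<close> by stationarity, and by the upper bound it must be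
  supplied by some path.
\<close>

lemma predecessor:
  assumes y: "0 < c" "c < \<Psi> {y}" and t: "0 \<le> t" and \<rho>: "0 < \<rho>"
  shows "\<exists>x Y. dist y (traj Y t) \<le> \<rho> \<and> c \<le> \<Psi> {x} * \<Phi> x {Y}"
proof (rule ccontr)
  assume neg: "\<not> ?thesis"
  obtain c1 where c1: "c < c1" "c1 < \<Psi> {y}" using y(2) dense by blast
  obtain c2 where c2: "c1 < c2" "c2 < \<Psi> {y}" using c1(2) dense by blast
  have up: "\<forall>\<^sub>F k in sequentially.
      measure M {\<omega> \<in> space M. traj (X (r k) \<omega>) 0 \<in> UNIV \<and> traj (X (r k) \<omega>) t \<in> cball y \<rho>} \<le> c1 ^ r k"
  proof (rule flow_upper[OF closed_UNIV closed_cball _ t y(1) c1(1)])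
    show "\<Psi> {x} * \<Phi> x {Y} < c" if "traj Y t \<in> cball y \<rho>" for x Y
      using neg that unfolding mem_cball by (meson not_le)
  qed (use \<rho> in auto)
  have low: "\<forall>\<^sub>F k in sequentially. c2 ^ r k \<le> measure (P (r k)) (ball y \<rho>)"
    using \<rho> y c1 c2 by (intro initial_lower[of _ y]) auto
  have "\<forall>\<^sub>F k in sequentially. c2 ^ r k \<le>
      measure M {\<omega> \<in> space M. traj (X (r k) \<omega>) 0 \<in> UNIV \<and> traj (X (r k) \<omega>) t \<in> cball y \<rho>}"
    using low
  proof eventually_elim
    case (elim k)
    interpret Pn: prob_space "P (r k)" by (rule prob_P)
    have "measure (P (r k)) (ball y \<rho>) \<le> measure (P (r k)) (cball y \<rho>)"
      by (intro Pn.finite_measure_mono) (auto simp: sets_P)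
    with elim marginal_law[OF t, of "cball y \<rho>" "r k"] show ?case by simp
  qed
  from exponential_rates_le[OF this up] y c1 c2 show False by linarith
qed

text \<open>
  The probabilities of leaving and of entering \<open>D\<close> between the times \<open>0\<close> and \<open>t\<close> agree, because \<open>X\<^sub>0\<close> and
  \<open>X\<^sub>t\<close> have the same law. The upper bound needs closed sets and the lower bound open sets, whence the
  closure and the interior.
\<close>

lemma flow_balance:
  assumes D: "closed D" and t: "0 \<le> t" and c: "0 < c"
    and out: "\<And>x Y. x \<in> D \<Longrightarrow> traj Y t \<in> closure (- D) \<Longrightarrow> \<Psi> {x} * \<Phi> x {Y} < c"
    and x: "x \<notin> D" and Y: "traj Y t \<in> interior D"
  shows "\<Psi> {x} * \<Phi> x {Y} \<le> c"
proof (rule ccontr)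
  assume "\<not> ?thesis"
  then obtain c1 where c1: "c < c1" "c1 < \<Psi> {x} * \<Phi> x {Y}" using dense not_le by metis
  then obtain c2 where c2: "c1 < c2" "c2 < \<Psi> {x} * \<Phi> x {Y}" using dense by blast
  let ?A = "\<lambda>D E k. {\<omega> \<in> space M. traj (X (r k) \<omega>) 0 \<in> D \<and> traj (X (r k) \<omega>) t \<in> E}"
  have "- D \<noteq> {}" using x by auto
  then have up: "\<forall>\<^sub>F k in sequentially. measure M (?A D (closure (- D)) k) \<le> c1 ^ r k"
    using D t c c1 out by (intro flow_upper) auto
  have low: "\<forall>\<^sub>F k in sequentially. c2 ^ r k \<le> measure M (?A (- D) (interior D) k)"
    using D t c c1 c2 x Y by (intro flow_lower[of _ x _ Y]) auto
  have "\<forall>\<^sub>F k in sequentially. c2 ^ r k \<le> measure M (?A D (closure (- D)) k)"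
    using low
  proof eventually_elim
    case (elim k)
    interpret M: prob_space M by (rule prob)
    have D': "D \<in> sets borel" "- D \<in> sets borel" using D by auto
    have cl: "closure (- D) \<in> sets borel" by simp
    have 0: "(0::real) \<le> 0" by simp
    have meas: "?A D D k \<in> sets M" "?A (- D) D k \<in> sets M" "?A D (- D) k \<in> sets M"
        "?A D (closure (- D)) k \<in> sets M"
      using measurable_flow[OF 0 t D'(1) D'(1)] measurable_flow[OF 0 t D'(2) D'(1)]
        measurable_flow[OF 0 t D'] measurable_flow[OF 0 t D'(1) cl] by blast+
    have eq1: "{\<omega> \<in> space M. traj (X (r k) \<omega>) t \<in> D} = ?A D D k \<union> ?A (- D) D k"
      and eq2: "{\<omega> \<in> space M. traj (X (r k) \<omega>) 0 \<in> D} = ?A D D k \<union> ?A D (- D) k" by auto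
    have "measure M (?A D D k \<union> ?A (- D) D k) = measure M (?A D D k) + measure M (?A (- D) D k)"
      by (rule M.finite_measure_Union[OF meas(1,2)]) auto
    moreover have "measure M (?A D D k \<union> ?A D (- D) k) = measure M (?A D D k) + measure M (?A D (- D) k)"
      by (rule M.finite_measure_Union[OF meas(1,3)]) auto
    moreover have "measure M {\<omega> \<in> space M. traj (X (r k) \<omega>) t \<in> D} =
        measure M {\<omega> \<in> space M. traj (X (r k) \<omega>) 0 \<in> D}"
      using marginal_law[OF t D'(1)] marginal_law[OF 0 D'(1)] by simp
    ultimately have "measure M (?A (- D) D k) = measure M (?A D (- D) k)"
      unfolding eq1 eq2 by linarith
    moreover have "measure M (?A (- D) (interior D) k) \<le> measure M (?A (- D) D k)"
      using interior_subset[of D] by (intro M.finite_measure_mono[OF _ meas(2)]) blast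
    moreover have "measure M (?A D (- D) k) \<le> measure M (?A D (closure (- D)) k)"
      using closure_subset[of "- D"] by (intro M.finite_measure_mono[OF _ meas(4)]) blast
    ultimately show ?case using elim by linarith
  qed
  from exponential_rates_le[OF this up] c c1 c2 show False by linarith
qed

end

section \<open>The idempotent Markov process\<close>

definition reach :: "('s \<Rightarrow> 's::topological_space cadlag set \<Rightarrow> real) \<Rightarrow> 's \<Rightarrow> 's \<Rightarrow> real" where
  "reach \<Phi> x y = (SUP t\<in>{0..}. marginal \<Phi> x t y)"

locale idempotent_process =
  fixes \<Phi> :: "'s \<Rightarrow> 's::metric_space cadlag set \<Rightarrow> real"
  assumes deviability_\<Phi>: "\<And>x. deviability (\<Phi> x)"
    and markov: "\<And>Y x s. s \<ge> 0 \<Longrightarrow> \<Phi> x {Y} = \<Phi> x (same_upto s Y) * \<Phi> (traj Y s) {shift_traj s Y}"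
begin

lemmas \<Phi>_unit = deviability_unit[OF deviability_\<Phi>]

lemma \<Phi>_eq_sup: "\<Phi> x E = sup0 ((\<lambda>Y. \<Phi> x {Y}) ` E)"
  using deviability_\<Phi>[of x] unfolding deviability_def by blast

lemma \<Phi>_mono: "Y \<in> E \<Longrightarrow> \<Phi> x {Y} \<le> \<Phi> x E"
  unfolding \<Phi>_eq_sup[of x E] using \<Phi>_unit by (intro sup0_upper[where c = 1]) auto

lemma less_\<Phi>E:
  assumes "c < \<Phi> x E" "0 \<le> c"
  obtains Y where "Y \<in> E" "c < \<Phi> x {Y}"
  using assms(1) less_sup0E[of c "(\<lambda>Y. \<Phi> x {Y}) ` E"] assms(2) unfolding \<Phi>_eq_sup[of x E] by blast

lemma almost_sure_path:
  assumes "c < 1"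
  obtains Y where "c < \<Phi> x {Y}"
proof -
  have "sup0 (range (\<lambda>Y. \<Phi> x {Y})) = 1"
    using deviability_\<Phi>[of x] unfolding deviability_def by blast
  moreover have "max c 0 < 1" using assms by simp
  ultimately obtain y where "y \<in> range (\<lambda>Y. \<Phi> x {Y})" "max c 0 < y"
    using less_sup0E[of "max c 0" "range (\<lambda>Y. \<Phi> x {Y})"] by auto
  then show thesis using that by auto
qed

lemma marginal_unit: "0 \<le> marginal \<Phi> x t y" "marginal \<Phi> x t y \<le> 1"
  unfolding marginal_def using \<Phi>_unit
  by (auto intro!: sup0_nonneg[where c = 1] sup0_least)

lemma marginal_upper: "\<Phi> x {Y} \<le> marginal \<Phi> x t (traj Y t)"
  unfolding marginal_def using \<Phi>_unit by (intro sup0_upper[where c = 1]) auto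

lemma less_marginalE:
  assumes "c < marginal \<Phi> x t y" "0 \<le> c"
  obtains Y where "traj Y t = y" "c < \<Phi> x {Y}"
  using assms less_sup0E[of c "(\<lambda>Y. \<Phi> x {Y}) ` {Y. traj Y t = y}"] unfolding marginal_def by blast

lemma bdd_marginal: "bdd_above ((\<lambda>t. marginal \<Phi> x t y) ` {0..})"
  using marginal_unit by (intro bdd_aboveI2[where M = 1]) auto

lemma marginal_le_reach: "0 \<le> t \<Longrightarrow> marginal \<Phi> x t y \<le> reach \<Phi> x y"
  unfolding reach_def by (intro cSUP_upper bdd_marginal) simp

lemma path_le_reach: "0 \<le> t \<Longrightarrow> \<Phi> x {Y} \<le> reach \<Phi> x (traj Y t)"
  using marginal_upper marginal_le_reach by (meson order_trans)

lemma reach_nonneg: "0 \<le> reach \<Phi> x y"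
  using marginal_unit(1)[of x 0 y] marginal_le_reach[of 0 x y] by linarith

lemma reach_le_1: "reach \<Phi> x y \<le> 1"
  unfolding reach_def by (intro cSUP_least marginal_unit) simp

lemma less_reachE:
  assumes "c < reach \<Phi> x y" "0 \<le> c"
  obtains Y t where "0 \<le> t" "traj Y t = y" "c < \<Phi> x {Y}"
proof -
  obtain t where "t \<in> {0..}" "c < marginal \<Phi> x t y"
    using assms(1) bdd_marginal unfolding reach_def by (subst (asm) less_cSUP_iff) auto
  then show thesis using assms(2) that by (auto elim: less_marginalE)
qed

lemma prefix_le_reach: "0 \<le> s \<Longrightarrow> \<Phi> x (same_upto s Y) \<le> reach \<Phi> x (traj Y s)"
proof -
  assume s: "0 \<le> s"
  have "\<Phi> x {Z} \<le> reach \<Phi> x (traj Y s)" if "Z \<in> same_upto s Y" for Z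
    using path_le_reach[OF s, of x Z] that s by (simp add: same_upto_def)
  then show ?thesis unfolding \<Phi>_eq_sup[of x "same_upto s Y"] using reach_nonneg by (intro sup0_least) auto
qed

lemma path_split:
  assumes "0 \<le> s" "s \<le> t"
  shows "\<Phi> x {Y} \<le> reach \<Phi> x (traj Y s) * reach \<Phi> (traj Y s) (traj Y t)"
proof -
  have "\<Phi> (traj Y s) {shift_traj s Y} \<le> reach \<Phi> (traj Y s) (traj Y t)"
    using path_le_reach[of "t - s" "traj Y s" "shift_traj s Y"] assms by (simp add: traj_shift)
  then show ?thesis
    unfolding markov[OF assms(1), of x Y] using assms prefix_le_reach reach_nonneg \<Phi>_unit
    by (intro mult_mono) auto
qed

lemma concat_path:
  assumes s: "0 \<le> s" and Y: "traj Y s = traj Z 0"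
  obtains W where "W \<in> same_upto s Y" "shift_traj s W = Z" "\<Phi> x {Y} * \<Phi> (traj Z 0) {Z} \<le> \<Phi> x {W}"
proof -
  obtain W where W: "W \<in> same_upto s Y" "shift_traj s W = Z" using concat_cadlag[OF s Y] .
  have "same_upto s W = same_upto s Y" using W(1) by (auto simp: same_upto_def)
  moreover have "traj W s = traj Z 0" using W(1) Y s by (simp add: same_upto_def)
  ultimately have "\<Phi> x {W} = \<Phi> x (same_upto s Y) * \<Phi> (traj Z 0) {Z}"
    using markov[OF s, of x W] W(2) by simp
  moreover have "\<Phi> x {Y} \<le> \<Phi> x (same_upto s Y)" by (rule \<Phi>_mono) (simp add: same_upto_def)
  ultimately have "\<Phi> x {Y} * \<Phi> (traj Z 0) {Z} \<le> \<Phi> x {W}" using \<Phi>_unit by (simp add: mult_right_mono)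
  with W show thesis by (rule that)
qed

end

text \<open>
  The last four assumptions summarise what stationarity gives; from here on everything is a statement
  about deviabilities. Points with \<open>\<Psi> {x} = 0\<close> are avoided throughout, since
  paths of positive deviability under \<open>\<Phi> x\<close> could start elsewhere.
\<close>

locale stationary_deviability = idempotent_process \<Phi>
  for \<Phi> :: "'s \<Rightarrow> 's::metric_space cadlag set \<Rightarrow> real" +
  fixes \<Psi> :: "'s set \<Rightarrow> real" and A :: "'s set"
  assumes deviability_\<Psi>: "deviability \<Psi>"
    and usc: "upper_semicontinuous (\<lambda>(x, Y). \<Phi> x {Y})"
    and compact_paths: "\<And>\<gamma> K. 0 < \<gamma> \<Longrightarrow> \<gamma> \<le> 1 \<Longrightarrow> compact K \<Longrightarrow> compact (\<Union>x\<in>K. {Y. \<Phi> x {Y} \<ge> \<gamma>})"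
    and locally_finite: "\<And>K. compact K \<Longrightarrow> finite (K \<inter> A)"
    and approach: "\<And>x Y. \<Phi> x {Y} = 1 \<Longrightarrow> (INF t\<in>{0..}. infdist (traj Y t) A) = 0"
    and rest: "\<And>b Y. b \<in> A \<Longrightarrow> (\<And>t. t \<ge> 0 \<Longrightarrow> traj Y t = b) \<Longrightarrow> \<Phi> b {Y} = 1"
    and connected: "\<And>b b'. b \<in> A \<Longrightarrow> b' \<in> A \<Longrightarrow> \<exists>t>0. marginal \<Phi> b t b' > 0"
    and attract: "\<And>\<epsilon>. \<epsilon> > 0 \<Longrightarrow> \<exists>\<delta>>0. \<forall>x. infdist x A < \<delta> \<longrightarrow>
          (\<exists>s\<^sub>0>0. \<exists>s\<^sub>1>0. \<exists>b\<in>A. marginal \<Phi> x s\<^sub>0 b > 1 - \<epsilon> \<and> marginal \<Phi> b s\<^sub>1 x > 1 - \<epsilon>)"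
    and local_return: "\<And>x \<epsilon>. \<epsilon> > 0 \<Longrightarrow> \<exists>\<delta>>0. \<exists>t\<^sub>0\<ge>0. \<exists>t\<^sub>1\<ge>0. \<forall>x'. dist x x' < \<delta> \<longrightarrow>
          marginal \<Phi> x t\<^sub>0 x' > 1 - \<epsilon> \<and> marginal \<Phi> x' t\<^sub>1 x > 1 - \<epsilon>"
    and transport: "\<And>t x Y. 0 \<le> t \<Longrightarrow> \<Psi> {x} * \<Phi> x {Y} \<le> \<Psi> {traj Y t}"
    and path_starts_at: "\<And>x Y. 0 < \<Psi> {x} \<Longrightarrow> 0 < \<Phi> x {Y} \<Longrightarrow> traj Y 0 = x"
    and predecessor: "\<And>c y t \<rho>. 0 < c \<Longrightarrow> c < \<Psi> {y} \<Longrightarrow> 0 \<le> t \<Longrightarrow> 0 < \<rho> \<Longrightarrow>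
          \<exists>x Y. dist y (traj Y t) \<le> \<rho> \<and> c \<le> \<Psi> {x} * \<Phi> x {Y}"
    and flow_balance: "\<And>D t c x Y. closed D \<Longrightarrow> 0 \<le> t \<Longrightarrow> 0 < c \<Longrightarrow>
          (\<And>x Y. x \<in> D \<Longrightarrow> traj Y t \<in> closure (- D) \<Longrightarrow> \<Psi> {x} * \<Phi> x {Y} < c) \<Longrightarrow>
          x \<notin> D \<Longrightarrow> traj Y t \<in> interior D \<Longrightarrow> \<Psi> {x} * \<Phi> x {Y} \<le> c"
begin

lemmas \<Psi>_unit = deviability_unit[OF deviability_\<Psi>]

abbreviation V :: "'s \<Rightarrow> 's \<Rightarrow> real" where "V \<equiv> reach \<Phi>"

lemma reach_transport: "\<Psi> {x} * V x y \<le> \<Psi> {y}"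
proof (rule ccontr)
  assume "\<not> ?thesis"
  then have lt: "\<Psi> {y} < \<Psi> {x} * V x y" by simp
  then have x: "0 < \<Psi> {x}" using \<Psi>_unit[of "{x}"] \<Psi>_unit[of "{y}"] by (auto simp: order_less_le)
  with lt have "\<Psi> {y} / \<Psi> {x} < V x y" by (simp add: field_simps)
  then obtain Y t where Y: "0 \<le> t" "traj Y t = y" "\<Psi> {y} / \<Psi> {x} < \<Phi> x {Y}"
    by (rule less_reachE) (use x \<Psi>_unit in auto)
  then show False using transport[OF Y(1), of x Y] x by (simp add: field_simps)
qed

lemma reach_pos: "0 < \<Psi> {x} \<Longrightarrow> 0 < V x y \<Longrightarrow> 0 < \<Psi> {y}"
  using reach_transport[of x y] by (meson less_le_trans mult_pos_pos)

text \<open>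
  Two paths are concatenated, which requires that the second one starts at \<open>y\<close>; this is known for
  \<open>\<Psi> {y} > 0\<close>.
\<close>

lemma reach_trans:
  assumes y: "0 < \<Psi> {y}"
  shows "V x y * V y z \<le> V x z"
proof (rule ccontr)
  assume "\<not> ?thesis"
  then have lt: "V x z < V x y * V y z" by simp
  have yz: "0 < V y z" using lt reach_nonneg[of x z] reach_nonneg[of y z] by (auto simp: order_less_le)
  have "V x z / V y z < V x y" using lt yz by (simp add: field_simps)
  then obtain Y s where Y: "0 \<le> s" "traj Y s = y" "V x z / V y z < \<Phi> x {Y}"
    by (rule less_reachE) (use reach_nonneg in auto)
  have Ypos: "0 < \<Phi> x {Y}" using Y(3) reach_nonneg[of x z] yz by (meson divide_nonneg_pos le_less_trans)
  have "V x z / \<Phi> x {Y} < V y z" using Y(3) yz Ypos by (simp add: field_simps)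
  then obtain Z t where Z: "0 \<le> t" "traj Z t = z" "V x z / \<Phi> x {Y} < \<Phi> y {Z}"
    by (rule less_reachE) (use reach_nonneg Ypos in auto)
  have Zpos: "0 < \<Phi> y {Z}" using Z(3) reach_nonneg[of x z] Ypos by (meson divide_nonneg_pos le_less_trans)
  have Z0: "traj Z 0 = y" by (rule path_starts_at[OF y Zpos])
  obtain W where W: "W \<in> same_upto s Y" "shift_traj s W = Z" "\<Phi> x {Y} * \<Phi> y {Z} \<le> \<Phi> x {W}"
    using concat_path[OF Y(1), of Y Z x] Y(2) Z0 by auto
  have "traj W (s + t) = z" using W(2) Z(1,2) by (metis traj_shift)
  then have "\<Phi> x {W} \<le> V x z" using path_le_reach[of "s + t" x W] Y(1) Z(1) by simp
  with W(3) have "\<Phi> x {Y} * \<Phi> y {Z} \<le> V x z" by simp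
  with Z(3) Ypos show False by (simp add: field_simps)
qed

lemma local_reach:
  assumes "e < 1"
  shows "\<exists>\<delta>>0. \<forall>x'. dist x x' < \<delta> \<longrightarrow> e < V x x' \<and> e < V x' x"
proof -
  have "0 < 1 - e" using assms by simp
  from local_return[OF this, of x] obtain \<delta> t\<^sub>0 t\<^sub>1 where \<delta>: "\<delta> > 0" "t\<^sub>0 \<ge> 0" "t\<^sub>1 \<ge> 0"
    "\<forall>x'. dist x x' < \<delta> \<longrightarrow> marginal \<Phi> x t\<^sub>0 x' > 1 - (1 - e) \<and> marginal \<Phi> x' t\<^sub>1 x > 1 - (1 - e)" by blast
  have "e < V x x' \<and> e < V x' x" if "dist x x' < \<delta>" for x'
    using \<delta>(4)[rule_format, OF that] marginal_le_reach[OF \<delta>(2), of x x'] marginal_le_reach[OF \<delta>(3), of x' x]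
    by linarith
  with \<delta>(1) show ?thesis by blast
qed

lemma attract_reach:
  assumes "e < 1"
  obtains \<delta> where "0 < \<delta>" "\<And>x. infdist x A < \<delta> \<Longrightarrow> \<exists>b\<in>A. e < V x b \<and> e < V b x"
proof -
  have "0 < 1 - e" using assms by simp
  from attract[OF this] obtain \<delta> where \<delta>: "\<delta> > 0" "\<forall>x. infdist x A < \<delta> \<longrightarrow>
      (\<exists>s\<^sub>0>0. \<exists>s\<^sub>1>0. \<exists>b\<in>A. marginal \<Phi> x s\<^sub>0 b > 1 - (1 - e) \<and> marginal \<Phi> b s\<^sub>1 x > 1 - (1 - e))" by blast
  show thesis
  proof (rule that[OF \<delta>(1)])
    fix x assume "infdist x A < \<delta>"
    then obtain s\<^sub>0 s\<^sub>1 b where "s\<^sub>0 > 0" "s\<^sub>1 > 0" "b \<in> A"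
      "marginal \<Phi> x s\<^sub>0 b > 1 - (1 - e)" "marginal \<Phi> b s\<^sub>1 x > 1 - (1 - e)" using \<delta>(2) by blast
    then show "\<exists>b\<in>A. e < V x b \<and> e < V b x"
      using marginal_le_reach[of s\<^sub>0 x b] marginal_le_reach[of s\<^sub>1 b x] by (intro bexI[of _ b]) auto
  qed
qed

lemma reach_in_A_pos: "b \<in> A \<Longrightarrow> b' \<in> A \<Longrightarrow> 0 < V b b'"
  using connected[of b b'] marginal_le_reach[of _ b b'] by (meson less_le_trans less_imp_le)

lemma constant_path:
  assumes "b \<in> A"
  obtains Y where "\<And>t. traj Y t = b" "\<Phi> b {Y} = 1"
proof -
  have "is_cadlag (\<lambda>_::real. b)" unfolding is_cadlag_def by (auto intro: exI[of _ b])
  then have eq: "traj (Traj (\<lambda>_. b)) = (\<lambda>_. b)" by (intro Traj_inverse) simp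
  then have "\<Phi> b {Traj (\<lambda>_. b)} = 1" by (intro rest[OF assms]) simp
  with eq show thesis by (intro that[of "Traj (\<lambda>_. b)"]) auto
qed

lemma reach_self: "b \<in> A \<Longrightarrow> V b b = 1"
proof -
  assume "b \<in> A"
  then obtain Y where "\<And>t. traj Y t = b" "\<Phi> b {Y} = 1" using constant_path by blast
  then have "1 \<le> V b b" using path_le_reach[of 0 b Y] by simp
  with reach_le_1[of b b] show ?thesis by simp
qed

text \<open>
  Waiting at a point of \<open>A\<close> is free, so that the marginals at such a point increase with time and
  their limit is the supremum \<open>reach\<close>.
\<close>

lemma stay_path:
  assumes b: "b \<in> A" and Y: "traj Y s = b" and s: "0 \<le> s" "s \<le> t"
  obtains Z where "traj Z t = b" "\<Phi> x {Y} \<le> \<Phi> x {Z}"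
proof -
  obtain R where R: "\<And>t. traj R t = b" "\<Phi> b {R} = 1" using constant_path[OF b] by blast
  obtain Z where Z: "Z \<in> same_upto s Y" "shift_traj s Z = R" "\<Phi> x {Y} * \<Phi> b {R} \<le> \<Phi> x {Z}"
    using concat_path[OF s(1), of Y R x] Y R(1) by auto
  have "traj Z (s + (t - s)) = b" using Z(2) R(1) s by (metis traj_shift diff_ge_0_iff_ge)
  then show thesis using Z(3) R(2) by (intro that[of Z]) auto
qed

lemma marginal_mono:
  assumes "b \<in> A" "0 \<le> s" "s \<le> t"
  shows "marginal \<Phi> x s b \<le> marginal \<Phi> x t b"
proof -
  have "\<Phi> x {Y} \<le> marginal \<Phi> x t b" if Y: "traj Y s = b" for Y
  proof -
    obtain Z where "traj Z t = b" "\<Phi> x {Y} \<le> \<Phi> x {Z}" using stay_path[OF assms(1) Y assms(2,3)] .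
    then show ?thesis using marginal_upper[of x Z t] by simp
  qed
  then show ?thesis unfolding marginal_def[of \<Phi> x s b] using marginal_unit by (intro sup0_least) auto
qed

lemma limit_marginal_eq_reach:
  assumes "b \<in> A"
  shows "limit_marginal \<Phi> x b = V x b"
proof -
  have "((\<lambda>t. marginal \<Phi> x t b) \<longlongrightarrow> V x b) at_top"
  proof (rule order_tendstoI)
    fix c assume "c < V x b"
    then obtain s where s: "0 \<le> s" "c < marginal \<Phi> x s b"
      using bdd_marginal unfolding reach_def by (subst (asm) less_cSUP_iff) auto
    show "\<forall>\<^sub>F t in at_top. c < marginal \<Phi> x t b"
      using eventually_ge_at_top[of s]
      by eventually_elim (use marginal_mono[OF assms s(1), of _ x] s(2) in force)
  next
    fix c assume c: "V x b < c"
    show "\<forall>\<^sub>F t in at_top. marginal \<Phi> x t b < c"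
      using eventually_ge_at_top[of "0::real"]
      by eventually_elim (use marginal_le_reach[of _ x b] c in force)
  qed
  then show ?thesis unfolding limit_marginal_def by (intro tendsto_Lim) auto
qed

text \<open>
  The path is cut into \<open>N\<close> blocks of length \<open>R\<close>. By the Markov property its deviability is the product of
  those of the blocks and of the remaining path; if every block had deviability at most \<open>1 - \<epsilon>\<close>, the product
  would be less than \<open>\<theta>\<close>.
\<close>

lemma away_block:
  assumes \<theta>: "0 < \<theta>" "\<theta> \<le> \<Psi> {x} * \<Phi> x {Y}" and R: "0 < R" and \<epsilon>: "0 < \<epsilon>" "\<epsilon> < 1" "(1 - \<epsilon>) ^ N < \<theta>"
    and away: "\<And>s. s \<in> {0..real N * R} \<Longrightarrow> \<delta> \<le> infdist (traj Y s) A"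
  shows "\<exists>z Z. \<theta> \<le> \<Psi> {z} \<and> 1 - \<epsilon> < \<Phi> z {Z} \<and> (\<forall>s\<in>{0..R}. \<delta> \<le> infdist (traj Z s) A)"
proof -
  have pos: "0 < \<Psi> {x}" "0 < \<Phi> x {Y}"
    using \<theta> \<Psi>_unit[of "{x}"] \<Phi>_unit[of x "{Y}"] by (auto simp: order_less_le)
  define z where "z j = traj Y (real j * R)" for j
  define S where "S j = shift_traj (real j * R) Y" for j
  define p where "p j = \<Phi> (z j) (same_upto R (S j))" for j
  have step: "\<Phi> (z j) {S j} = p j * \<Phi> (z (Suc j)) {S (Suc j)}" for j
    using markov[of R "z j" "S j"] R
    by (simp add: p_def z_def S_def traj_shift shift_shift algebra_simps)
  have S0: "z 0 = x" "S 0 = Y"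
    using path_starts_at[OF pos] by (simp_all add: z_def S_def shift_0)
  have "\<exists>j<N. 1 - \<epsilon> < p j"
  proof (rule ccontr)
    assume neg: "\<not> ?thesis"
    have small: "p j \<le> 1 - \<epsilon>" if "j < N" for j using neg that by (meson not_less)
    have "\<Phi> x {Y} \<le> (1 - \<epsilon>) ^ j * \<Phi> (z j) {S j}" if "j \<le> N" for j
      using that
    proof (induction j)
      case 0
      then show ?case by (simp add: S0)
    next
      case (Suc j)
      have "\<Phi> (z j) {S j} \<le> (1 - \<epsilon>) * \<Phi> (z (Suc j)) {S (Suc j)}"
        unfolding step[of j] using small[of j] Suc.prems \<Phi>_unit by (intro mult_right_mono) auto
      then have "(1 - \<epsilon>) ^ j * \<Phi> (z j) {S j} \<le> (1 - \<epsilon>) ^ j * ((1 - \<epsilon>) * \<Phi> (z (Suc j)) {S (Suc j)})"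
        using \<epsilon> by (intro mult_left_mono) auto
      with Suc show ?case by (simp add: mult.assoc mult.left_commute)
    qed
    from this[of N] have "\<Phi> x {Y} \<le> (1 - \<epsilon>) ^ N * \<Phi> (z N) {S N}" by simp
    also have "\<dots> \<le> (1 - \<epsilon>) ^ N" using \<Phi>_unit \<epsilon> by (intro mult_left_le) auto
    finally have "\<Phi> x {Y} < \<theta>" using \<epsilon>(3) by simp
    moreover have "\<Psi> {x} * \<Phi> x {Y} \<le> \<Phi> x {Y}" using \<Psi>_unit[of "{x}"] pos by (simp add: mult_left_le_one_le)
    ultimately show False using \<theta> by simp
  qed
  then obtain j where j: "j < N" "1 - \<epsilon> < p j" by blast
  obtain Z where Z: "Z \<in> same_upto R (S j)" "1 - \<epsilon> < \<Phi> (z j) {Z}"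
    using j(2) \<epsilon> unfolding p_def by (auto elim: less_\<Phi>E)
  have "\<theta> \<le> \<Psi> {z j}" using \<theta>(2) transport[of "real j * R" x Y] R by (simp add: z_def)
  moreover have "\<delta> \<le> infdist (traj Z s) A" if s: "s \<in> {0..R}" for s
  proof -
    have "real j * R + s \<le> real (Suc j) * R" using s by (simp add: algebra_simps)
    also have "\<dots> \<le> real N * R" using j(1) R by (intro mult_right_mono) auto
    finally have "\<delta> \<le> infdist (traj Y (real j * R + s)) A" using s R by (intro away) auto
    moreover have "traj Z s = traj Y (real j * R + s)"
      using Z(1) s by (simp add: same_upto_def S_def traj_shift)
    ultimately show ?thesis by simp
  qed
  ultimately show ?thesis using Z(2) by blast
qed

text \<open>
  Paths that avoid \<open>A\<close> for longer and longer times at vanishing cost have, by compactness and upper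
  semicontinuity, a cluster point of deviability \<open>1\<close> that avoids \<open>A\<close> forever. This contradicts \<open>approach\<close>.
\<close>

lemma no_long_excursions:
  assumes \<theta>: "0 < \<theta>" and \<delta>: "0 < \<delta>" and bad: "\<And>m::nat. \<exists>z Z. \<theta> \<le> \<Psi> {z} \<and>
     1 - 1 / (real m + 2) < \<Phi> z {Z} \<and> (\<forall>s\<in>{0..real m + 1}. \<delta> \<le> infdist (traj Z s) A)"
  shows False
proof -
  have "\<forall>m::nat. \<exists>p. \<theta> \<le> \<Psi> {fst p} \<and> 1 - 1 / (real m + 2) < \<Phi> (fst p) {snd p} \<and>
      (\<forall>s\<in>{0..real m + 1}. \<delta> \<le> infdist (traj (snd p) s) A)"
  proof
    fix m
    from bad[of m] obtain z Z where "\<theta> \<le> \<Psi> {z}" "1 - 1 / (real m + 2) < \<Phi> z {Z}"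
      "\<forall>s\<in>{0..real m + 1}. \<delta> \<le> infdist (traj Z s) A" by (elim exE conjE)
    then show "\<exists>p. \<theta> \<le> \<Psi> {fst p} \<and> 1 - 1 / (real m + 2) < \<Phi> (fst p) {snd p} \<and>
      (\<forall>s\<in>{0..real m + 1}. \<delta> \<le> infdist (traj (snd p) s) A)"
      by (intro exI[of _ "(z, Z)"]) simp
  qed
  from choice[OF this] obtain p where p': "\<forall>m::nat. \<theta> \<le> \<Psi> {fst (p m)} \<and>
      1 - 1 / (real m + 2) < \<Phi> (fst (p m)) {snd (p m)} \<and>
      (\<forall>s\<in>{0..real m + 1}. \<delta> \<le> infdist (traj (snd (p m)) s) A)" by (elim exE)
  have p: "\<theta> \<le> \<Psi> {fst (p m)}" "1 - 1 / (real m + 2) < \<Phi> (fst (p m)) {snd (p m)}"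
    "s \<in> {0..real m + 1} \<Longrightarrow> \<delta> \<le> infdist (traj (snd (p m)) s) A" for m s
    using p'[rule_format, of m] by simp_all
  let ?K = "{x. \<theta> \<le> \<Psi> {x}}"
  let ?L = "\<Union>x\<in>?K. {Y. \<Phi> x {Y} \<ge> 1 / 2}"
  have K: "compact ?K" by (rule deviability_compact[OF deviability_\<Psi> \<theta>])
  have "compact ?L" using compact_paths[OF _ _ K, of "1 / 2"] by simp
  with K have KL: "compact (?K \<times> ?L)" by (rule compact_Times)
  have "p m \<in> ?K \<times> ?L" for m
  proof -
    have "1 / (real m + 2) \<le> 1 / 2" by (intro divide_left_mono) auto
    then have "1 / 2 \<le> \<Phi> (fst (p m)) {snd (p m)}" using p(2)[of m] by linarith
    then show ?thesis using p(1)[of m] by (cases "p m") auto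
  qed
  from compact_cluster_point[of _ p, OF KL this] obtain q where q': "q \<in> ?K \<times> ?L"
    "\<forall>U. open U \<longrightarrow> q \<in> U \<longrightarrow> (\<exists>\<^sub>\<infinity>m. p m \<in> U)" by (elim bexE)
  note q = q'(2)[rule_format]
  have "\<Phi> (fst q) {snd q} = 1"
  proof (rule ccontr)
    assume "\<Phi> (fst q) {snd q} \<noteq> 1"
    with \<Phi>_unit[of "fst q" "{snd q}"] have "\<Phi> (fst q) {snd q} < 1" by linarith
    then obtain c where c: "\<Phi> (fst q) {snd q} < c" "c < 1" using dense by blast
    have "open {x. (\<lambda>(x, Y). \<Phi> x {Y}) x < c}" using usc unfolding upper_semicontinuous_def by blast
    then have "open {x. \<Phi> (fst x) {snd x} < c}" by (simp add: case_prod_beta)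
    from q[OF this] c(1) have inf: "\<exists>\<^sub>\<infinity>m. \<Phi> (fst (p m)) {snd (p m)} < c" by simp
    obtain n where n: "1 / real (Suc n) < 1 - c" using c(2) nat_approx_posE[of "1 - c"] by auto
    from inf obtain m where m: "n < m" "\<Phi> (fst (p m)) {snd (p m)} < c" unfolding INFM_nat by blast
    have "1 / (real m + 2) \<le> 1 / real (Suc n)" using m(1) by (intro divide_left_mono) auto
    with p(2)[of m] m(2) n show False by linarith
  qed
  then have inf0: "(INF t\<in>{0..}. infdist (traj (snd q) t) A) = 0" by (rule approach)
  have "\<delta> \<le> infdist (traj (snd q) s) A" if s: "s \<in> {0..}" for s
  proof (rule ccontr)
    assume "\<not> ?thesis"
    then have lt: "0 < bump A \<delta> (traj (snd q) s)"
      using bump_pos_iff[OF \<delta>, of A "traj (snd q) s"] by simp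
    interpret unit_function "bump A \<delta>" using \<delta> by (rule unit_function_bump)
    have "open {Y. 0 < window_sup (bump A \<delta>) s 1 Y}"
      using \<delta> s by (intro open_Collect_less continuous_window_sup_bump continuous_intros) auto
    then have "open (UNIV \<times> {Y. 0 < window_sup (bump A \<delta>) s 1 Y})" by (intro open_Times) auto
    moreover have "q \<in> UNIV \<times> {Y. 0 < window_sup (bump A \<delta>) s 1 Y}"
      using lt window_sup_ge[of 1 s "snd q"] s by (cases q) auto
    ultimately have inf: "\<exists>\<^sub>\<infinity>m. p m \<in> UNIV \<times> {Y. 0 < window_sup (bump A \<delta>) s 1 Y}" by (rule q)
    obtain n where n: "s < real n" using reals_Archimedean2 by blast
    from inf obtain m where m: "n < m" "0 < window_sup (bump A \<delta>) s 1 (snd (p m))"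
      unfolding INFM_nat by (auto simp: mem_Times_iff)
    from m(2) obtain s' where s': "0 \<le> s'" "\<bar>s' - s\<bar> < 1" "0 < bump A \<delta> (traj (snd (p m)) s')"
      by (rule window_sup_posE) simp
    then have "s' \<in> {0..real m + 1}" using n m(1) by auto
    from p(3)[OF this] s'(3) show False using bump_pos_iff[OF \<delta>, of A "traj (snd (p m)) s'"] by simp
  qed
  then have "\<delta> \<le> (INF t\<in>{0..}. infdist (traj (snd q) t) A)" by (intro cINF_greatest) auto
  with inf0 \<delta> show False by simp
qed

text \<open>
  A path of deviability bounded below that avoids \<open>A\<close> for a very long time contains a long block that
  avoids \<open>A\<close> almost for free.
\<close>

lemma hitting_time:
  assumes \<theta>: "0 < \<theta>" and \<delta>: "0 < \<delta>"
  obtains T where "0 \<le> T" "\<And>x Y. \<theta> \<le> \<Psi> {x} * \<Phi> x {Y} \<Longrightarrow> \<exists>s\<in>{0..T}. infdist (traj Y s) A < \<delta>"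
proof -
  have "\<exists>T\<ge>0. \<forall>x Y. \<theta> \<le> \<Psi> {x} * \<Phi> x {Y} \<longrightarrow> (\<exists>s\<in>{0..T}. infdist (traj Y s) A < \<delta>)"
  proof (rule ccontr)
    assume neg: "\<not> ?thesis"
    have "\<exists>z Z. \<theta> \<le> \<Psi> {z} \<and> 1 - 1 / (real m + 2) < \<Phi> z {Z} \<and>
        (\<forall>s\<in>{0..real m + 1}. \<delta> \<le> infdist (traj Z s) A)" for m
    proof -
      define \<epsilon> where "\<epsilon> = 1 / (real m + 2)"
      have \<epsilon>: "0 < \<epsilon>" "\<epsilon> < 1" by (auto simp: \<epsilon>_def)
      obtain N where N: "(1 - \<epsilon>) ^ N < \<theta>" using real_arch_pow_inv[OF \<theta>, of "1 - \<epsilon>"] \<epsilon> by auto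
      have "0 \<le> real N * (real m + 1)" by simp
      with neg[unfolded not_ex, rule_format, of "real N * (real m + 1)"]
      have "\<not> (\<forall>x Y. \<theta> \<le> \<Psi> {x} * \<Phi> x {Y} \<longrightarrow> (\<exists>s\<in>{0..real N * (real m + 1)}. infdist (traj Y s) A < \<delta>))"
        by simp
      then obtain x Y where xY: "\<theta> \<le> \<Psi> {x} * \<Phi> x {Y}"
        "\<forall>s\<in>{0..real N * (real m + 1)}. \<not> infdist (traj Y s) A < \<delta>"
        unfolding not_all not_imp bex_simps by (elim exE conjE) simp
      from away_block[OF \<theta> xY(1) _ \<epsilon> N, of "real m + 1" \<delta>] xY(2)
      show ?thesis by (simp add: \<epsilon>_def not_less)
    qed
    then show False by (rule no_long_excursions[OF \<theta> \<delta>])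
  qed
  then obtain T where T: "0 \<le> T"
    "\<forall>x Y. \<theta> \<le> \<Psi> {x} * \<Phi> x {Y} \<longrightarrow> (\<exists>s\<in>{0..T}. infdist (traj Y s) A < \<delta>)"
    by (elim exE conjE)
  show thesis
  proof (rule that[OF T(1)])
    fix x Y assume "\<theta> \<le> \<Psi> {x} * \<Phi> x {Y}"
    with T(2) show "\<exists>s\<in>{0..T}. infdist (traj Y s) A < \<delta>" by simp
  qed
qed

section \<open>Flow between attractors\<close>

lemma reach_attractor:
  assumes x: "0 < \<Psi> {x}" and c: "c < 1"
  obtains a where "a \<in> A" "c < V x a"
proof -
  define \<eta> where "\<eta> = (1 - max c 0) / 2"
  have \<eta>: "0 < \<eta>" "\<eta> \<le> 1 / 2" "c \<le> 1 - 2 * \<eta>"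
    using c by (auto simp: \<eta>_def max_def field_simps)
  have less_1: "1 - \<eta> < 1" using \<eta> by simp
  obtain Y where Y: "1 - \<eta> < \<Phi> x {Y}" using almost_sure_path[of "1 - \<eta>" x] \<eta> by auto
  obtain \<delta> where \<delta>: "0 < \<delta>" "\<And>x. infdist x A < \<delta> \<Longrightarrow> \<exists>b\<in>A. 1 - \<eta> < V x b \<and> 1 - \<eta> < V b x"
    using attract_reach[OF less_1] by blast
  have \<theta>: "0 < \<Psi> {x} / 2" "\<Psi> {x} / 2 \<le> \<Psi> {x} * \<Phi> x {Y}" using x Y \<eta> by auto
  obtain T where T: "0 \<le> T" "\<And>x' Y'. \<Psi> {x} / 2 \<le> \<Psi> {x'} * \<Phi> x' {Y'} \<Longrightarrow> \<exists>s\<in>{0..T}. infdist (traj Y' s) A < \<delta>"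
    using hitting_time[OF \<theta>(1) \<delta>(1)] by blast
  from T(2)[OF \<theta>(2)] obtain s where s: "0 \<le> s" "infdist (traj Y s) A < \<delta>" by auto
  let ?z = "traj Y s"
  from \<delta>(2)[OF s(2)] obtain a where a: "a \<in> A" "1 - \<eta> < V ?z a" by blast
  have xz: "1 - \<eta> < V x ?z" using path_le_reach[OF s(1), of x Y] Y by simp
  then have "0 < \<Psi> {?z}" using \<eta> by (intro reach_pos[OF x]) auto
  from reach_trans[OF this, of x a] have "V x ?z * V ?z a \<le> V x a" .
  moreover have "(1 - \<eta>) * (1 - \<eta>) \<le> V x ?z * V ?z a" using xz a(2) \<eta> by (intro mult_mono) auto
  moreover have "1 - 2 * \<eta> < (1 - \<eta>) * (1 - \<eta>)" using \<eta>(1) by (simp add: algebra_simps)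
  ultimately have "c < V x a" using \<eta>(3) by linarith
  with a(1) show thesis by (rule that)
qed

lemma attractor_pos:
  assumes "a \<in> A"
  shows "0 < \<Psi> {a}"
proof -
  have "sup0 (range (\<lambda>x. \<Psi> {x})) = 1" using deviability_\<Psi> unfolding deviability_def by blast
  then obtain x where x: "0 < \<Psi> {x}" using less_sup0E[of 0 "range (\<lambda>x. \<Psi> {x})"] by auto
  obtain b where b: "b \<in> A" "0 < V x b" using reach_attractor[OF x, of 0] by auto
  have "0 < \<Psi> {b}" using x b(2) by (rule reach_pos)
  then show ?thesis using reach_in_A_pos[OF b(1) assms] by (rule reach_pos)
qed

text \<open>
  From a point where \<open>\<Psi>\<close> is almost \<open>1\<close> some point of \<open>A\<close> is reached almost for free.
\<close>

lemma sup_attractors: "sup0 ((\<lambda>a. \<Psi> {a}) ` A) = 1" (is "?S = 1")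
proof (rule antisym)
  show "?S \<le> 1" using \<Psi>_unit by (intro sup0_least) auto
  show "1 \<le> ?S"
  proof (rule ccontr)
    assume "\<not> 1 \<le> ?S"
    then have S: "?S < 1" by simp
    have S0: "0 \<le> ?S" using \<Psi>_unit by (intro sup0_nonneg[where c = 1]) auto
    define \<eta> where "\<eta> = (1 - ?S) / 2"
    have \<eta>: "0 < \<eta>" "\<eta> \<le> 1 / 2" "?S = 1 - 2 * \<eta>" using S S0 by (auto simp: \<eta>_def field_simps)
    have "sup0 (range (\<lambda>x. \<Psi> {x})) = 1" using deviability_\<Psi> unfolding deviability_def by blast
    then obtain x where x: "1 - \<eta> < \<Psi> {x}"
      using less_sup0E[of "1 - \<eta>" "range (\<lambda>x. \<Psi> {x})"] \<eta> by auto
    then obtain a where a: "a \<in> A" "1 - \<eta> < V x a" using reach_attractor[of x "1 - \<eta>"] \<eta> by auto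
    have "(1 - \<eta>) * (1 - \<eta>) \<le> \<Psi> {x} * V x a" using x a(2) \<eta> by (intro mult_mono) auto
    also have "\<dots> \<le> \<Psi> {a}" by (rule reach_transport)
    also have "\<dots> \<le> ?S" using a(1) \<Psi>_unit by (intro sup0_upper[where c = 1]) auto
    finally show False using \<eta> mult_pos_pos[OF \<eta>(1) \<eta>(1)] by (simp add: algebra_simps)
  qed
qed

lemma finite_attractors_above: "0 < \<gamma> \<Longrightarrow> finite {a \<in> A. \<gamma> \<le> \<Psi> {a}}"
  using locally_finite[OF deviability_compact[OF deviability_\<Psi>, of \<gamma>]]
  by (rule rev_finite_subset) auto

text \<open>
  A path that arrives near \<open>y\<close> after a long time has passed near some \<open>a\<close> in \<open>A\<close>. The detour through \<open>a\<close>
  costs little, and \<open>a\<close> supplies almost all of \<open>\<Psi> {y}\<close>.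
\<close>

lemma represent_by_attractors:
  assumes y: "0 < \<Psi> {y}" and c: "c < \<Psi> {y}"
  obtains a where "a \<in> A" "c < \<Psi> {a} * V a y"
proof -
  \<comment> \<open>four factors \<open>1 - \<eta>\<close> are lost: in \<open>\<theta>\<close>, on the way to \<open>a\<close>, on the way back, and at the end near \<open>y\<close>\<close>
  define \<eta> where "\<eta> = min (1 / 2) ((\<Psi> {y} - c) / (8 * \<Psi> {y}))"
  have \<eta>: "0 < \<eta>" "\<eta> \<le> 1 / 2" "8 * \<Psi> {y} * \<eta> \<le> \<Psi> {y} - c"
  proof -
    have "\<eta> \<le> (\<Psi> {y} - c) / (8 * \<Psi> {y})" by (simp add: \<eta>_def)
    then show "8 * \<Psi> {y} * \<eta> \<le> \<Psi> {y} - c" using y by (simp add: field_simps)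
    show "0 < \<eta>" "\<eta> \<le> 1 / 2" using y c by (auto simp: \<eta>_def)
  qed
  have less_1: "1 - \<eta> < 1" using \<eta> by simp
  obtain \<rho> where \<rho>: "0 < \<rho>" "\<forall>x'. dist y x' < \<rho> \<longrightarrow> 1 - \<eta> < V y x' \<and> 1 - \<eta> < V x' y"
    using local_reach[OF less_1, of y] by blast
  obtain \<delta> where \<delta>: "0 < \<delta>" "\<And>x. infdist x A < \<delta> \<Longrightarrow> \<exists>b\<in>A. 1 - \<eta> < V x b \<and> 1 - \<eta> < V b x"
    using attract_reach[OF less_1] by blast
  define \<theta> where "\<theta> = (1 - \<eta>) * \<Psi> {y}"
  have \<theta>: "0 < \<theta>" "\<theta> < \<Psi> {y}" using y \<eta> by (auto simp: \<theta>_def)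
  obtain T where T: "0 \<le> T" "\<And>x Y. \<theta> \<le> \<Psi> {x} * \<Phi> x {Y} \<Longrightarrow> \<exists>s\<in>{0..T}. infdist (traj Y s) A < \<delta>"
    using hitting_time[OF \<theta>(1) \<delta>(1)] by blast
  have "0 < \<rho> / 2" using \<rho>(1) by simp
  from predecessor[OF \<theta> T(1) this] obtain x Y where xY: "dist y (traj Y T) \<le> \<rho> / 2" "\<theta> \<le> \<Psi> {x} * \<Phi> x {Y}"
    by blast
  from T(2)[OF xY(2)] obtain s where s: "0 \<le> s" "s \<le> T" "infdist (traj Y s) A < \<delta>" by auto
  let ?z = "traj Y s" and ?y = "traj Y T"
  from \<delta>(2)[OF s(3)] obtain a where a: "a \<in> A" "1 - \<eta> < V ?z a" "1 - \<eta> < V a ?z" by blast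
  have y': "1 - \<eta> < V ?y y" using xY(1) \<rho>(1) \<rho>(2)[rule_format, of ?y] by simp
  have pos: "0 < \<Psi> {?z}" "0 < \<Psi> {?y}"
    using transport[OF s(1), of x Y] transport[OF T(1), of x Y] xY(2) \<theta>(1) by linarith+
  have "\<theta> \<le> \<Psi> {x} * (V x ?z * V ?z ?y)"
    using xY(2) path_split[OF s(1,2), of x Y] \<Psi>_unit[of "{x}"] by (meson mult_left_mono order_trans)
  also have "\<dots> = (\<Psi> {x} * V x ?z) * V ?z ?y" by simp
  also have "\<dots> \<le> \<Psi> {?z} * V ?z ?y" by (intro mult_right_mono reach_transport reach_nonneg)
  finally have 1: "\<theta> \<le> \<Psi> {?z} * V ?z ?y" .
  have "(1 - \<eta>) * \<Psi> {?z} \<le> V ?z a * \<Psi> {?z}" using a(2) pos(1) by (intro mult_right_mono) auto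
  also have "\<dots> \<le> \<Psi> {a}" using reach_transport[of ?z a] by (simp add: mult.commute)
  finally have 2: "(1 - \<eta>) * \<Psi> {?z} \<le> \<Psi> {a}" .
  have "(1 - \<eta>) * V ?z ?y \<le> V a ?z * V ?z ?y" using a(3) reach_nonneg by (intro mult_right_mono) auto
  also have "\<dots> \<le> V a ?y" by (rule reach_trans[OF pos(1)])
  finally have 3: "(1 - \<eta>) * V ?z ?y \<le> V a ?y" .
  have "((1 - \<eta>) * V ?z ?y) * (1 - \<eta>) \<le> V a ?y * V ?y y"
    using 3 y' \<eta> reach_nonneg by (intro mult_mono) auto
  also have "\<dots> \<le> V a y" by (rule reach_trans[OF pos(2)])
  finally have 4: "((1 - \<eta>) * V ?z ?y) * (1 - \<eta>) \<le> V a y" .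
  have "(1 - \<eta>) ^ 4 * \<Psi> {y} = (1 - \<eta>) ^ 3 * \<theta>" by (simp add: \<theta>_def power_eq_if)
  also have "\<dots> \<le> (1 - \<eta>) ^ 3 * (\<Psi> {?z} * V ?z ?y)" using 1 \<eta> by (intro mult_left_mono) auto
  also have "\<dots> = ((1 - \<eta>) * \<Psi> {?z}) * (((1 - \<eta>) * V ?z ?y) * (1 - \<eta>))" by (simp add: power_eq_if)
  also have "\<dots> \<le> \<Psi> {a} * V a y"
    using 2 4 \<eta> reach_nonneg \<Psi>_unit by (intro mult_mono) (auto intro!: mult_nonneg_nonneg)
  finally have 5: "(1 - \<eta>) ^ 4 * \<Psi> {y} \<le> \<Psi> {a} * V a y" .
  have "1 - 4 * \<eta> \<le> (1 - \<eta>) ^ 4" using Bernoulli_inequality[of "- \<eta>" 4] \<eta> by simp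
  then have "(1 - 4 * \<eta>) * \<Psi> {y} \<le> (1 - \<eta>) ^ 4 * \<Psi> {y}" using y by (intro mult_right_mono) auto
  moreover have "(1 - 4 * \<eta>) * \<Psi> {y} = \<Psi> {y} - 8 * \<Psi> {y} * \<eta> / 2" by (simp add: algebra_simps)
  ultimately have "c < \<Psi> {a} * V a y" using 5 \<eta>(3) c by linarith
  with a(1) show thesis by (rule that)
qed

text \<open>
  The closure makes the set measurable and suitable for \<open>flow_balance\<close>; since \<open>reach\<close> varies continuously
  on \<open>\<Psi> {x} > 0\<close>, it adds no points there (\<open>remote_reach_le\<close>).
\<close>

definition remote :: "'s set \<Rightarrow> real \<Rightarrow> 's set" where
  "remote B \<rho> = closure {x. 0 < \<Psi> {x} \<and> (\<forall>b\<in>B. V x b \<le> \<rho>)}"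

lemma remote_reach_le:
  assumes x: "x \<in> remote B \<rho>" "0 < \<Psi> {x}" and b: "b \<in> B" and \<rho>: "0 < \<rho>"
  shows "V x b \<le> \<rho>"
proof (rule ccontr)
  assume "\<not> ?thesis"
  then have gt: "\<rho> < V x b" by simp
  define \<eta> where "\<eta> = 1 - \<rho> / V x b"
  have Vxb: "0 < V x b" using gt \<rho> by linarith
  have \<eta>: "0 < \<eta>" using gt Vxb by (simp add: \<eta>_def)
  have less_1: "1 - \<eta> < 1" using \<eta> by simp
  obtain \<delta> where \<delta>: "0 < \<delta>" "\<forall>x'. dist x x' < \<delta> \<longrightarrow> 1 - \<eta> < V x x' \<and> 1 - \<eta> < V x' x"
    using local_reach[OF less_1, of x] by blast
  obtain x' where x': "0 < \<Psi> {x'}" "\<forall>b\<in>B. V x' b \<le> \<rho>" "dist x x' < \<delta>"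
    using x(1) \<delta>(1) unfolding remote_def closure_approachable by (auto simp: dist_commute)
  have "\<rho> = (1 - \<eta>) * V x b" using Vxb by (simp add: \<eta>_def)
  also have "\<dots> < V x' x * V x b" using \<delta>(2)[rule_format, OF x'(3)] Vxb by simp
  also have "\<dots> \<le> V x' b" by (rule reach_trans[OF x(2)])
  also have "\<dots> \<le> \<rho>" using x'(2) b by blast
  finally show False by simp
qed

lemma remote_complement_reach:
  assumes y: "y \<in> closure (- remote B \<rho>)" "0 < \<Psi> {y}" and e: "0 < e" "e < 1" and \<rho>: "0 < \<rho>"
  shows "\<exists>b\<in>B. e * \<rho> \<le> V y b"
proof -
  obtain \<delta> where \<delta>: "0 < \<delta>" "\<forall>x'. dist y x' < \<delta> \<longrightarrow> e < V y x' \<and> e < V x' y"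
    using local_reach[OF e(2), of y] by blast
  obtain y' where y': "y' \<notin> remote B \<rho>" "dist y y' < \<delta>"
    using y(1) \<delta>(1) unfolding closure_approachable by (auto simp: dist_commute)
  have reach: "e < V y y'" using \<delta>(2)[rule_format, OF y'(2)] by blast
  then have pos: "0 < \<Psi> {y'}" using e by (intro reach_pos[OF y(2)]) auto
  have "y' \<notin> {x. 0 < \<Psi> {x} \<and> (\<forall>b\<in>B. V x b \<le> \<rho>)}"
    using y'(1) unfolding remote_def by (rule contra_subsetD[OF closure_subset])
  with pos obtain b where b: "b \<in> B" "\<rho> < V y' b" by (auto simp: not_le)
  have "e * \<rho> \<le> V y y' * V y' b" using reach b(2) e \<rho> by (intro mult_mono) auto
  also have "\<dots> \<le> V y b" by (rule reach_trans[OF pos])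
  finally show ?thesis using b(1) by blast
qed

lemma interior_remote:
  assumes c: "0 < \<Psi> {c}" and m: "\<And>b. b \<in> B \<Longrightarrow> \<Psi> {c} * V c b \<le> m"
    and e: "0 < e" "e < 1" "m \<le> \<Psi> {c} * (e * \<rho>)"
  shows "c \<in> interior (remote B \<rho>)"
proof -
  obtain \<delta> where \<delta>: "0 < \<delta>" "\<forall>x'. dist c x' < \<delta> \<longrightarrow> e < V c x' \<and> e < V x' c"
    using local_reach[OF e(2), of c] by blast
  have "x \<in> remote B \<rho>" if x: "dist c x < \<delta>" for x
  proof -
    have reach: "e < V c x" using \<delta>(2)[rule_format, OF x] by blast
    then have pos: "0 < \<Psi> {x}" using e by (intro reach_pos[OF c]) auto
    have "V x b \<le> \<rho>" if b: "b \<in> B" for b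
    proof -
      have "e * V x b \<le> V c x * V x b" using reach reach_nonneg by (intro mult_right_mono) auto
      also have "\<dots> \<le> V c b" by (rule reach_trans[OF pos])
      finally have "\<Psi> {c} * (e * V x b) \<le> \<Psi> {c} * (e * \<rho>)"
        using m[OF b] e(3) mult_left_mono[of "e * V x b" "V c b" "\<Psi> {c}"] c by linarith
      then show ?thesis using c e by simp
    qed
    with pos have "x \<in> {x. 0 < \<Psi> {x} \<and> (\<forall>b\<in>B. V x b \<le> \<rho>)}" by simp
    then show ?thesis unfolding remote_def by (rule subsetD[OF closure_subset])
  qed
  then have "ball c \<delta> \<subseteq> remote B \<rho>" by auto
  then have "ball c \<delta> \<subseteq> interior (remote B \<rho>)" by (rule interior_maximal) simp
  then show ?thesis using \<delta>(1) by auto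
qed

text \<open>
  A path that leaves the remote set within a long time \<open>t\<close> passes near some \<open>a\<close> in \<open>A\<close>, and the flow is at most
  about \<open>\<Psi> {x} * V x a * V a y\<close>.
  
  \<^item> If \<open>a \<notin> B\<close>, then \<open>\<Psi> {a} * V a y\<close> is at most about \<open>m / \<rho>\<close>, because from \<open>y\<close> one can go on to \<open>B\<close>
    with deviability about \<open>\<rho>\<close>, and the flow from \<open>A - B\<close> to \<open>B\<close> is bounded by \<open>m\<close>.
  \<^item> If \<open>a \<in> B\<close>, consider the point \<open>a'\<close> of \<open>A\<close> that supplies \<open>\<Psi> {x}\<close>. For \<open>a' \<notin> B\<close> the flow passes from
    \<open>a'\<close> to \<open>a\<close> and is bounded by \<open>m\<close>. For \<open>a' \<in> B\<close> one uses that from \<open>x\<close> some \<open>c\<close> in \<open>A - B\<close> is reached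
    almost for free, since \<open>B\<close> is not; hence \<open>\<Psi> {x}\<close> is at most about \<open>\<theta>\<close>, and the factor \<open>V x a \<le> \<rho>\<close>
    brings the flow down to \<open>\<theta> * \<rho>\<close>.
  
  The number \<open>e\<close> is the factor lost in each approximation. None of the cases loses more than four
  factors, so that \<open>e ^ 5\<close> leaves room.
\<close>

lemma remote_outflow:
  assumes B: "B \<subseteq> A" and e: "0 < e" "e < 1"
    and inflow: "\<And>c b. c \<in> A - B \<Longrightarrow> b \<in> B \<Longrightarrow> \<Psi> {c} * V c b \<le> m"
    and outflow: "\<And>b c. b \<in> B \<Longrightarrow> c \<in> A - B \<Longrightarrow> \<Psi> {b} * V b c \<le> \<theta>"
    and \<rho>: "0 < \<rho>" "\<rho> < e" and m: "m \<le> \<theta> * \<rho> * \<rho>" and \<theta>: "0 < \<theta>" "\<theta> * \<rho> < e ^ 5 * \<theta>'"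
    and hit: "\<And>x. infdist x A < \<delta> \<Longrightarrow> \<exists>b\<in>A. e < V x b \<and> e < V b x"
      "\<And>x Y. \<theta>' \<le> \<Psi> {x} * \<Phi> x {Y} \<Longrightarrow> \<exists>s\<in>{0..T}. infdist (traj Y s) A < \<delta>"
    and t: "T \<le> t" and x: "x \<in> remote B \<rho>" and y: "traj Y t \<in> closure (- remote B \<rho>)"
  shows "\<Psi> {x} * \<Phi> x {Y} < \<theta>'"
proof (rule ccontr)
  assume "\<not> ?thesis"
  then have flow: "\<theta>' \<le> \<Psi> {x} * \<Phi> x {Y}" by simp
  have "0 < e ^ 5 * \<theta>'" using \<theta> \<rho>(1) mult_pos_pos[of \<theta> \<rho>] by linarith
  then have \<theta>': "0 < \<theta>'" using e(1) by (simp add: zero_less_mult_iff)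
  let ?y = "traj Y t"
  from hit(2)[OF flow] obtain s where s: "0 \<le> s" "s \<le> T" "infdist (traj Y s) A < \<delta>" by auto
  let ?z = "traj Y s"
  from hit(1)[OF s(3)] obtain a where a: "a \<in> A" "e < V ?z a" "e < V a ?z" by blast
  have xpos: "0 < \<Psi> {x}" using flow \<theta>' \<Psi>_unit[of "{x}"] by (auto simp: order_less_le)
  have pos: "0 < \<Psi> {?z}" "0 < \<Psi> {?y}"
    using transport[of s x Y] transport[of t x Y] flow \<theta>' s t by linarith+
  have "\<theta>' \<le> \<Psi> {x} * (V x ?z * V ?z ?y)"
    by (rule order_trans[OF flow mult_left_mono[OF path_split]]) (use s t xpos in auto)
  then have "e * e * \<theta>' \<le> e * e * (\<Psi> {x} * (V x ?z * V ?z ?y))" using e by (intro mult_left_mono) auto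
  also have "\<dots> = \<Psi> {x} * ((V x ?z * e) * (e * V ?z ?y))" by (simp add: mult_ac)
  also have "\<dots> \<le> \<Psi> {x} * ((V x ?z * V ?z a) * (V a ?z * V ?z ?y))"
    using a e reach_nonneg xpos
    by (intro mult_left_mono mult_mono mult_right_mono) (auto intro!: mult_nonneg_nonneg less_imp_le)
  also have "\<dots> \<le> \<Psi> {x} * (V x a * V a ?y)"
    using reach_trans[OF pos(1)] reach_nonneg xpos by (intro mult_left_mono mult_mono) auto
  finally have main: "e * e * \<theta>' \<le> \<Psi> {x} * V x a * V a ?y" by (simp add: mult_ac)
  have e5: "e ^ 5 * \<theta>' \<le> e ^ k * \<theta>'" if "k \<le> 5" for k
    using e \<theta>' that by (intro mult_right_mono power_decreasing) auto
  have m_small: "m < \<rho> * (e ^ 5 * \<theta>')"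
    using m mult_strict_left_mono[OF \<theta>(2) \<rho>(1)] by (simp add: mult_ac)
  have \<rho>1: "\<rho> < 1" using \<rho> e by simp
  have m_small': "m < e ^ 5 * \<theta>'"
  proof -
    have "\<rho> * (e ^ 5 * \<theta>') \<le> 1 * (e ^ 5 * \<theta>')" using \<rho>1 \<theta>' e by (intro mult_right_mono) auto
    with m_small show ?thesis by simp
  qed
  show False
  proof (cases "a \<in> B")
    case False
    obtain b where b: "b \<in> B" "e * \<rho> \<le> V ?y b"
      using remote_complement_reach[OF y pos(2) e \<rho>(1)] by blast
    have "e * e * \<theta>' \<le> \<Psi> {a} * V a ?y"
      using main mult_right_mono[OF reach_transport[of x a] reach_nonneg[of a ?y]] by linarith
    then have "(e * e * \<theta>') * (e * \<rho>) \<le> (\<Psi> {a} * V a ?y) * V ?y b"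
      by (rule mult_mono[OF _ b(2)]) (use e \<rho> \<theta>' reach_nonneg \<Psi>_unit in auto)
    also have "\<dots> \<le> \<Psi> {a} * V a b"
      using reach_trans[OF pos(2), of a b] \<Psi>_unit[of "{a}"] by (simp add: mult.assoc mult_left_mono)
    also have "\<dots> \<le> m" using inflow a(1) b(1) False by blast
    finally have "\<rho> * (e ^ 3 * \<theta>') \<le> m" by (simp add: power_eq_if mult_ac)
    moreover have "\<rho> * (e ^ 5 * \<theta>') \<le> \<rho> * (e ^ 3 * \<theta>')" using e5[of 3] \<rho> by (intro mult_left_mono) auto
    ultimately show False using m_small by linarith
  next
    case True
    have xa: "e * e * \<theta>' \<le> \<Psi> {x} * V x a"
    proof -
      have "\<Psi> {x} * V x a * V a ?y \<le> \<Psi> {x} * V x a * 1"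
        by (intro mult_left_mono reach_le_1) (use xpos reach_nonneg in auto)
      with main show ?thesis by simp
    qed
    have "e * \<Psi> {x} < \<Psi> {x}" using xpos e by simp
    then obtain a' where a': "a' \<in> A" "e * \<Psi> {x} < \<Psi> {a'} * V a' x"
      by (rule represent_by_attractors[OF xpos])
    show False
    proof (cases "a' \<in> B")
      case False
      have "e * (e * e * \<theta>') \<le> e * (\<Psi> {x} * V x a)" using xa e by (intro mult_left_mono) auto
      also have "\<dots> = (e * \<Psi> {x}) * V x a" by simp
      also have "\<dots> \<le> (\<Psi> {a'} * V a' x) * V x a" using a'(2) reach_nonneg by (intro mult_right_mono) auto
      also have "\<dots> \<le> \<Psi> {a'} * V a' a"
        using reach_trans[OF xpos, of a' a] \<Psi>_unit[of "{a'}"] by (simp add: mult.assoc mult_left_mono)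
      also have "\<dots> \<le> m" using inflow a'(1) True False by blast
      finally have "e ^ 3 * \<theta>' \<le> m" by (simp add: power_eq_if mult_ac)
      with e5[of 3] m_small' show False by simp
    next
      case a'B: True
      obtain c where c: "c \<in> A" "e < V x c" using reach_attractor[OF xpos e(2)] .
      have "c \<notin> B" using remote_reach_le[OF x xpos _ \<rho>(1), of c] c(2) \<rho>(2) by auto
      then have out: "\<Psi> {a'} * V a' c \<le> \<theta>" using outflow a'B c(1) by blast
      have "e * e * \<Psi> {x} = (e * \<Psi> {x}) * e" by simp
      also have "\<dots> \<le> (\<Psi> {a'} * V a' x) * V x c"
        by (rule mult_mono) (use a'(2) c(2) e xpos \<Psi>_unit reach_nonneg in auto)
      also have "\<dots> \<le> \<Psi> {a'} * V a' c"
        using reach_trans[OF xpos, of a' c] \<Psi>_unit[of "{a'}"] by (simp add: mult.assoc mult_left_mono)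
      finally have ex: "e * e * \<Psi> {x} \<le> \<theta>" using out by linarith
      have "V x a \<le> \<rho>" by (rule remote_reach_le[OF x xpos True \<rho>(1)])
      then have "\<Psi> {x} * V x a \<le> \<Psi> {x} * \<rho>" using xpos by (intro mult_left_mono) auto
      then have "e * e * \<theta>' \<le> \<Psi> {x} * \<rho>" using xa by linarith
      then have "(e * e) * (e * e * \<theta>') \<le> (e * e) * (\<Psi> {x} * \<rho>)" using e by (intro mult_left_mono) auto
      also have "\<dots> = (e * e * \<Psi> {x}) * \<rho>" by simp
      also have "\<dots> \<le> \<theta> * \<rho>" using ex \<rho> by (intro mult_right_mono) auto
      finally have "e ^ 4 * \<theta>' \<le> \<theta> * \<rho>" by (simp add: power_eq_if mult_ac)
      with e5[of 4] \<theta>(2) show False by simp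
    qed
  qed
qed

text \<open>
  Suppose that the flow \<open>\<theta>\<close> from \<open>B\<close> to \<open>A - B\<close> exceeds the bound \<open>m\<close> for the opposite direction. Let \<open>b0\<close> and \<open>c0\<close>
  almost attain \<open>\<theta>\<close>. The point \<open>b0\<close> is outside the remote set, and \<open>c0\<close> is in its interior, so
  that the flow into the set is almost \<open>\<theta>\<close> at every large time. By \<open>remote_outflow\<close> the flow out of it
  stays below a smaller bound, in contradiction to \<open>flow_balance\<close>.
\<close>

theorem cut_inequality:
  assumes B: "B \<subseteq> A" and b: "b \<in> B" and c: "c \<in> A - B"
    and inflow: "\<And>c b. c \<in> A - B \<Longrightarrow> b \<in> B \<Longrightarrow> \<Psi> {c} * V c b \<le> m"
  shows "\<Psi> {b} * V b c \<le> m"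
proof (rule ccontr)
  assume neg: "\<not> ?thesis"
  define \<theta> where "\<theta> = (SUP (b, c)\<in>B \<times> (A - B). \<Psi> {b} * V b c)"
  have bdd: "bdd_above ((\<lambda>(b, c). \<Psi> {b} * V b c) ` (B \<times> (A - B)))"
    using \<Psi>_unit reach_le_1 reach_nonneg by (intro bdd_aboveI2[where M = 1]) (auto intro!: mult_le_one)
  have outflow: "\<Psi> {b} * V b c \<le> \<theta>" if "b \<in> B" "c \<in> A - B" for b c
    unfolding \<theta>_def using that bdd cSUP_upper[of "(b, c)" "B \<times> (A - B)" "\<lambda>(b, c). \<Psi> {b} * V b c"] by auto
  have m\<theta>: "m < \<theta>" using neg outflow[OF b c] by simp
  have "0 < \<Psi> {c} * V c b" using attractor_pos reach_in_A_pos b c B by (intro mult_pos_pos) auto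
  then have m: "0 < m" using inflow[OF c b] by linarith
  \<comment> \<open>\<open>\<theta> * \<rho>\<close> is the mean of \<open>m\<close> and \<open>\<theta>\<close>; comparison with their geometric mean gives \<open>m \<le> \<theta> * \<rho>\<^sup>2\<close>, so that
    both bounds \<open>m / \<rho>\<close> and \<open>\<theta> * \<rho>\<close> for the flow out of the remote set stay away from \<open>\<theta>\<close>\<close>
  define \<rho> where "\<rho> = (\<theta> + m) / (2 * \<theta>)"
  have \<rho>: "0 < \<rho>" "\<rho> < 1" "\<theta> * \<rho> = (\<theta> + m) / 2" using m m\<theta> by (auto simp: \<rho>_def field_simps)
  have m\<rho>: "m \<le> \<theta> * \<rho> * \<rho>"
  proof -
    have "0 \<le> (\<theta> - m) * (\<theta> - m)" by simp
    then have "4 * \<theta> * m \<le> (\<theta> + m) * (\<theta> + m)" by (simp add: algebra_simps)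
    then have "m \<le> (\<theta> + m) * (\<theta> + m) / (4 * \<theta>)" using m m\<theta> by (simp add: field_simps)
    also have "\<dots> = \<theta> * \<rho> * \<rho>" unfolding \<rho>(3) by (simp add: \<rho>_def)
    finally show ?thesis .
  qed
  have "\<theta> * \<rho> < \<theta>" using \<rho> m m\<theta> by simp
  then obtain \<theta>1 where \<theta>1: "\<theta> * \<rho> < \<theta>1" "\<theta>1 < \<theta>" using dense by blast
  then obtain \<theta>2 where \<theta>2: "\<theta> * \<rho> < \<theta>2" "\<theta>2 < \<theta>1" using dense by blast
  have \<theta>\<rho>: "0 < \<theta> * \<rho>" using \<rho>(1) m m\<theta> by (intro mult_pos_pos) auto
  have \<theta>2pos: "0 < \<theta>2" using \<theta>2(1) \<theta>\<rho> by (rule less_trans[rotated])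
  define \<epsilon> where "\<epsilon> = (\<theta>2 - \<theta> * \<rho>) / (10 * \<theta>2)"
  define e where "e = 1 - \<epsilon>"
  have \<epsilon>: "0 < \<epsilon>" "\<epsilon> < 1" "10 * \<epsilon> * \<theta>2 = \<theta>2 - \<theta> * \<rho>"
    using \<theta>2(1) \<theta>2pos \<theta>\<rho> by (auto simp: \<epsilon>_def field_simps)
  have e: "0 < e" "e < 1" using \<epsilon> by (auto simp: e_def)
  have e5: "\<theta> * \<rho> < e ^ 5 * \<theta>2"
  proof -
    have "1 - 5 * \<epsilon> \<le> e ^ 5" using Bernoulli_inequality[of "- \<epsilon>" 5] \<epsilon> by (simp add: e_def)
    then have "(1 - 5 * \<epsilon>) * \<theta>2 \<le> e ^ 5 * \<theta>2" using \<theta>2pos by (intro mult_right_mono) auto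
    moreover have "(1 - 5 * \<epsilon>) * \<theta>2 = \<theta>2 - 10 * \<epsilon> * \<theta>2 / 2" by (simp add: algebra_simps)
    ultimately show ?thesis using \<epsilon>(3) \<theta>2(1) by linarith
  qed
  have e5e: "e ^ 5 \<le> e" using e power_decreasing[of 1 5 e] by simp
  have \<rho>e: "\<rho> < e"
  proof -
    have "\<theta> * \<rho> < e ^ 5 * \<theta>2" by (rule e5)
    also have "\<dots> \<le> e * \<theta>" using e5e e \<theta>1 \<theta>2 \<theta>2pos by (intro mult_mono) auto
    finally show ?thesis using m m\<theta> by (simp add: mult.commute)
  qed
  obtain b0 c0 where bc: "b0 \<in> B" "c0 \<in> A - B" "\<theta>1 < \<Psi> {b0} * V b0 c0"
    using \<theta>1(2) b c bdd unfolding \<theta>_def by (subst (asm) less_cSUP_iff) auto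
  have b0: "0 < \<Psi> {b0}" "b0 \<in> A" using bc(1) B attractor_pos by auto
  have c0: "0 < \<Psi> {c0}" "c0 \<in> A" using bc(2) attractor_pos by auto
  have "\<theta>1 / \<Psi> {b0} < V b0 c0" using bc(3) b0 by (simp add: field_simps)
  then obtain Y s where Y: "0 \<le> s" "traj Y s = c0" "\<theta>1 / \<Psi> {b0} < \<Phi> b0 {Y}"
    by (rule less_reachE) (use \<theta>1 \<theta>2 \<theta>2pos b0 in auto)
  obtain \<delta> where \<delta>: "0 < \<delta>" "\<And>x. infdist x A < \<delta> \<Longrightarrow> \<exists>b\<in>A. e < V x b \<and> e < V b x"
    using attract_reach[OF e(2)] by blast
  obtain T where T: "0 \<le> T" "\<And>x Y. \<theta>2 \<le> \<Psi> {x} * \<Phi> x {Y} \<Longrightarrow> \<exists>s\<in>{0..T}. infdist (traj Y s) A < \<delta>"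
    using hitting_time[OF \<theta>2pos \<delta>(1)] by blast
  obtain Z where Z: "traj Z (s + T) = c0" "\<Phi> b0 {Y} \<le> \<Phi> b0 {Z}"
    using stay_path[OF c0(2) Y(2,1), of "s + T" b0] T(1) by auto
  have "\<theta>1 < \<Psi> {b0} * \<Phi> b0 {Y}" using Y(3) b0 by (simp add: field_simps)
  also have "\<dots> \<le> \<Psi> {b0} * \<Phi> b0 {Z}" using Z(2) b0 by simp
  finally have flow: "\<theta>1 < \<Psi> {b0} * \<Phi> b0 {Z}" .
  have "\<Psi> {b0} * \<Phi> b0 {Z} \<le> \<theta>2"
  proof (rule flow_balance[of "remote B \<rho>" "s + T" \<theta>2])
    show "closed (remote B \<rho>)" by (simp add: remote_def)
    show "0 \<le> s + T" using Y T by simp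
    show "0 < \<theta>2" by (rule \<theta>2pos)
    show "b0 \<notin> remote B \<rho>"
      using remote_reach_le[of b0 B \<rho> b0] b0 bc(1) \<rho> reach_self[of b0] by auto
    have "\<theta>1 < \<Psi> {c0}" using bc(3) reach_transport[of b0 c0] by linarith
    moreover have "m \<le> e ^ 5 * \<theta>2 * \<rho>" using m\<rho> mult_right_mono[OF less_imp_le[OF e5], of \<rho>] \<rho>(1) by linarith
    moreover have "e ^ 5 * \<theta>2 * \<rho> \<le> \<Psi> {c0} * (e * \<rho>)"
    proof -
      have "e ^ 5 * \<theta>2 \<le> e * \<Psi> {c0}"
        using e5e e \<theta>2 \<theta>2pos \<open>\<theta>1 < \<Psi> {c0}\<close> by (intro mult_mono) auto
      then have "e ^ 5 * \<theta>2 * \<rho> \<le> e * \<Psi> {c0} * \<rho>" using \<rho>(1) by (intro mult_right_mono) auto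
      then show ?thesis by (simp add: mult_ac)
    qed
    ultimately have "c0 \<in> interior (remote B \<rho>)"
      using inflow bc(2) by (intro interior_remote[OF c0(1) _ e, of B m]) auto
    then show "traj Z (s + T) \<in> interior (remote B \<rho>)" by (simp add: Z(1))
    show "\<Psi> {x} * \<Phi> x {Y} < \<theta>2"
      if "x \<in> remote B \<rho>" "traj Y (s + T) \<in> closure (- remote B \<rho>)" for x Y
      using remote_outflow[OF B e inflow outflow \<rho>(1) \<rho>e m\<rho> _ e5 \<delta>(2) T(2) _ that] m m\<theta> \<open>0 \<le> s\<close> by simp
  qed
  with flow \<theta>2 show False by simp
qed

section \<open>The tree formula\<close>

lemma tree_weight_eq:
  assumes g: "g \<in> in_trees A a"
  shows "tree_weight \<Phi> g = inf_prod (\<lambda>(b, c). V b c) (parcs g)"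
proof -
  have E: "parcs g \<subseteq> A \<times> A" using g by (auto simp: in_trees_iff in_tree_arcs_def)
  let ?v = "\<lambda>(b, c). limit_marginal \<Phi> b c" and ?V = "\<lambda>(b, c). V b c"
  have eq: "?v e = ?V e" if "e \<in> parcs g" for e
    using that E limit_marginal_eq_reach by (cases e) auto
  then have prod: "(\<Prod>e\<in>F. ?v e) = (\<Prod>e\<in>F. ?V e)" if "F \<subseteq> parcs g" for F
    using that by (intro prod.cong) auto
  show ?thesis
  proof (cases "finite (parcs g)")
    case True
    then show ?thesis
      using prod[of "parcs g"] reach_nonneg reach_le_1
      by (subst inf_prod_finite) (auto simp: tree_weight_def)
  next
    case False
    then show ?thesis
      using prod by (auto simp: tree_weight_def inf_prod_def intro!: INF_cong)
  qed
qed

lemma max_tree_weight_eq: "max_tree_weight \<Phi> A a = max_arc_weight (\<lambda>(b, c). V b c) A a"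
proof -
  have "tree_weight \<Phi> ` in_trees A a = inf_prod (\<lambda>(b, c). V b c) ` {E. in_tree_arcs A a E}" (is "?L = ?R")
  proof (intro equalityI subsetI)
    fix w assume "w \<in> ?L"
    then obtain g where "g \<in> in_trees A a" "w = tree_weight \<Phi> g" by blast
    then show "w \<in> ?R" using tree_weight_eq by (auto simp: in_trees_iff)
  next
    fix w assume "w \<in> ?R"
    then obtain E where E: "in_tree_arcs A a E" "w = inf_prod (\<lambda>(b, c). V b c) E" by blast
    let ?g = "\<lparr>pverts = A, parcs = E\<rparr>"
    have g: "?g \<in> in_trees A a" using E(1) by (simp add: in_trees_iff)
    moreover have "tree_weight \<Phi> ?g = w" using tree_weight_eq[OF g] E(2) by simp
    ultimately show "w \<in> ?L" by blast
  qed
  then show ?thesis by (simp add: max_tree_weight_def max_arc_weight_def)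
qed

lemma max_tree_weight_unit: "0 \<le> max_tree_weight \<Phi> A a" "max_tree_weight \<Phi> A a \<le> 1"
proof -
  have "inf_prod (\<lambda>(b, c). V b c) E \<in> {0..1}" for E
    using reach_nonneg by (intro inf_prod_in_unit) auto
  then have bnd: "0 \<le> w \<and> w \<le> 1" if "w \<in> inf_prod (\<lambda>(b, c). V b c) ` {E. in_tree_arcs A a E}" for w
    using that by (metis (no_types, lifting) atLeastAtMost_iff imageE)
  then show "0 \<le> max_tree_weight \<Phi> A a" "max_tree_weight \<Phi> A a \<le> 1"
    unfolding max_tree_weight_eq max_arc_weight_def
    by (auto intro!: sup0_nonneg[where c = 1] sup0_least)
qed

text \<open>
  The star with centre \<open>a\<close> is an in-tree of positive weight.
\<close>

lemma max_tree_weight_pos: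
  assumes "finite A" "a \<in> A"
  shows "0 < max_tree_weight \<Phi> A a"
proof -
  let ?E = "(A - {a}) \<times> {a}"
  have "0 < (\<Prod>e\<in>?E. (\<lambda>(b, c). V b c) e)"
    using assms reach_in_A_pos by (intro prod_pos) auto
  also have "\<dots> = inf_prod (\<lambda>(b, c). V b c) ?E"
    using assms reach_nonneg reach_le_1 by (intro inf_prod_finite[symmetric]) auto
  also have "\<dots> \<le> max_tree_weight \<Phi> A a"
    unfolding max_tree_weight_eq max_arc_weight_def
  proof (rule sup0_upper[where c = 1])
    show "inf_prod (\<lambda>(b, c). V b c) ?E \<in> inf_prod (\<lambda>(b, c). V b c) ` {E. in_tree_arcs A a E}"
      using in_tree_arcs_star[OF assms(2)] by blast
    show "w \<le> 1" if "w \<in> inf_prod (\<lambda>(b, c). V b c) ` {E. in_tree_arcs A a E}" for w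
      using that reach_nonneg inf_prod_in_unit[of _ "\<lambda>(b, c). V b c"] by force
  qed
  finally show ?thesis .
qed

theorem density_proportional_to_tree_weight:
  assumes a: "a \<in> A" and b: "b \<in> A"
  shows "max_tree_weight \<Phi> A a * \<Psi> {b} = max_tree_weight \<Phi> A b * \<Psi> {a}"
proof -
  let ?T = "max_tree_weight \<Phi> A" and ?V = "\<lambda>(b, c). V b c"
  have V: "0 < ?V (x, y) \<and> ?V (x, y) \<le> 1" if "x \<in> A" "y \<in> A" for x y
    using that reach_in_A_pos reach_le_1 by simp
  have le: "?T a / \<Psi> {a} \<le> ?T b / \<Psi> {b}" if "a \<in> A" "b \<in> A" for a b
  proof (rule max_balanced_ratio_le[where A = A and v = ?V and u = "\<lambda>x. \<Psi> {x}" and T = ?T])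
    show "0 < \<Psi> {x} \<and> \<Psi> {x} \<le> 1" if "x \<in> A" for x using attractor_pos[OF that] \<Psi>_unit by simp
    show "\<Psi> {b} * ?V (b, c) \<le> m" if "B \<subseteq> A" "b \<in> B" "c \<in> A - B"
      "\<And>c' b'. c' \<in> A - B \<Longrightarrow> b' \<in> B \<Longrightarrow> \<Psi> {c'} * ?V (c', b') \<le> m" for B b c m
      using cut_inequality[of B b c m] that by simp
    show "?T b * ?V (b, c) \<le> m" if "B \<subseteq> A" "b \<in> B" "c \<in> A - B"
      "\<And>c' b'. c' \<in> A - B \<Longrightarrow> b' \<in> B \<Longrightarrow> ?T c' * ?V (c', b') \<le> m" for B b c m
      unfolding max_tree_weight_eq
    proof (rule max_arc_weight_cut[where B = B])
      show "max_arc_weight ?V A c' * ?V (c', b') \<le> m" if "c' \<in> A - B" "b' \<in> A \<inter> B" for c' b'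
        using that \<open>\<And>c' b'. c' \<in> A - B \<Longrightarrow> b' \<in> B \<Longrightarrow> ?T c' * ?V (c', b') \<le> m\<close>[of c' b']
        by (simp add: max_tree_weight_eq)
    qed (use that V in auto)
  qed (use V max_tree_weight_unit finite_attractors_above that in auto)
  have "?T a / \<Psi> {a} = ?T b / \<Psi> {b}" using le[OF a b] le[OF b a] by simp
  then show ?thesis using attractor_pos[OF a] attractor_pos[OF b] by (simp add: field_simps)
qed

text \<open>
  As \<open>\<Psi>\<close> has supremum \<open>1\<close> on \<open>A\<close>, the constant of proportionality is the supremum of the tree weights.
\<close>

lemma density_eq_tree_weight_quotient:
  assumes nonzero: "infinite A \<Longrightarrow> sup0 (max_tree_weight \<Phi> A ` A) \<noteq> 0" and a: "a \<in> A"
  shows "sup0 (max_tree_weight \<Phi> A ` A) > 0 \<and>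
    \<Psi> {a} = max_tree_weight \<Phi> A a / sup0 (max_tree_weight \<Phi> A ` A)"
proof
  let ?T = "max_tree_weight \<Phi> A"
  let ?S = "sup0 (?T ` A)"
  have T_le: "?T b \<le> ?S" if "b \<in> A" for b
    using that max_tree_weight_unit by (intro sup0_upper[where c = 1]) auto
  show S: "0 < ?S"
  proof (cases "finite A")
    case True
    with max_tree_weight_pos[OF this a] T_le[OF a] show ?thesis by linarith
  next
    case False
    have "0 \<le> ?S" using max_tree_weight_unit by (intro sup0_nonneg[where c = 1]) auto
    with nonzero[OF False] show ?thesis by linarith
  qed
  have pos: "0 < \<Psi> {a}" by (rule attractor_pos[OF a])
  define k where "k = ?T a / \<Psi> {a}"
  have eq: "?T b = k * \<Psi> {b}" if "b \<in> A" for b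
    using density_proportional_to_tree_weight[OF a that] pos by (simp add: k_def field_simps)
  have "0 \<le> k" using max_tree_weight_unit pos by (simp add: k_def)
  have S_le: "?S \<le> k"
    using eq \<open>0 \<le> k\<close> \<Psi>_unit by (intro sup0_least) (auto intro!: mult_left_le)
  then have k: "0 < k" using S by linarith
  have "sup0 ((\<lambda>b. \<Psi> {b}) ` A) \<le> ?S / k"
  proof (rule sup0_least)
    show "y \<le> ?S / k" if "y \<in> (\<lambda>b. \<Psi> {b}) ` A" for y
      using that T_le eq k by (auto simp: pos_le_divide_eq mult.commute)
    show "0 \<le> ?S / k" using k S by simp
  qed
  then have "k \<le> ?S" using k by (simp add: sup_attractors pos_le_divide_eq)
  with S_le have "?S = k" by simp
  with eq[OF a] k show "\<Psi> {a} = ?T a / ?S" by simp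
qed

end

theorem lemma3p7:
  fixes M :: "'w measure"
    and X :: "nat \<Rightarrow> 'w \<Rightarrow> 's::metric_space cadlag"
    and P :: "nat \<Rightarrow> 's measure"
    and \<kappa> :: "nat \<Rightarrow> 's \<Rightarrow> 's cadlag measure"
    and \<Phi> :: "'s \<Rightarrow> 's cadlag set \<Rightarrow> real"
    and \<Psi> :: "'s set \<Rightarrow> real"
    and A :: "'s set"
    and a :: 's
  assumes prob: "prob_space M" and complete: "complete_measure M"
    and process: "\<And>n. cadlag_process M (X n)"
    and borel_P: "\<And>n. borel_prob (P n)"
    and stationary: "\<And>n t. t \<ge> 0 \<Longrightarrow> distr M borel (\<lambda>\<omega>. traj (X n \<omega>) t) = P n"
    and deviability: "\<And>x. deviability (\<Phi> x)"
    and H1_rcd: "\<And>n. regular_conditional_distribution M (X n) (\<lambda>\<omega>. traj (X n \<omega>) 0) (\<kappa> n)"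
    and H1_ld: "\<And>r xs x. strict_mono r \<Longrightarrow> (\<And>k. xs k \<in> msupport (P (r k))) \<Longrightarrow> xs \<longlonglongrightarrow> x \<Longrightarrow>
          ld_converges (\<lambda>k. \<kappa> (r k) (xs k)) r (\<Phi> x) \<and>
          (\<forall>Y. \<not> continuous_on {0..} (traj Y) \<longrightarrow> \<Phi> x {Y} = 0)"
    and H2_usc: "upper_semicontinuous (\<lambda>(x, Y). \<Phi> x {Y})"
    and H2_compact: "\<And>\<gamma> K. 0 < \<gamma> \<Longrightarrow> \<gamma> \<le> 1 \<Longrightarrow> compact K \<Longrightarrow> compact (\<Union>x\<in>K. {Y. \<Phi> x {Y} \<ge> \<gamma>})"
    and H3: "\<And>Y x s. s \<ge> 0 \<Longrightarrow> \<Phi> x {Y} = \<Phi> x (same_upto s Y) * \<Phi> (traj Y s) {shift_traj s Y}"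
    and H4_locally_finite: "\<And>K. compact K \<Longrightarrow> finite (K \<inter> A)"
    and H4_1: "\<And>x Y. \<Phi> x {Y} = 1 \<Longrightarrow> (INF t\<in>{0..}. infdist (traj Y t) A) = 0"
    and H4_2: "\<And>b Y. b \<in> A \<Longrightarrow> (\<And>t. t \<ge> 0 \<Longrightarrow> traj Y t = b) \<Longrightarrow> \<Phi> b {Y} = 1"
    and H4_3: "\<And>b b'. b \<in> A \<Longrightarrow> b' \<in> A \<Longrightarrow> \<exists>t>0. marginal \<Phi> b t b' > 0"
    and H4_4: "\<And>\<epsilon>. \<epsilon> > 0 \<Longrightarrow> \<exists>\<delta>>0. \<forall>x. infdist x A < \<delta> \<longrightarrow>
          (\<exists>s\<^sub>0>0. \<exists>s\<^sub>1>0. \<exists>b\<in>A. marginal \<Phi> x s\<^sub>0 b > 1 - \<epsilon> \<and> marginal \<Phi> b s\<^sub>1 x > 1 - \<epsilon>)"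
    and H4_5: "\<And>x \<epsilon>. \<epsilon> > 0 \<Longrightarrow> \<exists>\<delta>>0. \<exists>t\<^sub>0\<ge>0. \<exists>t\<^sub>1\<ge>0. \<forall>x'. dist x x' < \<delta> \<longrightarrow>
          marginal \<Phi> x t\<^sub>0 x' > 1 - \<epsilon> \<and> marginal \<Phi> x' t\<^sub>1 x > 1 - \<epsilon>"
    and H5: "\<And>K\<^sub>1 \<epsilon>. compact K\<^sub>1 \<Longrightarrow> \<epsilon> > 0 \<Longrightarrow> \<exists>K\<^sub>2. compact K\<^sub>2 \<and>
          Limsup at_top (\<lambda>t. ereal (sup0 ((\<lambda>x. marginal_set \<Phi> x t (UNIV - K\<^sub>2)) ` K\<^sub>1))) < ereal \<epsilon>"
    and tight: "exponentially_tight P"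
    and limit_point: "ld_limit_point P \<Psi>"
    and quotient_defined: "infinite A \<Longrightarrow> sup0 (max_tree_weight \<Phi> A ` A) \<noteq> 0"
    and a_in_A: "a \<in> A"
  shows "sup0 (max_tree_weight \<Phi> A ` A) > 0 \<and>
         \<Psi> {a} = max_tree_weight \<Phi> A a / sup0 (max_tree_weight \<Phi> A ` A)"
proof -
  from limit_point obtain r where r: "strict_mono r" "ld_converges (\<lambda>k. P (r k)) r \<Psi>"
    unfolding ld_limit_point_def by blast
  interpret ld: stationary_ld M X P \<kappa> \<Phi> \<Psi> r
    by (rule stationary_ld.intro)
      (fact prob process borel_P stationary deviability H1_rcd H1_ld tight r)+
  interpret stationary_deviability \<Phi> \<Psi> A
    by unfold_locales (fact deviability H2_usc H2_compact H3 H4_locally_finite H4_1 H4_2 H4_3 H4_4 H4_5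
      ld.deviability_\<Psi> ld.transport ld.path_starts_at ld.predecessor ld.flow_balance)+
  show ?thesis by (rule density_eq_tree_weight_quotient[OF quotient_defined a_in_A])
qed

end
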